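(* The following hold. (1) Every countable amenable group embeds in a finitely generated amenable group that is highly transitive and mixed identity free; likewise, every countable elementary amenable group embeds in a finitely generated elementary amenable group that is highly transitive and mixed identity free. (2) Every countable group without nonabelian free subgroups embeds in a finitely generated group without nonabelian free subgroups that is highly transitive and mixed identity free.
   Context: An action of a group on a set $\Omega$ is $k$-transitive if $|\Omega|\geq k$ and for all $k$-tuples $(x_1,\dots,x_k),(y_1,\dots,y_k)\in\Omega^k$, each with pairwise distinct entries, some group element $g$ satisfies $g\cdot x_i=y_i$ for all $1\le i\le k$. A faithful action is highly transitive if it is $k$-transitive for every $k\in\mathbb{N}$; an infinite group is called highly transitive if it admits a (faithful) highly transitive action. A group $H$ has a non-trivial mixed identity if there is a non-trivial element $W\in H*\mathbb{Z}$ such that every homomorphism $H*\mathbb{Z}\to H$ restricting to the identity on $H$ maps $W$ to the identity; if there is no such $W$, $H$ is mixed identity free. *)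

theory Defs
  imports Complex_Main "HOL-Library.Countable_Set" "HOL-Algebra.Elementary_Groups" "HOL-Algebra.Group_Action"
    "HOL-Algebra.Generated_Groups"
begin

section \<open>Groups presented by words\<close>

text \<open>The congruence on the words over the alphabet \<open>A\<close> that is generated by the pairs in \<open>R\<close>, and
  the quotient of the free monoid on \<open>A\<close> by it.\<close>

inductive word_cong :: "'x set \<Rightarrow> ('x list \<times> 'x list) set \<Rightarrow> 'x list \<Rightarrow> 'x list \<Rightarrow> bool"
  for A R where
  refl: "w \<in> lists A \<Longrightarrow> word_cong A R w w"
| sym: "word_cong A R u v \<Longrightarrow> word_cong A R v u"
| trans: "word_cong A R u v \<Longrightarrow> word_cong A R v w \<Longrightarrow> word_cong A R u w"
| rel: "(u, v) \<in> R \<Longrightarrow> p \<in> lists A \<Longrightarrow> q \<in> lists A \<Longrightarrow> u \<in> lists A \<Longrightarrow> v \<in> lists A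
    \<Longrightarrow> word_cong A R (p @ u @ q) (p @ v @ q)"

definition word_class :: "'x set \<Rightarrow> ('x list \<times> 'x list) set \<Rightarrow> 'x list \<Rightarrow> 'x list set" where
  "word_class A R u = {v. word_cong A R u v}"

definition presented :: "'x set \<Rightarrow> ('x list \<times> 'x list) set \<Rightarrow> 'x list set monoid" where
  "presented A R =
    \<lparr>carrier = word_class A R ` lists A,
     monoid.mult = (\<lambda>P Q. {w. \<exists>p\<in>P. \<exists>q\<in>Q. word_cong A R (p @ q) w}),
     one = word_class A R []\<rparr>"

text \<open>In the free group, the letters \<open>(x, True)\<close> and \<open>(x, False)\<close> stand for \<open>x\<close> and its inverse.\<close>

definition free_group :: "'x set \<Rightarrow> ('x \<times> bool) list set monoid" where
  "free_group X = presented (X \<times> UNIV) {([(x, b), (x, \<not> b)], []) | x b. x \<in> X}"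

definition free_product_rels ::
    "('a, 'c) monoid_scheme \<Rightarrow> ('b, 'd) monoid_scheme \<Rightarrow> (('a + 'b) list \<times> ('a + 'b) list) set" where
  "free_product_rels G H =
     {([Inl a, Inl b], [Inl (a \<otimes>\<^bsub>G\<^esub> b)]) | a b. a \<in> carrier G \<and> b \<in> carrier G} \<union>
     {([Inr a, Inr b], [Inr (a \<otimes>\<^bsub>H\<^esub> b)]) | a b. a \<in> carrier H \<and> b \<in> carrier H} \<union>
     {([Inl \<one>\<^bsub>G\<^esub>], []), ([Inr \<one>\<^bsub>H\<^esub>], [])}"

definition free_product ::
    "('a, 'c) monoid_scheme \<Rightarrow> ('b, 'd) monoid_scheme \<Rightarrow> ('a + 'b) list set monoid" where
  "free_product G H = presented (carrier G <+> carrier H) (free_product_rels G H)"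

definition free_product_inl ::
    "('a, 'c) monoid_scheme \<Rightarrow> ('b, 'd) monoid_scheme \<Rightarrow> 'a \<Rightarrow> ('a + 'b) list set" where
  "free_product_inl G H a = word_class (carrier G <+> carrier H) (free_product_rels G H) [Inl a]"

lemma word_cong_lists: "word_cong A R u v \<Longrightarrow> u \<in> lists A \<and> v \<in> lists A"
  by (induction rule: word_cong.induct) auto

lemma word_cong_append_left:
  assumes "word_cong A R u v" "w \<in> lists A" shows "word_cong A R (w @ u) (w @ v)"
  using assms
proof (induction rule: word_cong.induct)
  case (rel u v p q)
  then show ?case using word_cong.rel[of u v R "w @ p" A q] by simp
next
  case (refl v)
  then show ?case by (intro word_cong.refl) auto
qed (blast intro: word_cong.sym word_cong.trans)+

lemma word_cong_append_right:
  assumes "word_cong A R u v" "w \<in> lists A" shows "word_cong A R (u @ w) (v @ w)"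
  using assms
proof (induction rule: word_cong.induct)
  case (rel u v p q)
  then show ?case using word_cong.rel[of u v R p A "q @ w"] by simp
next
  case (refl v)
  then show ?case by (intro word_cong.refl) auto
qed (blast intro: word_cong.sym word_cong.trans)+

lemma word_cong_append:
  assumes "word_cong A R u u'" "word_cong A R v v'" shows "word_cong A R (u @ v) (u' @ v')"
  by (meson assms word_cong.trans word_cong_append_left word_cong_append_right word_cong_lists)

lemma word_class_eq_iff:
  "u \<in> lists A \<Longrightarrow> word_class A R u = word_class A R v \<longleftrightarrow> word_cong A R u v"
  unfolding word_class_def by (auto intro: word_cong.intros)

lemma mult_presented:
  assumes "u \<in> lists A" "v \<in> lists A"
  shows "word_class A R u \<otimes>\<^bsub>presented A R\<^esub> word_class A R v = word_class A R (u @ v)"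
  using assms unfolding presented_def word_class_def
  by (auto intro: word_cong.intros word_cong_append)

lemma monoid_presented: "monoid (presented A R)"
proof (rule monoidI)
  fix P Q assume "P \<in> carrier (presented A R)" "Q \<in> carrier (presented A R)"
  then obtain u v where "u \<in> lists A" "v \<in> lists A" "P = word_class A R u" "Q = word_class A R v"
    by (auto simp: presented_def)
  then show "P \<otimes>\<^bsub>presented A R\<^esub> Q \<in> carrier (presented A R)"
    by (simp add: mult_presented) (auto simp: presented_def)
next
  fix P Q S
  assume "P \<in> carrier (presented A R)" "Q \<in> carrier (presented A R)" "S \<in> carrier (presented A R)"
  then obtain u v w where "u \<in> lists A" "v \<in> lists A" "w \<in> lists A"
    "P = word_class A R u" "Q = word_class A R v" "S = word_class A R w"
    by (auto simp: presented_def)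
  then show "P \<otimes>\<^bsub>presented A R\<^esub> Q \<otimes>\<^bsub>presented A R\<^esub> S = P \<otimes>\<^bsub>presented A R\<^esub> (Q \<otimes>\<^bsub>presented A R\<^esub> S)"
    by (simp add: mult_presented)
next
  fix P assume "P \<in> carrier (presented A R)"
  then obtain u where u: "u \<in> lists A" "P = word_class A R u" by (auto simp: presented_def)
  have one: "\<one>\<^bsub>presented A R\<^esub> = word_class A R []" by (simp add: presented_def)
  show "\<one>\<^bsub>presented A R\<^esub> \<otimes>\<^bsub>presented A R\<^esub> P = P" "P \<otimes>\<^bsub>presented A R\<^esub> \<one>\<^bsub>presented A R\<^esub> = P"
    using u mult_presented[of "[]" A u R] mult_presented[of u A "[]" R] by (simp_all add: one)
qed (auto simp: presented_def)

lemma group_presented: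
  assumes inv: "\<And>x. x \<in> A \<Longrightarrow> \<exists>u\<in>lists A. word_cong A R (u @ [x]) []"
  shows "group (presented A R)"
proof -
  interpret monoid "presented A R" by (rule monoid_presented)
  have one: "\<one>\<^bsub>presented A R\<^esub> = word_class A R []" by (simp add: presented_def)
  have *: "\<exists>u\<in>lists A. word_cong A R (u @ w) []" if "w \<in> lists A" for w
    using that
  proof (induction w rule: list.induct)
    case Nil
    then show ?case by (auto intro!: bexI[of _ "[]"] word_cong.refl)
  next
    case (Cons x w)
    from Cons obtain u where u: "u \<in> lists A" "word_cong A R (u @ w) []" by auto
    from Cons.prems inv[of x] obtain v where v: "v \<in> lists A" "word_cong A R (v @ [x]) []" by force
    have "word_cong A R ((u @ (v @ [x])) @ w) ((u @ []) @ w)"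
      using u v Cons.prems by (intro word_cong_append_right word_cong_append_left) auto
    then have "word_cong A R ((u @ v) @ x # w) []"
      using u(2) word_cong.trans[of A R _ "u @ w" "[]"] by simp
    then show ?case using u v by (intro bexI[of _ "u @ v"]) auto
  qed
  show ?thesis
  proof (rule groupI)
    fix P assume "P \<in> carrier (presented A R)"
    then obtain w where w: "w \<in> lists A" "P = word_class A R w" by (auto simp: presented_def)
    with * obtain u where u: "u \<in> lists A" "word_cong A R (u @ w) []" by blast
    show "\<exists>y\<in>carrier (presented A R). y \<otimes>\<^bsub>presented A R\<^esub> P = \<one>\<^bsub>presented A R\<^esub>"
    proof (rule bexI[of _ "word_class A R u"])
      show "word_class A R u \<in> carrier (presented A R)" using u by (simp add: presented_def)
      show "word_class A R u \<otimes>\<^bsub>presented A R\<^esub> P = \<one>\<^bsub>presented A R\<^esub>"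
        using u w by (simp add: mult_presented one word_class_eq_iff)
    qed
  qed (auto simp: m_assoc)
qed

lemma group_free_group: "group (free_group X)"
  unfolding free_group_def
proof (rule group_presented)
  fix y :: "'a \<times> bool" assume "y \<in> X \<times> UNIV"
  then obtain x b where y: "y = (x, b)" "x \<in> X" by auto
  let ?R = "{([(x, b), (x, \<not> b)], []) | x b. x \<in> X}"
  have "([(x, \<not> b), (x, b)], []) \<in> ?R"
    using y(2) by force
  then have "word_cong (X \<times> UNIV) ?R ([] @ [(x, \<not> b), (x, b)] @ []) ([] @ [] @ [])"
    using y by (intro word_cong.rel) auto
  then show "\<exists>u\<in>lists (X \<times> UNIV). word_cong (X \<times> UNIV) ?R (u @ [y]) []"
    using y by (intro bexI[of _ "[(x, \<not> b)]"]) auto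
qed

lemma group_free_product:
  assumes "group G" "group H"
  shows "group (free_product G H)"
  unfolding free_product_def
proof (rule group_presented)
  interpret G: group G by fact
  interpret H: group H by fact
  let ?A = "carrier G <+> carrier H" and ?R = "free_product_rels G H"
  fix y assume "y \<in> ?A"
  then consider a where "y = Inl a" "a \<in> carrier G" | b where "y = Inr b" "b \<in> carrier H"
    by auto
  then show "\<exists>u\<in>lists ?A. word_cong ?A ?R (u @ [y]) []"
  proof cases
    case 1
    have m: "([Inl (inv\<^bsub>G\<^esub> a), Inl a], [Inl \<one>\<^bsub>G\<^esub>]) \<in> ?R"
      unfolding free_product_rels_def using 1 G.l_inv[of a] G.inv_closed[of a] by force
    have "word_cong ?A ?R ([] @ [Inl (inv\<^bsub>G\<^esub> a), Inl a] @ []) ([] @ [Inl \<one>\<^bsub>G\<^esub>] @ [])"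
      using 1 m by (intro word_cong.rel) auto
    moreover have "word_cong ?A ?R ([] @ [Inl \<one>\<^bsub>G\<^esub>] @ []) ([] @ [] @ [])"
      by (intro word_cong.rel) (auto simp: free_product_rels_def)
    ultimately have "word_cong ?A ?R ([Inl (inv\<^bsub>G\<^esub> a)] @ [y]) []"
      using 1 word_cong.trans by fastforce
    then show ?thesis using 1 by (intro bexI[of _ "[Inl (inv\<^bsub>G\<^esub> a)]"]) auto
  next
    case 2
    have m: "([Inr (inv\<^bsub>H\<^esub> b), Inr b], [Inr \<one>\<^bsub>H\<^esub>]) \<in> ?R"
      unfolding free_product_rels_def using 2 H.l_inv[of b] H.inv_closed[of b] by force
    have "word_cong ?A ?R ([] @ [Inr (inv\<^bsub>H\<^esub> b), Inr b] @ []) ([] @ [Inr \<one>\<^bsub>H\<^esub>] @ [])"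
      using 2 m by (intro word_cong.rel) auto
    moreover have "word_cong ?A ?R ([] @ [Inr \<one>\<^bsub>H\<^esub>] @ []) ([] @ [] @ [])"
      by (intro word_cong.rel) (auto simp: free_product_rels_def)
    ultimately have "word_cong ?A ?R ([Inr (inv\<^bsub>H\<^esub> b)] @ [y]) []"
      using 2 word_cong.trans by fastforce
    then show ?thesis using 2 by (intro bexI[of _ "[Inr (inv\<^bsub>H\<^esub> b)]"]) auto
  qed
qed


section \<open>Classes of groups\<close>

text \<open>Amenability of a discrete group: a left-invariant, finitely additive probability measure
  defined on all subsets.\<close>

definition amenable :: "('a, 'b) monoid_scheme \<Rightarrow> bool" where
  "amenable G \<longleftrightarrow> group G \<and>
     (\<exists>\<mu> :: 'a set \<Rightarrow> real.
        (\<forall>A. A \<subseteq> carrier G \<longrightarrow> 0 \<le> \<mu> A) \<and>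
        \<mu> (carrier G) = 1 \<and>
        (\<forall>A B. A \<subseteq> carrier G \<longrightarrow> B \<subseteq> carrier G \<longrightarrow> A \<inter> B = {} \<longrightarrow> \<mu> (A \<union> B) = \<mu> A + \<mu> B) \<and>
        (\<forall>g\<in>carrier G. \<forall>A. A \<subseteq> carrier G \<longrightarrow> \<mu> (g <#\<^bsub>G\<^esub> A) = \<mu> A))"

text \<open>The smallest class of groups that contains the finite and the abelian groups and is closed under
  subgroups, quotients, extensions and directed unions. All groups in the definition have their
  elements in one type \<open>'a\<close>, so quotients are taken up to isomorphism. This is no restriction: the
  subgroups and quotients of a group with elements in \<open>'a\<close> are no larger than the group, and by a
  theorem of Chou every elementary amenable group is obtained from finite and abelian groups by
  extensions and directed unions only; these never lead to a smaller group.\<close>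

inductive elementary_amenable :: "'a monoid \<Rightarrow> bool" where
  finite: "group G \<Longrightarrow> finite (carrier G) \<Longrightarrow> elementary_amenable G"
| abelian: "comm_group G \<Longrightarrow> elementary_amenable G"
| subgroup: "elementary_amenable G \<Longrightarrow> subgroup K G \<Longrightarrow> elementary_amenable (G\<lparr>carrier := K\<rparr>)"
| quotient: "elementary_amenable G \<Longrightarrow> N \<lhd> G \<Longrightarrow> group Q \<Longrightarrow> Q \<cong> G Mod N \<Longrightarrow> elementary_amenable Q"
| extension: "group G \<Longrightarrow> N \<lhd> G \<Longrightarrow> elementary_amenable (G\<lparr>carrier := N\<rparr>) \<Longrightarrow>
    elementary_amenable Q \<Longrightarrow> Q \<cong> G Mod N \<Longrightarrow> elementary_amenable G"
| directed_union: "group G \<Longrightarrow> \<K> \<noteq> {} \<Longrightarrow>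
    (\<And>K. K \<in> \<K> \<Longrightarrow> subgroup K G) \<Longrightarrow>
    (\<And>K. K \<in> \<K> \<Longrightarrow> elementary_amenable (G\<lparr>carrier := K\<rparr>)) \<Longrightarrow>
    (\<And>K L. K \<in> \<K> \<Longrightarrow> L \<in> \<K> \<Longrightarrow> \<exists>M\<in>\<K>. K \<union> L \<subseteq> M) \<Longrightarrow>
    \<Union>\<K> = carrier G \<Longrightarrow> elementary_amenable G"

lemma elementary_amenable_group: "elementary_amenable G \<Longrightarrow> group G"
  by (induction rule: elementary_amenable.induct)
    (auto simp: comm_group_def intro: subgroup.subgroup_is_group)

text \<open>A basis of a free subgroup of \<open>G\<close> consists of elements of \<open>G\<close>, so the basis may be taken to be a
  set over the type of the elements of \<open>G\<close>.\<close>

definition has_nonabelian_free_subgroup :: "('a, 'b) monoid_scheme \<Rightarrow> bool" where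
  "has_nonabelian_free_subgroup G \<longleftrightarrow>
     (\<exists>K (X :: 'a set). subgroup K G \<and> G\<lparr>carrier := K\<rparr> \<cong> free_group X \<and>
        \<not> comm_group (G\<lparr>carrier := K\<rparr>))"

definition finitely_generated :: "('a, 'b) monoid_scheme \<Rightarrow> bool" where
  "finitely_generated G \<longleftrightarrow>
     group G \<and> (\<exists>S. finite S \<and> S \<subseteq> carrier G \<and> generate G S = carrier G)"


section \<open>Highly transitive actions and mixed identities\<close>

definition k_transitive ::
    "nat \<Rightarrow> ('a, 'b) monoid_scheme \<Rightarrow> 'w set \<Rightarrow> ('a \<Rightarrow> 'w \<Rightarrow> 'w) \<Rightarrow> bool" where
  "k_transitive k G \<Omega> \<phi> \<longleftrightarrow> group_action G \<Omega> \<phi> \<and>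
     (infinite \<Omega> \<or> k \<le> card \<Omega>) \<and>
     (\<forall>xs ys. length xs = k \<longrightarrow> length ys = k \<longrightarrow> set xs \<subseteq> \<Omega> \<longrightarrow> set ys \<subseteq> \<Omega> \<longrightarrow>
        distinct xs \<longrightarrow> distinct ys \<longrightarrow>
        (\<exists>g\<in>carrier G. \<forall>i<k. \<phi> g (xs ! i) = ys ! i))"

definition highly_transitive_action ::
    "('a, 'b) monoid_scheme \<Rightarrow> 'w set \<Rightarrow> ('a \<Rightarrow> 'w \<Rightarrow> 'w) \<Rightarrow> bool" where
  "highly_transitive_action G \<Omega> \<phi> \<longleftrightarrow>
     faithful_action G \<Omega> \<phi> \<and> (\<forall>k. k_transitive k G \<Omega> \<phi>)"

text \<open>A set with a transitive action of \<open>G\<close> is in bijection with a set of coset representatives of a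
  point stabiliser, so it may be taken over the type of the elements of \<open>G\<close>.\<close>

definition highly_transitive :: "('a, 'b) monoid_scheme \<Rightarrow> bool" where
  "highly_transitive G \<longleftrightarrow> group G \<and> infinite (carrier G) \<and>
     (\<exists>(\<Omega> :: 'a set) \<phi>. highly_transitive_action G \<Omega> \<phi>)"

definition has_mixed_identity :: "('a, 'b) monoid_scheme \<Rightarrow> bool" where
  "has_mixed_identity G \<longleftrightarrow>
     (\<exists>W \<in> carrier (free_product G integer_group).
        W \<noteq> \<one>\<^bsub>free_product G integer_group\<^esub> \<and>
        (\<forall>\<phi> \<in> hom (free_product G integer_group) G.
           (\<forall>g\<in>carrier G. \<phi> (free_product_inl G integer_group g) = g) \<longrightarrow> \<phi> W = \<one>\<^bsub>G\<^esub>))"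

definition mixed_identity_free :: "('a, 'b) monoid_scheme \<Rightarrow> bool" where
  "mixed_identity_free G \<longleftrightarrow> group G \<and> \<not> has_mixed_identity G"

definition embeds :: "('a, 'b) monoid_scheme \<Rightarrow> ('c, 'd) monoid_scheme \<Rightarrow> bool" where
  "embeds H G \<longleftrightarrow> mon H G \<noteq> {}"

end

theory Submission
  imports Defs "HOL-Combinatorics.Permutations" "HOL-Algebra.Multiplicative_Group" "HOL-Analysis.Function_Topology"
begin

text \<open>
  The three classes are closed under subgroups, extensions and directed unions and contain the finite
  and the abelian groups, so one construction serves all of them. Enlarge the given group to an
  infinite group acting regularly on \<open>\<nat>\<close>, let \<open>Y = \<nat> \<times> \<int>\<close> carry the permutations \<open>h\<close> that act on
  the upper half of \<open>Y\<close> together with the shift \<open>s\<close> of \<open>\<int>\<close>, and consider the set \<open>Y \<times> \<int>\<close>. The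
  group is generated by the translation of the last coordinate, by a permutation that acts on sparse
  fibres by \<open>s\<close> and by the \<open>h\<close>'s, and by copies of the permutations of five points, placed along the
  set \<open>V\<close> of integers whose digits in base 5 are 0 and 1. Every finite part of this pattern recurs
  infinitely often, so no nontrivial element has finite support. At each scale the infinitely many
  fibres not seen before contribute an abelian group only, so apart from the translation the group is
  a directed union of groups built from finitely many fibres. Commutators of a pattern with a
  translate of it are sparser patterns; in the limit they become finitary permutations, whence high
  transitivity, and \<open>[h, s]\<close> recovers the given group.

  A highly transitive group without nontrivial finitely supported elements has no mixed identity: the
  images of the variable along the path of a point can be prescribed freely at ever new points.
\<close>

section \<open>Classes of groups closed under extensions and directed unions\<close>

text \<open>High transitivity calls for transpositions, but a transposition in the group would
  violate the infinite supports that exclude mixed identities. So transpositions occur only as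
  pointwise limits (\<open>closure_perm\<close>); this suffices because a tuple sees finitely many
  points.

  Five is also the size of the smallest nontrivial window, and the number of points moved by two
  3-cycles that meet in one point, whose commutator is again a 3-cycle.

  The given group may need infinitely many generators. One permutation carries them all, under
  infinitely many labels; its translates by 2 and by \<open>2 * 5 ^ Suc m\<close> make label 0 meet
  label \<open>Suc m\<close> and nothing else.

  Membership in a class is shown for large groups first (\<open>level\<close>,
  \<open>levels\<close>, \<open>envelope\<close>), whose quotients are visible; the finitely
  generated group inherits it as a subgroup.\<close>

lemma iso_restrict:
  assumes "group K" "group L" "f \<in> iso K L" "subgroup B K"
  shows "subgroup (f ` B) L" "f \<in> iso (K\<lparr>carrier := B\<rparr>) (L\<lparr>carrier := f ` B\<rparr>)"
proof -
  have hom: "group_hom K L f"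
    using assms by (simp add: group_hom_def group_hom_axioms_def iso_def)
  show "subgroup (f ` B) L"
    using hom assms(4) by (rule group_hom.subgroup_img_is_subgroup)
  have BK: "B \<subseteq> carrier K" using assms(4) by (rule subgroup.subset)
  show "f \<in> iso (K\<lparr>carrier := B\<rparr>) (L\<lparr>carrier := f ` B\<rparr>)"
    using assms(3) BK by (auto simp: iso_def hom_def bij_betw_def subset_iff intro: inj_on_subset)
qed

lemma countable_nat_copy:
  assumes "group K" "countable (carrier K)"
  obtains L :: "nat monoid" and f where "group L" "f \<in> iso K L"
proof -
  interpret K: group K by fact
  let ?f = "to_nat_on (carrier K)"
  let ?g = "inv_into (carrier K) ?f"
  let ?L = "\<lparr>carrier = ?f ` carrier K, monoid.mult = (\<lambda>x y. ?f (?g x \<otimes>\<^bsub>K\<^esub> ?g y)), one = ?f \<one>\<^bsub>K\<^esub>\<rparr> :: nat monoid"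
  have inj: "inj_on ?f (carrier K)" using assms(2) by (rule inj_on_to_nat_on)
  have g: "?g (?f x) = x" if "x \<in> carrier K" for x using inj that by simp
  have f: "?f \<in> iso K ?L"
    using inj by (auto simp: iso_def hom_def g bij_betw_def)
  have "group ?L"
  proof (rule groupI)
    fix x assume "x \<in> carrier ?L"
    then obtain a where a: "a \<in> carrier K" "x = ?f a" by auto
    then show "\<exists>y\<in>carrier ?L. y \<otimes>\<^bsub>?L\<^esub> x = \<one>\<^bsub>?L\<^esub>"
      by (intro bexI[of _ "?f (inv\<^bsub>K\<^esub> a)"]) (auto simp: g)
  qed (auto simp: g K.m_assoc)
  then show ?thesis using f that by blast
qed

lemma hom_restrict_subgroup:
  assumes "group K" "group Q" "\<pi> \<in> hom K Q" "subgroup B K"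
  shows "group (K\<lparr>carrier := B\<rparr>)" "subgroup (\<pi> ` B) Q" "\<pi> \<in> hom (K\<lparr>carrier := B\<rparr>) (Q\<lparr>carrier := \<pi> ` B\<rparr>)"
    "kernel (K\<lparr>carrier := B\<rparr>) (Q\<lparr>carrier := \<pi> ` B\<rparr>) \<pi> = B \<inter> kernel K Q \<pi>"
    "subgroup (kernel K Q \<pi>) K" "subgroup (B \<inter> kernel K Q \<pi>) K"
proof -
  have hom: "group_hom K Q \<pi>"
    using assms by (simp add: group_hom_def group_hom_axioms_def)
  have BK: "B \<subseteq> carrier K" using assms(4) by (rule subgroup.subset)
  show "group (K\<lparr>carrier := B\<rparr>)" using assms(4,1) by (rule subgroup.subgroup_is_group)
  show "subgroup (\<pi> ` B) Q" using hom assms(4) by (rule group_hom.subgroup_img_is_subgroup)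
  show "\<pi> \<in> hom (K\<lparr>carrier := B\<rparr>) (Q\<lparr>carrier := \<pi> ` B\<rparr>)"
    using assms(3) BK by (auto simp: hom_def subset_iff)
  show "kernel (K\<lparr>carrier := B\<rparr>) (Q\<lparr>carrier := \<pi> ` B\<rparr>) \<pi> = B \<inter> kernel K Q \<pi>"
    using BK by (auto simp: kernel_def)
  show k: "subgroup (kernel K Q \<pi>) K" using hom by (rule group_hom.subgroup_kernel)
  show "subgroup (B \<inter> kernel K Q \<pi>) K"
    using assms(4) k by (meson group.subgroups_Inter_pair assms(1))
qed

text \<open>In \<open>C_extension\<close> the map \<open>\<pi>\<close> may have a proper subgroup as
  its image. With a trivial kernel the axiom therefore also gives closure under subgroups and
  isomorphic copies (\<open>C_embed\<close>).\<close>

locale group_class =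
  fixes C :: "nat monoid \<Rightarrow> bool"
  assumes C_finite: "group G \<Longrightarrow> finite (carrier G) \<Longrightarrow> C G"
    and C_abelian: "comm_group G \<Longrightarrow> C G"
    and C_extension: "group K \<Longrightarrow> group Q \<Longrightarrow> \<pi> \<in> hom K Q \<Longrightarrow>
          C (K\<lparr>carrier := kernel K Q \<pi>\<rparr>) \<Longrightarrow> C Q \<Longrightarrow> C K"
    and C_union: "group G \<Longrightarrow> \<K> \<noteq> {} \<Longrightarrow>
          (\<And>K. K \<in> \<K> \<Longrightarrow> subgroup K G) \<Longrightarrow>
          (\<And>K. K \<in> \<K> \<Longrightarrow> C (G\<lparr>carrier := K\<rparr>)) \<Longrightarrow>
          (\<And>K L. K \<in> \<K> \<Longrightarrow> L \<in> \<K> \<Longrightarrow> \<exists>M\<in>\<K>. K \<union> L \<subseteq> M) \<Longrightarrow>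
          \<Union>\<K> = carrier G \<Longrightarrow> C G"
begin

text \<open>Carries \<open>C\<close>, which speaks of groups on \<open>nat\<close> only, over to
  countable groups on any type.\<close>

definition copy_in_class :: "'b monoid \<Rightarrow> bool" where
  "copy_in_class K \<longleftrightarrow> group K \<and> (\<exists>L f. group L \<and> C L \<and> f \<in> iso K L)"

text \<open>Makes sense for groups of any cardinality and spares the constructions a count of their
  elements. For elementary amenability it is essential: a derivation for a countable group may pass
  through uncountable ones.\<close>

definition locally_in_class :: "'b monoid \<Rightarrow> bool" where
  "locally_in_class K \<longleftrightarrow> group K \<and>
     (\<forall>B. subgroup B K \<longrightarrow> countable B \<longrightarrow> copy_in_class (K\<lparr>carrier := B\<rparr>))"

lemma C_embed:
  assumes "group K" "group Q" "\<pi> \<in> hom K Q" "inj_on \<pi> (carrier K)" "C Q"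
  shows "C K"
proof (rule C_extension[OF assms(1-3) _ assms(5)])
  interpret group_hom K Q \<pi> using assms by (simp add: group_hom_def group_hom_axioms_def)
  have "kernel K Q \<pi> = {\<one>\<^bsub>K\<^esub>}" using assms(4) inj_iff_trivial_ker by auto
  moreover have "group (K\<lparr>carrier := kernel K Q \<pi>\<rparr>)"
    using subgroup_kernel assms(1) by (rule subgroup.subgroup_is_group)
  ultimately show "C (K\<lparr>carrier := kernel K Q \<pi>\<rparr>)" by (intro C_finite) auto
qed

lemma copy_in_class_embed:
  assumes "group K" "copy_in_class Q" "\<pi> \<in> hom K Q" "inj_on \<pi> (carrier K)"
  shows "copy_in_class K"
proof -
  obtain L f where L: "group L" "C L" "f \<in> iso Q L" and Q: "group Q"
    using assms(2) by (auto simp: copy_in_class_def)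
  have "inj_on f (carrier Q)" using L(3) by (auto simp: iso_def bij_betw_def)
  moreover have img: "\<pi> ` carrier K \<subseteq> carrier Q" using assms(3) by (auto simp: hom_def)
  ultimately have inj: "inj_on (f \<circ> \<pi>) (carrier K)"
    using assms(4) by (intro comp_inj_on) (auto intro: inj_on_subset)
  have fh: "f \<circ> \<pi> \<in> hom K L" using hom_compose[OF assms(3) iso_imp_homomorphism[OF L(3)]] .
  have "countable ((f \<circ> \<pi>) ` carrier K)" by auto
  then have "countable (carrier K)" using inj countable_image_inj_on by blast
  obtain M :: "nat monoid" and g where M: "group M" "g \<in> iso K M"
    by (rule countable_nat_copy[OF assms(1) \<open>countable (carrier K)\<close>])
  let ?g = "inv_into (carrier K) g"
  have g': "?g \<in> iso M K" using M(2) assms(1) group.iso_set_sym by blast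
  have "C M"
  proof (rule C_embed[OF M(1) L(1) _ _ L(2)])
    show "(f \<circ> \<pi>) \<circ> ?g \<in> hom M L"
      using hom_compose[OF iso_imp_homomorphism[OF g'] fh] .
    have b: "bij_betw ?g (carrier M) (carrier K)" using g' by (auto simp: iso_def)
    show "inj_on ((f \<circ> \<pi>) \<circ> ?g) (carrier M)"
      using inj b comp_inj_on[of ?g "carrier M" "f \<circ> \<pi>"] by (simp add: bij_betw_def)
  qed
  then show ?thesis using M assms(1) by (auto simp: copy_in_class_def)
qed

lemma copy_in_class_C: "copy_in_class L \<Longrightarrow> C L"
  unfolding copy_in_class_def
  using C_embed[of L] by (auto simp: iso_def bij_betw_def)

lemma locally_in_class_countable:
  assumes "locally_in_class K" "countable (carrier K)"
  shows "copy_in_class K"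
proof -
  have "group K" using assms(1) by (simp add: locally_in_class_def)
  then have "subgroup (carrier K) K" by (rule group.subgroup_self)
  with assms have "copy_in_class (K\<lparr>carrier := carrier K\<rparr>)" unfolding locally_in_class_def by blast
  then show ?thesis by simp
qed

lemma locally_in_class_embed:
  assumes "group K" "locally_in_class Q" "\<pi> \<in> hom K Q" "inj_on \<pi> (carrier K)"
  shows "locally_in_class K"
  unfolding locally_in_class_def
proof (intro conjI allI impI)
  fix B assume B: "subgroup B K" "countable B"
  have Q: "group Q" using assms(2) by (simp add: locally_in_class_def)
  note r = hom_restrict_subgroup[OF assms(1) Q assms(3) B(1)]
  have "copy_in_class (Q\<lparr>carrier := \<pi> ` B\<rparr>)"
    using assms(2) r(2) B(2) by (auto simp: locally_in_class_def)
  then show "copy_in_class (K\<lparr>carrier := B\<rparr>)"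
    using r(1,3) inj_on_subset[OF assms(4) subgroup.subset[OF B(1)]]
    by - (rule copy_in_class_embed[where \<pi> = \<pi> and Q = "Q\<lparr>carrier := \<pi> ` B\<rparr>"], simp_all)
qed fact

lemma copy_in_class_locally: "copy_in_class K \<Longrightarrow> locally_in_class K"
  unfolding locally_in_class_def
proof (intro conjI allI impI)
  fix B assume K: "copy_in_class K" and B: "subgroup B K"
  then have "group K" by (simp add: copy_in_class_def)
  then have "group (K\<lparr>carrier := B\<rparr>)" by (rule subgroup.subgroup_is_group[OF B])
  then show "copy_in_class (K\<lparr>carrier := B\<rparr>)"
    using subgroup.subset[OF B] K
    by - (rule copy_in_class_embed[where \<pi> = "\<lambda>x. x" and Q = K], auto simp: hom_def)
qed (simp add: copy_in_class_def)

lemma copy_in_class_finite: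
  assumes "group K" "finite (carrier K)"
  shows "copy_in_class K"
proof -
  obtain L :: "nat monoid" and f where L: "group L" "f \<in> iso K L"
    by (rule countable_nat_copy[OF assms(1) countable_finite[OF assms(2)]])
  then have "finite (carrier L)"
    using assms(2) bij_betw_finite[of f "carrier K" "carrier L"] by (simp add: iso_def)
  then show ?thesis using L assms(1) C_finite by (auto simp: copy_in_class_def)
qed

lemma copy_in_class_abelian:
  assumes "comm_group K" "countable (carrier K)"
  shows "copy_in_class K"
proof -
  have K: "group K" using assms(1) by (simp add: comm_group_def)
  obtain L :: "nat monoid" and f where L: "group L" "f \<in> iso K L"
    by (rule countable_nat_copy[OF K assms(2)])
  have "comm_group L"
    using comm_group.iso_imp_comm_group[OF assms(1) is_isoI[OF L(2)]] L(1) group.is_monoid by blast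
  then show ?thesis using L K C_abelian by (auto simp: copy_in_class_def)
qed

lemma copy_in_class_extension:
  assumes K: "group K" "countable (carrier K)" and Q: "copy_in_class Q" and \<pi>: "\<pi> \<in> hom K Q"
    and ker: "copy_in_class (K\<lparr>carrier := kernel K Q \<pi>\<rparr>)"
  shows "copy_in_class K"
proof -
  obtain L g where L: "group L" "C L" "g \<in> iso Q L" and Q: "group Q"
    using Q by (auto simp: copy_in_class_def)
  obtain M :: "nat monoid" and f where M: "group M" "f \<in> iso K M"
    by (rule countable_nat_copy[OF K])
  let ?f = "inv_into (carrier K) f"
  let ?p = "g \<circ> \<pi> \<circ> ?f"
  have f': "?f \<in> iso M K" using M(2) K group.iso_set_sym by blast
  have p: "?p \<in> hom M L" using hom_compose[OF hom_compose[OF iso_imp_homomorphism[OF f'] \<pi>] iso_imp_homomorphism[OF L(3)]]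
    by (simp add: comp_assoc)
  let ?k = "kernel M L ?p"
  have sk: "subgroup ?k M" using p M(1) L(1)
    by (intro group_hom.subgroup_kernel) (simp add: group_hom_def group_hom_axioms_def)
  \<comment> \<open>The kernel of the transported map need only inject into the given kernel, since
    \<open>copy_in_class_embed\<close> takes care of subgroups.\<close>
  have "?f ` ?k \<subseteq> kernel K Q \<pi>"
  proof
    fix x assume "x \<in> ?f ` ?k"
    then obtain y where y: "y \<in> carrier M" "g (\<pi> (?f y)) = \<one>\<^bsub>L\<^esub>" "x = ?f y" by (auto simp: kernel_def)
    have x: "x \<in> carrier K" using y f' by (auto simp: iso_def hom_def)
    then have "\<pi> x \<in> carrier Q" using \<pi> by (auto simp: hom_def)
    moreover have "g \<one>\<^bsub>Q\<^esub> = \<one>\<^bsub>L\<^esub>" using L Q by (auto simp: iso_def hom_one)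
    moreover have "inj_on g (carrier Q)" using L(3) by (auto simp: iso_def bij_betw_def)
    ultimately have "\<pi> x = \<one>\<^bsub>Q\<^esub>" using y Q by (metis group.is_monoid inj_onD monoid.one_closed)
    then show "x \<in> kernel K Q \<pi>" using x by (simp add: kernel_def)
  qed
  then have "?f \<in> hom (M\<lparr>carrier := ?k\<rparr>) (K\<lparr>carrier := kernel K Q \<pi>\<rparr>)"
    using f' subgroup.subset[OF sk] by (auto simp: hom_def iso_def subset_iff image_subset_iff)
  moreover have "inj_on ?f ?k"
    using f' subgroup.subset[OF sk] by (auto simp: iso_def bij_betw_def intro: inj_on_subset)
  ultimately have "copy_in_class (M\<lparr>carrier := ?k\<rparr>)"
    using subgroup.subgroup_is_group[OF sk M(1)] by - (rule copy_in_class_embed[OF _ ker], auto)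
  then have "C M" using C_extension[OF M(1) L(1) p _ L(2)] copy_in_class_C by blast
  then show ?thesis using M K by (auto simp: copy_in_class_def)
qed

lemma locally_in_class_extension:
  assumes K: "group K" and Q: "locally_in_class Q" and \<pi>: "\<pi> \<in> hom K Q"
    and ker: "locally_in_class (K\<lparr>carrier := kernel K Q \<pi>\<rparr>)"
  shows "locally_in_class K"
  unfolding locally_in_class_def
proof (intro conjI allI impI)
  fix B assume B: "subgroup B K" "countable B"
  have Q': "group Q" using Q by (simp add: locally_in_class_def)
  note r = hom_restrict_subgroup[OF K Q' \<pi> B(1)]
  show "copy_in_class (K\<lparr>carrier := B\<rparr>)"
  proof (rule copy_in_class_extension[OF r(1) _ _ r(3)])
    show "copy_in_class (Q\<lparr>carrier := \<pi> ` B\<rparr>)"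
      using Q r(2) B(2) by (auto simp: locally_in_class_def)
    have "subgroup (B \<inter> kernel K Q \<pi>) (K\<lparr>carrier := kernel K Q \<pi>\<rparr>)"
      using r(5,6) K by (simp add: group.subgroup_incl)
    then show "copy_in_class (K\<lparr>carrier := B\<rparr>
       \<lparr>carrier := kernel (K\<lparr>carrier := B\<rparr>) (Q\<lparr>carrier := \<pi> ` B\<rparr>) \<pi>\<rparr>)"
      using ker B(2) by (auto simp: locally_in_class_def r(4))
  qed (use B in auto)
qed fact

lemma copy_in_class_union:
  assumes G: "group G" "countable (carrier G)" and ne: "\<K> \<noteq> {}"
    and sub: "\<And>K. K \<in> \<K> \<Longrightarrow> subgroup K G"
    and inC: "\<And>K. K \<in> \<K> \<Longrightarrow> copy_in_class (G\<lparr>carrier := K\<rparr>)"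
    and dir: "\<And>K L. K \<in> \<K> \<Longrightarrow> L \<in> \<K> \<Longrightarrow> \<exists>M\<in>\<K>. K \<union> L \<subseteq> M"
    and un: "\<Union>\<K> = carrier G"
  shows "copy_in_class G"
proof -
  obtain L :: "nat monoid" and f where L: "group L" "f \<in> iso G L"
    by (rule countable_nat_copy[OF G])
  have "C L"
  proof (rule C_union[OF L(1), of "(`) f ` \<K>"])
    show "(`) f ` \<K> \<noteq> {}" using ne by auto
    show "\<Union>((`) f ` \<K>) = carrier L" using un L(2) by (simp add: iso_def bij_betw_def flip: image_Union)
    fix K assume "K \<in> (`) f ` \<K>"
    then obtain B where B: "B \<in> \<K>" "K = f ` B" by auto
    note r = iso_restrict[OF G(1) L sub[OF B(1)]]
    show "subgroup K L" using r B by simp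
    have "inv_into B f \<in> iso (L\<lparr>carrier := K\<rparr>) (G\<lparr>carrier := B\<rparr>)"
      using group.iso_set_sym[OF subgroup.subgroup_is_group[OF sub[OF B(1)] G(1)] r(2)] B by simp
    moreover have "group (L\<lparr>carrier := K\<rparr>)" using subgroup.subgroup_is_group[OF r(1) L(1)] B by simp
    ultimately show "C (L\<lparr>carrier := K\<rparr>)"
      using inC[OF B(1)] copy_in_class_embed[of "L\<lparr>carrier := K\<rparr>" "G\<lparr>carrier := B\<rparr>" "inv_into B f"]
      by (intro copy_in_class_C) (simp add: iso_def bij_betw_def)
  next
    fix K K' assume "K \<in> (`) f ` \<K>" "K' \<in> (`) f ` \<K>"
    then obtain B B' where B: "B \<in> \<K>" "K = f ` B" "B' \<in> \<K>" "K' = f ` B'" by auto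
    then obtain M where "M \<in> \<K>" "B \<union> B' \<subseteq> M" using dir by blast
    then show "\<exists>M\<in>(`) f ` \<K>. K \<union> K' \<subseteq> M" using B by (intro bexI[of _ "f ` M"]) auto
  qed
  then show ?thesis using L G by (auto simp: copy_in_class_def)
qed

text \<open>A countable subgroup \<open>B\<close> is the directed union of its intersections with
  the members of \<open>\<K>\<close>, and each intersection is a countable subgroup of a
  member.\<close>

lemma locally_in_class_union:
  assumes G: "group G" and ne: "\<K> \<noteq> {}"
    and sub: "\<And>K. K \<in> \<K> \<Longrightarrow> subgroup K G"
    and inC: "\<And>K. K \<in> \<K> \<Longrightarrow> locally_in_class (G\<lparr>carrier := K\<rparr>)"
    and dir: "\<And>K L. K \<in> \<K> \<Longrightarrow> L \<in> \<K> \<Longrightarrow> \<exists>M\<in>\<K>. K \<union> L \<subseteq> M"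
    and un: "\<Union>\<K> = carrier G"
  shows "locally_in_class G"
  unfolding locally_in_class_def
proof (intro conjI allI impI)
  fix B assume B: "subgroup B G" "countable B"
  have BG: "B \<subseteq> carrier G" using B(1) by (rule subgroup.subset)
  have sI: "subgroup (B \<inter> K) G" if "K \<in> \<K>" for K
    by (rule group.subgroups_Inter_pair[OF G B(1) sub[OF that]])
  show "copy_in_class (G\<lparr>carrier := B\<rparr>)"
  proof (rule copy_in_class_union[of _ "(\<inter>) B ` \<K>"])
    show "group (G\<lparr>carrier := B\<rparr>)" by (rule subgroup.subgroup_is_group[OF B(1) G])
    show "\<Union> ((\<inter>) B ` \<K>) = carrier (G\<lparr>carrier := B\<rparr>)" using un BG by auto
    fix K assume "K \<in> (\<inter>) B ` \<K>"
    then obtain K' where K': "K' \<in> \<K>" "K = B \<inter> K'" by auto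
    show "subgroup K (G\<lparr>carrier := B\<rparr>)"
      using sI[OF K'(1)] K' B(1) G by (simp add: group.subgroup_incl)
    have "subgroup K (G\<lparr>carrier := K'\<rparr>)"
      using sI[OF K'(1)] K' sub G by (simp add: group.subgroup_incl)
    then show "copy_in_class (G\<lparr>carrier := B\<rparr>\<lparr>carrier := K\<rparr>)"
      using inC[OF K'(1)] K' B(2) by (auto simp: locally_in_class_def)
  next
    fix K L assume "K \<in> (\<inter>) B ` \<K>" "L \<in> (\<inter>) B ` \<K>"
    then obtain K' L' where *: "K' \<in> \<K>" "K = B \<inter> K'" "L' \<in> \<K>" "L = B \<inter> L'" by auto
    then obtain M where "M \<in> \<K>" "K' \<union> L' \<subseteq> M" using dir by blast
    then show "\<exists>M\<in>(\<inter>) B ` \<K>. K \<union> L \<subseteq> M" using * by (intro bexI[of _ "B \<inter> M"]) auto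
  qed (use B ne in auto)
qed fact

lemma locally_in_class_abelian: "comm_group K \<Longrightarrow> locally_in_class K"
  unfolding locally_in_class_def
proof (intro conjI allI impI)
  assume K: "comm_group K"
  interpret comm_group K by fact
  show "group K" by (rule is_group)
  fix B assume B: "subgroup B K" "countable B"
  have "comm_group (K\<lparr>carrier := B\<rparr>)"
    using subgroup.subset[OF B(1)] m_comm
    by (intro group.group_comm_groupI subgroup.subgroup_is_group[OF B(1)] is_group) auto
  then show "copy_in_class (K\<lparr>carrier := B\<rparr>)" using B(2) by (intro copy_in_class_abelian) auto
qed

lemma locally_in_class_finite: "group K \<Longrightarrow> finite (carrier K) \<Longrightarrow> locally_in_class K"
  by (intro copy_in_class_locally copy_in_class_finite)

end

section \<open>Sets of permutations as groups\<close>

definition perm_group :: "('b \<Rightarrow> 'b) set \<Rightarrow> bool" where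
  "perm_group A \<longleftrightarrow> id \<in> A \<and> (\<forall>f\<in>A. bij f \<and> inv_into UNIV f \<in> A) \<and> (\<forall>f\<in>A. \<forall>g\<in>A. f \<circ> g \<in> A)"

definition perm_monoid :: "('b \<Rightarrow> 'b) set \<Rightarrow> ('b \<Rightarrow> 'b) monoid" where
  "perm_monoid A = \<lparr>carrier = A, monoid.mult = (\<circ>), one = id\<rparr>"

lemma perm_monoid_simps [simp]:
  "carrier (perm_monoid A) = A" "f \<otimes>\<^bsub>perm_monoid A\<^esub> g = f \<circ> g" "\<one>\<^bsub>perm_monoid A\<^esub> = id" "perm_monoid A\<lparr>carrier := B\<rparr> = perm_monoid B"
  by (simp_all add: perm_monoid_def)

lemma perm_groupI:
  assumes "id \<in> A" "\<And>f. f \<in> A \<Longrightarrow> bij f" "\<And>f. f \<in> A \<Longrightarrow> inv_into UNIV f \<in> A"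
    "\<And>f g. f \<in> A \<Longrightarrow> g \<in> A \<Longrightarrow> f \<circ> g \<in> A"
  shows "perm_group A"
  using assms by (auto simp: perm_group_def)

lemma perm_groupD:
  assumes "perm_group A"
  shows "id \<in> A" "f \<in> A \<Longrightarrow> bij f" "f \<in> A \<Longrightarrow> inv_into UNIV f \<in> A" "f \<in> A \<Longrightarrow> g \<in> A \<Longrightarrow> f \<circ> g \<in> A"
  using assms by (auto simp: perm_group_def)

lemma group_perm_monoid:
  assumes "perm_group A"
  shows "group (perm_monoid A)"
proof (rule groupI)
  fix f assume "f \<in> carrier (perm_monoid A)"
  then show "\<exists>g\<in>carrier (perm_monoid A). g \<otimes>\<^bsub>perm_monoid A\<^esub> f = \<one>\<^bsub>perm_monoid A\<^esub>"
    using perm_groupD[OF assms] by (intro bexI[of _ "inv_into UNIV f"]) (auto simp: bij_is_inj)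
qed (use perm_groupD[OF assms] in \<open>auto simp: comp_assoc\<close>)

lemma inv_perm_monoid:
  assumes "perm_group A" "f \<in> A"
  shows "inv\<^bsub>perm_monoid A\<^esub> f = inv_into UNIV f"
  using perm_groupD[OF assms(1)] assms(2)
  by (intro group.inv_equality group_perm_monoid assms(1)) (auto simp: bij_is_inj)

lemma subgroup_perm_monoid:
  assumes "perm_group A" "perm_group B" "B \<subseteq> A"
  shows "subgroup B (perm_monoid A)"
  using perm_groupD[OF assms(2)] assms(3) inv_perm_monoid[OF assms(1)]
  by (intro subgroup.intro) (auto simp: subset_iff)

lemma subgroup_perm_monoid_perm_group:
  assumes "perm_group A" "subgroup B (perm_monoid A)"
  shows "perm_group B"
proof -
  have "B \<subseteq> A" using subgroup.subset[OF assms(2)] by simp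
  then show ?thesis
    using subgroup.one_closed[OF assms(2)] subgroup.m_closed[OF assms(2)]
      subgroup.m_inv_closed[OF assms(2)] inv_perm_monoid[OF assms(1)] perm_groupD(2)[OF assms(1)]
    by (intro perm_groupI) (auto simp: subset_iff)
qed

lemma perm_group_bij: "perm_group {f. bij f}"
  by (intro perm_groupI) (auto simp: bij_imp_bij_inv intro: bij_comp)

context group_class begin

definition perm_in_class :: "('b \<Rightarrow> 'b) set \<Rightarrow> bool" where
  "perm_in_class A \<longleftrightarrow> perm_group A \<and> locally_in_class (perm_monoid A)"

lemma perm_in_class_subset:
  assumes "perm_in_class A" "perm_group B" "B \<subseteq> A"
  shows "perm_in_class B"
proof -
  have "locally_in_class (perm_monoid B)"
    using assms group_perm_monoid[OF assms(2)]
    by - (rule locally_in_class_embed[where Q = "perm_monoid A" and \<pi> = "\<lambda>x. x"], auto simp: perm_in_class_def hom_def)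
  then show ?thesis using assms by (simp add: perm_in_class_def)
qed

lemma perm_in_class_abelian:
  assumes "perm_group A" "\<And>f g. f \<in> A \<Longrightarrow> g \<in> A \<Longrightarrow> f \<circ> g = g \<circ> f"
  shows "perm_in_class A"
  unfolding perm_in_class_def
  using assms by (auto intro!: locally_in_class_abelian group.group_comm_groupI group_perm_monoid)

lemma perm_in_class_finite: "perm_group A \<Longrightarrow> finite A \<Longrightarrow> perm_in_class A"
  unfolding perm_in_class_def by (auto intro!: locally_in_class_finite group_perm_monoid)

lemma perm_in_class_union:
  assumes A: "perm_group A" and ne: "\<K> \<noteq> {}"
    and inC: "\<And>K. K \<in> \<K> \<Longrightarrow> perm_in_class K"
    and dir: "\<And>K L. K \<in> \<K> \<Longrightarrow> L \<in> \<K> \<Longrightarrow> \<exists>M\<in>\<K>. K \<union> L \<subseteq> M"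
    and un: "\<Union>\<K> = A"
  shows "perm_in_class A"
proof -
  have "locally_in_class (perm_monoid A)"
  proof (rule locally_in_class_union[OF group_perm_monoid[OF A] ne])
    fix K assume "K \<in> \<K>"
    then show "subgroup K (perm_monoid A)" "locally_in_class (perm_monoid A\<lparr>carrier := K\<rparr>)"
      using un inC A by (auto intro!: subgroup_perm_monoid simp: perm_in_class_def)
  qed (use dir un in auto)
  then show ?thesis using A by (simp add: perm_in_class_def)
qed

text \<open>The homomorphism to \<open>Q\<close> is given as a single-valued relation. It can then
  be described by a property of its value, such as agreement off a finite set, without naming the
  value.\<close>

lemma perm_in_class_extension:
  assumes A: "perm_group A" and Q: "locally_in_class Q"
    and total: "\<And>f. f \<in> A \<Longrightarrow> \<exists>q\<in>carrier Q. R f q"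
    and mult: "\<And>f g p q. f \<in> A \<Longrightarrow> g \<in> A \<Longrightarrow> p \<in> carrier Q \<Longrightarrow> q \<in> carrier Q \<Longrightarrow>
      R f p \<Longrightarrow> R g q \<Longrightarrow> R (f \<circ> g) (p \<otimes>\<^bsub>Q\<^esub> q)"
    and single: "\<And>f p q. f \<in> A \<Longrightarrow> p \<in> carrier Q \<Longrightarrow> q \<in> carrier Q \<Longrightarrow> R f p \<Longrightarrow> R f q \<Longrightarrow> p = q"
    and ker: "perm_group {f \<in> A. R f \<one>\<^bsub>Q\<^esub>} \<Longrightarrow> perm_in_class {f \<in> A. R f \<one>\<^bsub>Q\<^esub>}"
  shows "perm_in_class A"
proof -
  define \<pi> where "\<pi> f = (SOME q. q \<in> carrier Q \<and> R f q)" for f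
  have \<pi>: "\<pi> f \<in> carrier Q" "R f (\<pi> f)" if "f \<in> A" for f
    using someI_ex[of "\<lambda>q. q \<in> carrier Q \<and> R f q"] total[OF that] unfolding \<pi>_def by blast+
  have \<pi>_eq: "\<pi> f = q" if "f \<in> A" "q \<in> carrier Q" "R f q" for f q
    using single \<pi> that by blast
  have gQ: "group Q" using Q by (simp add: locally_in_class_def)
  have hom: "\<pi> \<in> hom (perm_monoid A) Q"
    using \<pi> mult perm_groupD(4)[OF A] gQ
    by (auto simp: hom_def intro!: \<pi>_eq monoid.m_closed group.is_monoid)
  have k: "kernel (perm_monoid A) Q \<pi> = {f \<in> A. R f \<one>\<^bsub>Q\<^esub>}"
  proof (intro equalityI subsetI)
    fix f assume "f \<in> kernel (perm_monoid A) Q \<pi>"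
    then have "f \<in> A" "\<pi> f = \<one>\<^bsub>Q\<^esub>" by (auto simp: kernel_def)
    then show "f \<in> {f \<in> A. R f \<one>\<^bsub>Q\<^esub>}" using \<pi>(2)[of f] by simp
  qed (use gQ in \<open>auto simp: kernel_def group.is_monoid intro!: \<pi>_eq\<close>)
  have "subgroup (kernel (perm_monoid A) Q \<pi>) (perm_monoid A)"
    using hom gQ group_perm_monoid[OF A]
    by (intro group_hom.subgroup_kernel) (simp add: group_hom_def group_hom_axioms_def)
  then have "perm_group {f \<in> A. R f \<one>\<^bsub>Q\<^esub>}" unfolding k by (rule subgroup_perm_monoid_perm_group[OF A])
  from ker[OF this] have "locally_in_class (perm_monoid {f \<in> A. R f \<one>\<^bsub>Q\<^esub>})" by (simp add: perm_in_class_def)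
  then have "locally_in_class (perm_monoid A)"
    by (intro locally_in_class_extension[OF group_perm_monoid[OF A] Q hom]) (simp add: k)
  then show ?thesis using A by (simp add: perm_in_class_def)
qed

text \<open>A homomorphism to a finite power of \<open>Q\<close>, treated one coordinate at a time:
  each step passes to the kernel of one coordinate, where the remaining relations still have all the
  properties.\<close>

lemma perm_in_class_extension_family:
  assumes "finite I" and A: "perm_group A" and Q: "locally_in_class Q"
    and total: "\<And>i f. i \<in> I \<Longrightarrow> f \<in> A \<Longrightarrow> \<exists>q\<in>carrier Q. R i f q"
    and mult: "\<And>i f g p q. i \<in> I \<Longrightarrow> f \<in> A \<Longrightarrow> g \<in> A \<Longrightarrow> p \<in> carrier Q \<Longrightarrow> q \<in> carrier Q \<Longrightarrow>
      R i f p \<Longrightarrow> R i g q \<Longrightarrow> R i (f \<circ> g) (p \<otimes>\<^bsub>Q\<^esub> q)"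
    and single: "\<And>i f p q. i \<in> I \<Longrightarrow> f \<in> A \<Longrightarrow> p \<in> carrier Q \<Longrightarrow> q \<in> carrier Q \<Longrightarrow>
      R i f p \<Longrightarrow> R i f q \<Longrightarrow> p = q"
    and ker: "perm_group {f \<in> A. \<forall>i\<in>I. R i f \<one>\<^bsub>Q\<^esub>} \<Longrightarrow> perm_in_class {f \<in> A. \<forall>i\<in>I. R i f \<one>\<^bsub>Q\<^esub>}"
  shows "perm_in_class A"
  using assms(1) A total mult single ker
proof (induction I arbitrary: A rule: finite_induct)
  case empty
  then show ?case by simp
next
  case (insert i I)
  have eq: "{f \<in> {f \<in> A. R i f \<one>\<^bsub>Q\<^esub>}. \<forall>j\<in>I. R j f \<one>\<^bsub>Q\<^esub>} = {f \<in> A. \<forall>j\<in>insert i I. R j f \<one>\<^bsub>Q\<^esub>}"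
    by auto
  show ?case
  proof (rule perm_in_class_extension[of A Q "R i"])
    assume "perm_group {f \<in> A. R i f \<one>\<^bsub>Q\<^esub>}"
    then show "perm_in_class {f \<in> A. R i f \<one>\<^bsub>Q\<^esub>}"
    proof (rule insert.IH)
      fix j f assume "j \<in> I" "f \<in> {f \<in> A. R i f \<one>\<^bsub>Q\<^esub>}"
      then show "\<exists>q\<in>carrier Q. R j f q" using insert.prems(2) by simp
    next
      fix j f g p q
      assume "j \<in> I" "f \<in> {f \<in> A. R i f \<one>\<^bsub>Q\<^esub>}" "g \<in> {f \<in> A. R i f \<one>\<^bsub>Q\<^esub>}"
        "p \<in> carrier Q" "q \<in> carrier Q" "R j f p" "R j g q"
      then show "R j (f \<circ> g) (p \<otimes>\<^bsub>Q\<^esub> q)" by (intro insert.prems(3)) auto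
    next
      fix j f p q
      assume "j \<in> I" "f \<in> {f \<in> A. R i f \<one>\<^bsub>Q\<^esub>}" "p \<in> carrier Q" "q \<in> carrier Q" "R j f p" "R j f q"
      then show "p = q" using insert.prems(4)[of j f p q] by simp
    qed (use insert.prems(5) in \<open>simp only: eq\<close>)
  next
    fix f assume "f \<in> A"
    then show "\<exists>q\<in>carrier Q. R i f q" using insert.prems(2) by simp
  next
    fix f g p q
    assume "f \<in> A" "g \<in> A" "p \<in> carrier Q" "q \<in> carrier Q" "R i f p" "R i g q"
    then show "R i (f \<circ> g) (p \<otimes>\<^bsub>Q\<^esub> q)" by (intro insert.prems(3)) auto
  next
    fix f p q
    assume "f \<in> A" "p \<in> carrier Q" "q \<in> carrier Q" "R i f p" "R i f q"
    then show "p = q" using insert.prems(4)[of i f p q] by simp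
  qed (use insert.prems(1) Q in auto)
qed

end

section \<open>Relations between pairs of elements and free subgroups\<close>

definition flip :: "'x \<times> bool \<Rightarrow> 'x \<times> bool" where "flip l = (fst l, \<not> snd l)"

lemma flip_simps [simp]: "flip (flip l) = l" "flip l \<noteq> l" "l \<noteq> flip l" "flip l = flip m \<longleftrightarrow> l = m" "fst (flip l) = fst l"
    "flip (x, s) = (x, \<not> s)"
  by (auto simp: flip_def prod_eq_iff)

abbreviation reduced :: "('x \<times> bool) list \<Rightarrow> bool" where
  "reduced \<equiv> successively (\<lambda>l m. m \<noteq> flip l)"

definition inv_word :: "('x \<times> bool) list \<Rightarrow> ('x \<times> bool) list" where "inv_word w = rev (map flip w)"

lemma reduced_inv_word: "reduced (inv_word w) \<longleftrightarrow> reduced w"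
  unfolding inv_word_def successively_rev successively_map by (simp add: eq_commute)

definition word_val :: "('g, 'm) monoid_scheme \<Rightarrow> ('x \<Rightarrow> 'g) \<Rightarrow> ('x \<times> bool) list \<Rightarrow> 'g" where
  "word_val G f w = foldr (\<lambda>l a. (if snd l then f (fst l) else inv\<^bsub>G\<^esub> f (fst l)) \<otimes>\<^bsub>G\<^esub> a) w \<one>\<^bsub>G\<^esub>"

lemma word_val_simps [simp]: "word_val G f [] = \<one>\<^bsub>G\<^esub>"
    "word_val G f (l # w) = (if snd l then f (fst l) else inv\<^bsub>G\<^esub> f (fst l)) \<otimes>\<^bsub>G\<^esub> word_val G f w"
  by (simp_all add: word_val_def)

context group
begin

lemma word_val_closed: "(\<And>x. x \<in> fst ` set w \<Longrightarrow> f x \<in> carrier G) \<Longrightarrow> word_val G f w \<in> carrier G"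
  by (induction w) auto

lemma word_val_append:
  "(\<And>x. x \<in> fst ` set (u @ v) \<Longrightarrow> f x \<in> carrier G) \<Longrightarrow>
    word_val G f (u @ v) = word_val G f u \<otimes> word_val G f v"
proof (induction u)
  case (Cons l u)
  then have "word_val G f u \<in> carrier G" "word_val G f v \<in> carrier G" "f (fst l) \<in> carrier G"
    by (auto intro!: word_val_closed)
  then show ?case using Cons by (simp add: m_assoc)
next
  case Nil
  then have "word_val G f v \<in> carrier G" by (intro word_val_closed) auto
  then show ?case by simp
qed

lemma word_val_inv:
  assumes f: "\<And>x. f x \<in> carrier G"
  shows "word_val G f (inv_word w) = inv (word_val G f w)"
proof (induction w)
  case (Cons l w)
  have "word_val G f (inv_word (l # w)) = inv (word_val G f w) \<otimes> word_val G f [flip l]"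
    using Cons word_val_append[of "inv_word w" "[flip l]" f] f by (simp add: inv_word_def)
  then show ?case using f word_val_closed[of w f] by (auto simp: inv_mult_group flip_def)
qed (simp add: inv_word_def)

lemma word_val_subgroup:
  assumes "subgroup B G" "\<And>x. x \<in> fst ` set w \<Longrightarrow> f x \<in> B"
  shows "word_val (G\<lparr>carrier := B\<rparr>) f w = word_val G f w" "word_val G f w \<in> B"
  using assms(2)
  by (induction w) (use assms(1) in \<open>auto simp: m_inv_consistent subgroup.one_closed subgroup.m_closed subgroup.m_inv_closed\<close>)

end

lemma word_val_hom:
  assumes "group K" "group L" "h \<in> hom K L" "\<And>x. x \<in> fst ` set w \<Longrightarrow> f x \<in> carrier K"
  shows "h (word_val K f w) = word_val L (\<lambda>x. h (f x)) w"
proof -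
  interpret group_hom K L h using assms by (simp add: group_hom_def group_hom_axioms_def)
  show ?thesis using assms(4)
  proof (induction w)
    case (Cons l w)
    then have "word_val K f w \<in> carrier K" by (intro G.word_val_closed) auto
    then show ?case using Cons by auto
  qed simp
qed

lemma word_val_map: "word_val G f (map (\<lambda>l. (h (fst l), snd l)) w) = word_val G (\<lambda>x. f (h x)) w"
  by (induction w) auto

text \<open>Absence of a free subgroup of rank two, stated through words. No embedded free group
  occurs in it, so extensions and unions can be treated directly; \<open>no_free_pair_imp\<close>
  and \<open>imp_no_free_pair\<close> link it to
  \<open>has_nonabelian_free_subgroup\<close>.\<close>

definition no_free_pair :: "('g, 'm) monoid_scheme \<Rightarrow> bool" where
  "no_free_pair G \<longleftrightarrow> (\<forall>f :: bool \<Rightarrow> 'g. (\<forall>x. f x \<in> carrier G) \<longrightarrow>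
     (\<exists>w. w \<noteq> [] \<and> reduced w \<and> word_val G f w = \<one>\<^bsub>G\<^esub>))"

lemma no_free_pairD:
  fixes f :: "bool \<Rightarrow> 'g"
  shows "no_free_pair G \<Longrightarrow> (\<And>x. f x \<in> carrier G) \<Longrightarrow> \<exists>w. w \<noteq> [] \<and> reduced w \<and> word_val G f w = \<one>\<^bsub>G\<^esub>"
  unfolding no_free_pair_def by (drule spec[where x = f]) simp

lemma no_free_pair_embed:
  assumes "group K" "group L" "h \<in> hom K L" "inj_on h (carrier K)" "no_free_pair L"
  shows "no_free_pair K"
  unfolding no_free_pair_def
proof (intro allI impI)
  fix f :: "bool \<Rightarrow> 'a" assume "\<forall>x. f x \<in> carrier K"
  then have f: "range f \<subseteq> carrier K" by auto
  then have "h (f x) \<in> carrier L" for x using assms(3) by (auto simp: hom_def)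
  then obtain w where w: "w \<noteq> []" "reduced w" "word_val L (\<lambda>x. h (f x)) w = \<one>\<^bsub>L\<^esub>"
    using no_free_pairD[OF assms(5), of "\<lambda>x. h (f x)"] by blast
  interpret group_hom K L h using assms by (simp add: group_hom_def group_hom_axioms_def)
  have "h (word_val K f w) = h \<one>\<^bsub>K\<^esub>" using w(3) word_val_hom[OF assms(1-3), of w f] f by auto
  moreover have "word_val K f w \<in> carrier K" using f by (intro G.word_val_closed) auto
  ultimately have "word_val K f w = \<one>\<^bsub>K\<^esub>" using assms(4) by (meson inj_onD G.one_closed)
  then show "\<exists>w. w \<noteq> [] \<and> reduced w \<and> word_val K f w = \<one>\<^bsub>K\<^esub>" using w by blast
qed

lemma no_free_pair_abelian:
  fixes G (structure)
  assumes "comm_group G"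
  shows "no_free_pair G"
  unfolding no_free_pair_def
proof (intro allI impI)
  interpret comm_group G by fact
  fix f :: "bool \<Rightarrow> 'a" assume "\<forall>x. f x \<in> carrier G"
  then have f: "range f \<subseteq> carrier G" by auto
  let ?w = "[(True, True), (False, True), (True, False), (False, False)]"
  have a: "f True \<in> carrier G" "f False \<in> carrier G" using f by auto
  have "word_val G f ?w = (f True \<otimes> f False) \<otimes> inv (f True \<otimes> f False)"
    using a by (simp add: inv_mult m_assoc del: r_inv)
  also have "\<dots> = \<one>" using a by simp
  finally show "\<exists>w. w \<noteq> [] \<and> reduced w \<and> word_val G f w = \<one>" by (intro exI[of _ ?w]) simp
qed

lemma no_free_pair_finite:
  fixes G (structure)
  assumes "group G" "finite (carrier G)"
  shows "no_free_pair G"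
  unfolding no_free_pair_def
proof (intro allI impI)
  interpret group G by fact
  fix f :: "bool \<Rightarrow> 'a" assume "\<forall>x. f x \<in> carrier G"
  then have f: "range f \<subseteq> carrier G" by auto
  let ?w = "replicate (order G) (True, True)"
  have val: "word_val G f (replicate n (True, True)) = f True [^] n" for n
  proof (induction n)
    case (Suc n)
    have "f True \<in> carrier G" using f by auto
    then show ?case using Suc nat_pow_Suc2[of "f True" n] by simp
  qed simp
  have red: "reduced (replicate n (True, True))" for n
    by (induction n) (auto simp: successively_Cons)
  have "order G > 0" using assms(2) by (simp add: order_gt_0_iff_finite)
  moreover have "f True [^] order G = \<one>" using f by (intro pow_order_eq_1) auto
  ultimately show "\<exists>w. w \<noteq> [] \<and> reduced w \<and> word_val G f w = \<one>"
    using red val by (intro exI[of _ ?w]) auto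
qed

lemma no_free_pair_union:
  fixes G (structure)
  assumes G: "group G" and sub: "\<And>K. K \<in> \<K> \<Longrightarrow> subgroup K G"
    and nf: "\<And>K. K \<in> \<K> \<Longrightarrow> no_free_pair (G\<lparr>carrier := K\<rparr>)"
    and dir: "\<And>K L. K \<in> \<K> \<Longrightarrow> L \<in> \<K> \<Longrightarrow> \<exists>M\<in>\<K>. K \<union> L \<subseteq> M"
    and un: "\<Union>\<K> = carrier G"
  shows "no_free_pair G"
  unfolding no_free_pair_def
proof (intro allI impI)
  interpret group G by fact
  fix f :: "bool \<Rightarrow> 'a" assume "\<forall>x. f x \<in> carrier G"
  then have f: "range f \<subseteq> carrier G" by auto
  then have "f True \<in> \<Union>\<K>" "f False \<in> \<Union>\<K>" using un by auto
  then obtain K L where KL: "f True \<in> K" "K \<in> \<K>" "f False \<in> L" "L \<in> \<K>" by blast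
  obtain M where M: "M \<in> \<K>" "K \<union> L \<subseteq> M" using dir[OF KL(2,4)] by blast
  have fM: "f x \<in> M" for x using KL M by (cases x) auto
  then obtain w where w: "w \<noteq> []" "reduced w" "word_val (G\<lparr>carrier := M\<rparr>) f w = \<one>\<^bsub>G\<lparr>carrier := M\<rparr>\<^esub>"
    using no_free_pairD[OF nf[OF M(1)], of f] fM by auto
  then have "word_val G f w = \<one>" using word_val_subgroup(1)[OF sub[OF M(1)], of w f] fM by simp
  then show "\<exists>w. w \<noteq> [] \<and> reduced w \<and> word_val G f w = \<one>" using w by blast
qed

text \<open>\<open>reduced (c @ c)\<close> says that \<open>c\<close> is cyclically reduced. If the
  ends of a word are inverse to each other, removing both conjugates its value by a letter, so
  induction on the length applies.\<close>

lemma cyclic_reduction: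
  fixes w :: "('x \<times> bool) list" and G (structure)
  assumes "group G" "\<And>x. f x \<in> carrier G"
  shows "w \<noteq> [] \<Longrightarrow> reduced w \<Longrightarrow>
    \<exists>c p. c \<noteq> [] \<and> reduced (c @ c) \<and> p \<in> carrier G \<and> word_val G f w = p \<otimes>\<^bsub>G\<^esub> word_val G f c \<otimes>\<^bsub>G\<^esub> inv\<^bsub>G\<^esub> p"
proof (induction "length w" arbitrary: w rule: less_induct)
  case less
  interpret group G by fact
  have val: "word_val G f w \<in> carrier G" for w using assms by (intro word_val_closed)
  show ?case
  proof (cases "reduced (w @ w)")
    case True
    then show ?thesis using less.prems val[of w] by (intro exI[of _ w] exI[of _ \<one>]) simp
  next
    case False
    then have e: "hd w = flip (last w)" using less.prems by (auto simp: successively_append_iff)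
    obtain l v where w: "w = l # v" using less.prems by (cases w) auto
    have "v \<noteq> []" using e w by auto
    then obtain u m where v: "v = u @ [m]" by (cases v rule: rev_cases) auto
    have m: "m = flip l" using e by (simp add: w v)
    \<comment> \<open>The word \<open>[l, flip l]\<close> is not reduced, so stripping never
      exhausts the word.\<close>
    have "u \<noteq> []" using less.prems by (auto simp: w v m)
    moreover have "reduced u" using less.prems by (auto simp: w v successively_append_iff successively_Cons)
    ultimately obtain c p where c: "c \<noteq> []" "reduced (c @ c)" "p \<in> carrier G"
      "word_val G f u = p \<otimes> word_val G f c \<otimes> inv p" using less.hyps[of u] by (auto simp: w v)
    let ?a = "word_val G f [l]"
    have a: "word_val G f [flip l] = inv ?a" using word_val_inv[of f "[l]", OF assms(2)] by (simp add: inv_word_def)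
    have "word_val G f w = ?a \<otimes> (word_val G f u \<otimes> inv ?a)"
      unfolding a[symmetric] using word_val_append[of "[l]" "u @ [flip l]" f] word_val_append[of u "[flip l]" f] assms
      by (simp add: w v m)
    also have "\<dots> = (?a \<otimes> p) \<otimes> word_val G f c \<otimes> inv (?a \<otimes> p)"
      using c(3) val[of c] val[of "[l]"] by (simp add: c(4) inv_mult_group m_assoc)
    finally show ?thesis using c val[of "[l]"] by (intro exI[of _ c] exI[of _ "?a \<otimes> p"]) simp
  qed
qed

text \<open>Of the four letters of rank two, two remain when those that cancel against an end of the
  cyclically reduced word are excluded; they serve as conjugators in
  \<open>no_free_pair_extension\<close>.\<close>

lemma two_letters:
  fixes p q :: "bool \<times> bool"
  obtains z :: "bool \<Rightarrow> bool \<times> bool" where "z True \<noteq> z False" "\<And>i. z i \<noteq> p" "\<And>i. z i \<noteq> q"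
proof -
  have "card (UNIV - {p, q}) \<ge> card (UNIV :: (bool \<times> bool) set) - card {p, q}" by (intro diff_card_le_card_Diff) simp
  moreover have "card {p, q} \<le> 2" by (simp add: card_insert_if)
  moreover have "card (UNIV :: (bool \<times> bool) set) = 4" by (simp add: card_cartesian_product flip: UNIV_Times_UNIV)
  ultimately have "2 \<le> card (UNIV - {p, q})" by linarith
  then obtain T where T: "T \<subseteq> UNIV - {p, q}" "card T = 2" by (rule obtain_subset_with_card_n)
  then obtain a b where "T = {a, b}" "a \<noteq> b" unfolding card_2_iff by blast
  then have "a \<noteq> b" "a \<notin> {p, q}" "b \<notin> {p, q}" using T(1) by blast+
  then show ?thesis using that[of "\<lambda>i. if i then a else b"] by auto
qed

definition plug :: "(bool \<Rightarrow> bool \<times> bool) \<Rightarrow> (bool \<times> bool) list \<Rightarrow> bool \<times> bool \<Rightarrow> (bool \<times> bool) list" where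
  "plug z c l = z (fst l) # (if snd l then c else inv_word c) @ [flip (z (fst l))]"

text \<open>The conjugates of a cyclically reduced word by two suitable letters are free generators.\<close>

lemma plug_reduced:
  fixes G (structure)
  assumes G: "group G" "\<And>x. f x \<in> carrier G" and c: "c \<noteq> []" "reduced (c @ c)"
    and z: "z True \<noteq> z False" "\<And>i. z i \<noteq> flip (hd c)" "\<And>i. z i \<noteq> last c"
  shows "v \<noteq> [] \<Longrightarrow> reduced v \<Longrightarrow> \<exists>r. reduced (z (fst (hd v)) # (if snd (hd v) then c else inv_word c) @ r) \<and>
    word_val G f (concat (map (plug z c) v)) = word_val G f (z (fst (hd v)) # (if snd (hd v) then c else inv_word c) @ r)"
proof (induction v)
  case (Cons l v)
  interpret group G by fact
  define d where "d s = (if s then c else inv_word c)" for s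
  have d_ne: "d s \<noteq> []" for s using c by (simp add: d_def inv_word_def)
  have d_red: "reduced (d s @ d s)" for s
    using c reduced_inv_word[of "c @ c"] by (simp add: d_def inv_word_def)
  then have d_red1: "reduced (d s)" for s by (auto simp: successively_append_iff)
  have hd_last: "hd (inv_word c) = flip (last c)" "last (inv_word c) = flip (hd c)"
    using c by (simp_all add: inv_word_def hd_rev last_rev hd_map last_map)
  have zd: "hd (d s) \<noteq> flip (z i)" "flip (z i) \<noteq> flip (last (d s))" for s i
    using z(2)[of i] z(3)[of i] by (auto simp: d_def hd_last)
  let ?i = "fst l" and ?s = "snd l"
  have app: "word_val G f (u @ w) = word_val G f u \<otimes> word_val G f w" for u w using G(2) by (intro word_val_append)
  have val: "word_val G f w \<in> carrier G" for w using G(2) by (intro word_val_closed)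
  have plug: "plug z c l = z ?i # d ?s @ [flip (z ?i)]" by (simp add: plug_def d_def)
  show ?case
  proof (cases "v = []")
    case True
    have "reduced (z ?i # d ?s @ [flip (z ?i)])"
      using zd d_ne d_red1 by (auto simp: successively_Cons successively_append_iff hd_append)
    then show ?thesis using True by (intro exI[of _ "[flip (z ?i)]"]) (simp add: plug d_def)
  next
    case False
    then obtain m v' where v: "v = m # v'" by (cases v) auto
    obtain r where r: "reduced (z (fst m) # d (snd m) @ r)"
      "word_val G f (concat (map (plug z c) v)) = word_val G f (z (fst m) # d (snd m) @ r)"
      using Cons.IH Cons.prems v by (auto simp: d_def successively_Cons)
    have lm: "m \<noteq> flip l" using Cons.prems by (simp add: v)
    have total: "word_val G f (concat (map (plug z c) (l # v))) =
        word_val G f ((z ?i # d ?s @ [flip (z ?i)]) @ (z (fst m) # d (snd m) @ r))"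
      by (simp only: list.map concat.simps app r(2) plug)
    show ?thesis
    \<comment> \<open>Different conjugators meet without cancelling. Equal ones cancel; then the
      signs agree because the outer word is reduced, and the junction of two copies of
      \<open>d ?s\<close> is reduced because \<open>c @ c\<close> is.\<close>
    proof (cases "?i = fst m")
      case False
      then have "z (fst m) \<noteq> z ?i" using z(1) by (cases ?i; cases "fst m") auto
      then have "reduced (z ?i # d ?s @ (flip (z ?i) # z (fst m) # d (snd m) @ r))"
        using r(1) zd d_ne d_red1 by (auto simp: successively_Cons successively_append_iff hd_append)
      then show ?thesis using total
        by (intro exI[of _ "flip (z ?i) # z (fst m) # d (snd m) @ r"]) (simp add: d_def)
    next
      case True
      then have s: "snd m = ?s" using lm by (auto simp: flip_def prod_eq_iff)
      have "reduced (d ?s @ d ?s @ r)"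
        using r(1) d_red[of ?s] d_ne[of ?s] by (auto simp: s successively_Cons successively_append_iff hd_append)
      then have "reduced (z ?i # d ?s @ (d ?s @ r))"
        using zd d_ne[of ?s] by (auto simp: successively_Cons hd_append)
      moreover have "word_val G f ([flip (z ?i)] @ (z ?i # d ?s @ r)) = word_val G f (d ?s @ r)"
        using val G(2) by (cases "z ?i") (auto simp: inv_solve_left m_assoc[symmetric])
      then have "word_val G f ((z ?i # d ?s) @ ([flip (z ?i)] @ (z ?i # d ?s @ r))) = word_val G f ((z ?i # d ?s) @ (d ?s @ r))"
        by (simp only: app)
      then have "word_val G f (concat (map (plug z c) (l # v))) = word_val G f (z ?i # d ?s @ (d ?s @ r))"
        unfolding total s True[symmetric] by simp
      ultimately show ?thesis by (intro exI[of _ "d ?s @ r"]) (simp add: d_def)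
    qed
  qed
qed simp

text \<open>A relation between the images in \<open>Q\<close> is a word with value in the kernel.
  Two conjugates of its cyclically reduced core lie in the kernel as well and satisfy a relation
  there; expanding that relation gives a word whose reduced form is nonempty by
  \<open>plug_reduced\<close>.\<close>

lemma no_free_pair_extension:
  assumes K: "group K" and Q: "group Q" and \<pi>: "\<pi> \<in> hom K Q"
    and ker: "no_free_pair (K\<lparr>carrier := kernel K Q \<pi>\<rparr>)" and nfQ: "no_free_pair Q"
  shows "no_free_pair K"
  unfolding no_free_pair_def
proof (intro allI impI)
  interpret group_hom K Q \<pi> using assms by (simp add: group_hom_def group_hom_axioms_def)
  fix f :: "bool \<Rightarrow> 'a" assume "\<forall>x. f x \<in> carrier K"
  then have f: "f x \<in> carrier K" for x by auto
  have val: "word_val K f w \<in> carrier K" for w using f by (intro G.word_val_closed)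
  have "\<pi> (f x) \<in> carrier Q" for x using f by simp
  then obtain w where w: "w \<noteq> []" "reduced w" "word_val Q (\<lambda>x. \<pi> (f x)) w = \<one>\<^bsub>Q\<^esub>"
    using no_free_pairD[OF nfQ, of "\<lambda>x. \<pi> (f x)"] by blast
  have w1: "\<pi> (word_val K f w) = \<one>\<^bsub>Q\<^esub>" using w(3) word_val_hom[OF K Q \<pi>, of w f] f by simp
  obtain c p where c: "c \<noteq> []" "reduced (c @ c)" "p \<in> carrier K"
    "word_val K f w = p \<otimes>\<^bsub>K\<^esub> word_val K f c \<otimes>\<^bsub>K\<^esub> inv\<^bsub>K\<^esub> p"
    using cyclic_reduction[where f = f, OF K f w(1,2)] by blast
  have "word_val K f c = inv\<^bsub>K\<^esub> p \<otimes>\<^bsub>K\<^esub> word_val K f w \<otimes>\<^bsub>K\<^esub> p"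
    using c(3) val[of c] by (simp add: c(4) G.m_assoc) (simp add: G.inv_solve_left)
  then have c1: "\<pi> (word_val K f c) = \<one>\<^bsub>Q\<^esub>" using c(3) val[of w] w1 by simp
  obtain z where z: "z True \<noteq> z False" "\<And>i. z i \<noteq> flip (hd c)" "\<And>i. z i \<noteq> last c"
    using two_letters[of "flip (hd c)" "last c"] by blast
  let ?N = "kernel K Q \<pi>"
  define g where "g i = word_val K f (plug z c (i, True))" for i
  have app: "word_val K f (u @ w) = word_val K f u \<otimes>\<^bsub>K\<^esub> word_val K f w" for u w using f by (intro G.word_val_append)
  have "\<pi> (g i) = \<one>\<^bsub>Q\<^esub>" for i
  proof -
    have "g i = word_val K f [z i] \<otimes>\<^bsub>K\<^esub> word_val K f c \<otimes>\<^bsub>K\<^esub> inv\<^bsub>K\<^esub> (word_val K f [z i])"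
      using app[of "[z i] @ c" "[flip (z i)]"] app[of "[z i]" c] G.word_val_inv[of f "[z i]", OF f]
      by (simp add: g_def plug_def inv_word_def)
    then show ?thesis using val[of "[z i]"] val[of c] c1 by simp
  qed
  then have gN: "g i \<in> ?N" for i using val by (simp add: g_def kernel_def)
  then have "g i \<in> carrier (K\<lparr>carrier := ?N\<rparr>)" for i by simp
  then obtain v where v: "v \<noteq> []" "reduced v" "word_val (K\<lparr>carrier := ?N\<rparr>) g v = \<one>\<^bsub>K\<lparr>carrier := ?N\<rparr>\<^esub>"
    using no_free_pairD[OF ker, of g] by blast
  have "word_val K g v = \<one>\<^bsub>K\<^esub>"
    using v(3) G.word_val_subgroup(1)[OF subgroup_kernel, of v g] gN by simp
  moreover have "word_val K f (concat (map (plug z c) v)) = word_val K g v" for v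
  proof (induction v)
    case (Cons l v)
    have "word_val K f (plug z c l) = (if snd l then g (fst l) else inv\<^bsub>K\<^esub> g (fst l))"
    proof (cases "snd l")
      case False
      have "plug z c l = inv_word (plug z c (fst l, True))"
        using False by (simp add: plug_def inv_word_def)
      then show ?thesis using False G.word_val_inv[of f, OF f] by (simp add: g_def)
    qed (simp add: g_def plug_def)
    then show ?case using Cons app by simp
  qed simp
  moreover obtain r where "reduced (z (fst (hd v)) # (if snd (hd v) then c else inv_word c) @ r)"
    "word_val K f (concat (map (plug z c) v)) = word_val K f (z (fst (hd v)) # (if snd (hd v) then c else inv_word c) @ r)"
    using plug_reduced[where f = f, OF K f c(1,2) z v(1,2)] by blast
  ultimately show "\<exists>w. w \<noteq> [] \<and> reduced w \<and> word_val K f w = \<one>\<^bsub>K\<^esub>" by (metis list.distinct(1))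
qed

section \<open>Reduced words and the free group\<close>

definition push :: "'x \<times> bool \<Rightarrow> ('x \<times> bool) list \<Rightarrow> ('x \<times> bool) list" where
  "push l w = (if w \<noteq> [] \<and> hd w = flip l then tl w else l # w)"

lemma push_reduced: "reduced w \<Longrightarrow> reduced (push l w)"
  by (cases w) (auto simp: push_def successively_Cons)

lemma push_push: "reduced w \<Longrightarrow> push l (push (flip l) w) = w"
  by (cases w) (auto simp: push_def successively_Cons)

lemma foldr_push_reduced: "reduced w \<Longrightarrow> reduced (foldr push u w)"
  by (induction u) (auto intro: push_reduced)

lemma foldr_push_Nil: "reduced w \<Longrightarrow> foldr push w [] = w"
  by (induction w) (auto simp: push_def successively_Cons)

abbreviation FL :: "'x set \<Rightarrow> ('x \<times> bool) set" where "FL X \<equiv> X \<times> UNIV"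

definition free_rels :: "'x set \<Rightarrow> (('x \<times> bool) list \<times> ('x \<times> bool) list) set" where
  "free_rels X = {([(x, b), (x, \<not> b)], []) | x b. x \<in> X}"

lemma free_group_eq: "free_group X = presented (FL X) (free_rels X)"
  by (simp add: free_group_def free_rels_def)

text \<open>Letters act on the reduced words by multiplication with cancellation, and the relators
  act trivially. Applied to the empty word, a reduced word reproduces itself, so it is trivial in
  the free group only if it is empty.\<close>

lemma free_cong_push:
  "word_cong (FL X) (free_rels X) u v \<Longrightarrow> reduced w \<Longrightarrow> foldr push u w = foldr push v w"
proof (induction arbitrary: w rule: word_cong.induct)
  case (rel u v p q)
  then obtain x b where "u = [(x, b), flip (x, b)]" "v = []" by (auto simp: free_rels_def)
  then show ?case using push_push[OF foldr_push_reduced[OF rel.prems, of q], of "(x, b)"] by simp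
qed auto

lemma reduced_not_cong_Nil:
  assumes "reduced w" "word_cong (FL X) (free_rels X) w []"
  shows "w = []"
  using free_cong_push[OF assms(2), of "[]"] foldr_push_Nil[OF assms(1)] by simp

lemma free_cancel:
  assumes "x \<in> X" "q \<in> lists (FL X)"
  shows "word_cong (FL X) (free_rels X) ((x, b) # (x, \<not> b) # q) q"
proof -
  have "([(x, b), (x, \<not> b)], []) \<in> free_rels X" using assms unfolding free_rels_def by blast
  then show ?thesis using word_cong.rel[of "[(x, b), (x, \<not> b)]" "[]" "free_rels X" "[]" "FL X" q] assms by simp
qed

lemma free_cong_Cons:
  "word_cong (FL X) (free_rels X) u v \<Longrightarrow> l \<in> FL X \<Longrightarrow> word_cong (FL X) (free_rels X) (l # u) (l # v)"
  using word_cong_append_left[of "FL X" "free_rels X" u v "[l]"] by simp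

lemma reduced_form:
  "w \<in> lists (FL X) \<Longrightarrow> \<exists>v\<in>lists (FL X). reduced v \<and> word_cong (FL X) (free_rels X) w v"
proof (induction w)
  case Nil
  then show ?case by (auto intro!: bexI[of _ "[]"] word_cong.refl)
next
  case (Cons l w)
  then obtain v where v: "v \<in> lists (FL X)" "reduced v" "word_cong (FL X) (free_rels X) w v" by auto
  have c: "word_cong (FL X) (free_rels X) (l # w) (l # v)" using v(3) Cons.prems by (intro free_cong_Cons) auto
  have l: "l = (fst l, snd l)" "fst l \<in> X" using Cons.prems by (cases l; auto)+
  show ?case
  proof (cases "v \<noteq> [] \<and> hd v = flip l")
    case True
    then obtain u where u: "v = flip l # u" by (cases v) auto
    have "word_cong (FL X) (free_rels X) (l # v) u"
      using free_cancel[OF l(2), of u "snd l"] v(1) by (simp add: u flip_def)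
    then show ?thesis using c v u word_cong.trans by (intro bexI[of _ u]) (auto simp: successively_Cons)
  next
    case False
    then show ?thesis using c v Cons.prems by (intro bexI[of _ "l # v"]) (auto simp: successively_Cons)
  qed
qed

context group
begin

lemma word_val_cong:
  assumes f: "\<And>x. x \<in> X \<Longrightarrow> f x \<in> carrier G"
  shows "word_cong (FL X) (free_rels X) u v \<Longrightarrow> word_val G f u = word_val G f v"
proof (induction rule: word_cong.induct)
  case (rel u v p q)
  then obtain x b where u: "u = [(x, b), (x, \<not> b)]" "v = []" "x \<in> X" by (auto simp: free_rels_def)
  have "word_val G f u = word_val G f v" using f[OF u(3)] by (simp add: u)
  moreover have "word_val G f (r @ s) = word_val G f r \<otimes> word_val G f s"
    if "r \<in> lists (FL X)" "s \<in> lists (FL X)" for r s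
    using that f by (intro word_val_append) auto
  ultimately show ?case using rel by simp
qed auto

lemma free_group_hom:
  assumes f: "\<And>x. x \<in> X \<Longrightarrow> f x \<in> carrier G"
  shows "\<exists>\<theta>\<in>hom (free_group X) G. \<forall>w\<in>lists (FL X). \<theta> (word_class (FL X) (free_rels X) w) = word_val G f w"
proof -
  define \<theta> where "\<theta> P = word_val G f (SOME w. w \<in> P)" for P
  have \<theta>: "\<theta> (word_class (FL X) (free_rels X) w) = word_val G f w" if "w \<in> lists (FL X)" for w
  proof -
    have "w \<in> word_class (FL X) (free_rels X) w" using that by (simp add: word_class_def word_cong.refl)
    then have "(SOME v. v \<in> word_class (FL X) (free_rels X) w) \<in> word_class (FL X) (free_rels X) w" by (rule someI)
    then show ?thesis unfolding \<theta>_def using word_val_cong[of X f, OF f] by (simp add: word_class_def)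
  qed
  have fx: "f x \<in> carrier G" if "w \<in> lists (FL X)" "x \<in> fst ` set w" for x w using that f by auto
  have "\<theta> \<in> hom (free_group X) G"
  proof (rule homI)
    fix P assume "P \<in> carrier (free_group X)"
    then obtain u where u: "u \<in> lists (FL X)" "P = word_class (FL X) (free_rels X) u" by (auto simp: free_group_eq presented_def)
    then show "\<theta> P \<in> carrier G" using \<theta> word_val_closed fx by metis
    fix Q assume "Q \<in> carrier (free_group X)"
    then obtain v where v: "v \<in> lists (FL X)" "Q = word_class (FL X) (free_rels X) v" by (auto simp: free_group_eq presented_def)
    have "P \<otimes>\<^bsub>free_group X\<^esub> Q = word_class (FL X) (free_rels X) (u @ v)"
      using u v by (simp add: free_group_eq mult_presented)
    moreover have "u @ v \<in> lists (FL X)" using u v by simp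
    ultimately show "\<theta> (P \<otimes>\<^bsub>free_group X\<^esub> Q) = \<theta> P \<otimes> \<theta> Q"
      using u v \<theta> word_val_append[of u v f] fx[of "u @ v"] by simp
  qed
  then show ?thesis using \<theta> by blast
qed

end

lemma word_class_free_group:
  assumes "w \<in> lists (FL X)"
  shows "word_class (FL X) (free_rels X) w \<in> carrier (free_group X)"
    "word_class (FL X) (free_rels X) w = \<one>\<^bsub>free_group X\<^esub> \<longleftrightarrow> word_cong (FL X) (free_rels X) w []"
  using assms by (auto simp: free_group_eq presented_def word_class_eq_iff)

lemma word_val_free_group:
  assumes "w \<in> lists (FL X)"
  shows "word_val (free_group X) (\<lambda>x. word_class (FL X) (free_rels X) [(x, True)]) w = word_class (FL X) (free_rels X) w"
  using assms
proof (induction w rule: list.induct)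
  case Nil
  then show ?case by (simp add: free_group_eq presented_def)
next
  case (Cons l w)
  interpret group "free_group X" by (rule group_free_group)
  let ?c = "word_class (FL X) (free_rels X)"
  have l: "fst l \<in> X" using Cons.prems by (auto simp: mem_Times_iff)
  have mult: "?c u \<otimes>\<^bsub>free_group X\<^esub> ?c v = ?c (u @ v)" if "u \<in> lists (FL X)" "v \<in> lists (FL X)" for u v
    using that by (simp add: free_group_eq mult_presented)
  have "inv\<^bsub>free_group X\<^esub> ?c [(fst l, True)] = ?c [(fst l, False)]"
  proof (rule inv_equality)
    have "word_cong (FL X) (free_rels X) [(fst l, False), (fst l, True)] []"
      using free_cancel[OF l, of "[]" False] by simp
    then have "?c [(fst l, False), (fst l, True)] = \<one>\<^bsub>free_group X\<^esub>" using l by (subst word_class_free_group) auto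
    then show "?c [(fst l, False)] \<otimes>\<^bsub>free_group X\<^esub> ?c [(fst l, True)] = \<one>\<^bsub>free_group X\<^esub>" using l by (simp add: mult)
  qed (use l in \<open>auto intro!: word_class_free_group\<close>)
  then have "(if snd l then ?c [(fst l, True)] else inv\<^bsub>free_group X\<^esub> ?c [(fst l, True)]) = ?c [l]"
    by (cases l) auto
  then show ?case using Cons l mult[of "[l]" w] by (cases l) auto
qed

text \<open>Its contrapositive provides two different basis elements in a nonabelian free group. The
  proof commutes single letters first, then a letter with a word, then two words.\<close>

lemma free_group_singleton_comm:
  assumes "X \<subseteq> {x}"
  shows "comm_group (free_group X)"
proof -
  interpret group "free_group X" by (rule group_free_group)
  let ?C = "word_cong (FL X) (free_rels X)"
  have letters: "?C [l, m] [m, l]" if lm_X: "l \<in> FL X" "m \<in> FL X" for l m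
  proof (cases "l = m")
    case True
    then show ?thesis using lm_X by (auto intro!: word_cong.refl)
  next
    case False
    obtain y b where l: "l = (y, b)" "y \<in> X" using lm_X(1) by blast
    obtain y' b' where m: "m = (y', b')" "y' \<in> X" using lm_X(2) by blast
    have "y' = y" using l(2) m(2) assms by blast
    moreover from this have "b' = (\<not> b)" using False l m by auto
    ultimately have lm: "l = (y, b)" "m = (y, \<not> b)" "y \<in> X" using l m by simp_all
    have "?C [l, m] []" "?C [m, l] []" using free_cancel[OF lm(3), of "[]" b] free_cancel[OF lm(3), of "[]" "\<not> b"] lm by auto
    then show ?thesis by (rule word_cong.trans[OF _ word_cong.sym])
  qed
  have move: "?C (l # v) (v @ [l])" if "l \<in> FL X" "v \<in> lists (FL X)" for l v
    using that(2)
  proof (induction v)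
    case Nil
    then show ?case using that by (auto intro!: word_cong.refl)
  next
    case (Cons m v)
    have "?C ([l, m] @ v) ([m, l] @ v)" using letters[of l m] that(1) Cons by (intro word_cong_append_right) auto
    moreover have "?C (m # l # v) (m # v @ [l])" using Cons by (intro free_cong_Cons) auto
    ultimately show ?case using word_cong.trans[of "FL X" "free_rels X" "l # m # v" "m # l # v" "m # v @ [l]"] by simp
  qed
  have comm: "?C (u @ v) (v @ u)" if "u \<in> lists (FL X)" "v \<in> lists (FL X)" for u v
    using that(1)
  proof (induction u)
    case Nil
    then show ?case using that by (auto intro!: word_cong.refl)
  next
    case (Cons l u)
    have "?C (l # u @ v) (l # v @ u)" using Cons by (intro free_cong_Cons) auto
    moreover have "?C ((l # v) @ u) ((v @ [l]) @ u)" using move[of l v] that Cons by (intro word_cong_append_right) auto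
    ultimately show ?case using word_cong.trans[of "FL X" "free_rels X" "l # u @ v" "l # v @ u" "v @ l # u"] by simp
  qed
  show ?thesis
  proof (rule group_comm_groupI)
    fix P Q assume "P \<in> carrier (free_group X)" "Q \<in> carrier (free_group X)"
    then obtain u v where uv: "u \<in> lists (FL X)" "v \<in> lists (FL X)"
      "P = word_class (FL X) (free_rels X) u" "Q = word_class (FL X) (free_rels X) v"
      by (auto simp: free_group_eq presented_def)
    then show "P \<otimes>\<^bsub>free_group X\<^esub> Q = Q \<otimes>\<^bsub>free_group X\<^esub> P"
      using comm[OF uv(1,2)] by (simp add: free_group_eq mult_presented word_class_eq_iff)
  qed
qed

lemma reduced_map:
  assumes "inj_on h (fst ` set w)"
  shows "reduced (map (\<lambda>l. (h (fst l), snd l)) w) \<longleftrightarrow> reduced w"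
  unfolding successively_map
proof (rule successively_cong[OF _ HOL.refl])
  fix l m assume "l \<in> set w" "m \<in> set w"
  then have "h (fst m) = h (fst l) \<longleftrightarrow> fst m = fst l" using assms by (intro inj_on_eq_iff) auto
  then show "((h (fst m), snd m) \<noteq> flip (h (fst l), snd l)) = (m \<noteq> flip l)"
    by (simp add: flip_def prod_eq_iff)
qed

lemma no_free_pair_imp:
  assumes G: "group G" and nf: "no_free_pair G"
  shows "\<not> has_nonabelian_free_subgroup G"
proof
  assume "has_nonabelian_free_subgroup G"
  then obtain K and X :: "'a set" where K: "subgroup K G" "G\<lparr>carrier := K\<rparr> \<cong> free_group X"
    "\<not> comm_group (G\<lparr>carrier := K\<rparr>)" by (auto simp: has_nonabelian_free_subgroup_def)
  have gK: "group (G\<lparr>carrier := K\<rparr>)" using subgroup.subgroup_is_group[OF K(1) G] .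
  have iso: "free_group X \<cong> G\<lparr>carrier := K\<rparr>" by (rule group.iso_sym[OF gK K(2)])
  then obtain h where h: "h \<in> iso (free_group X) (G\<lparr>carrier := K\<rparr>)" by (auto simp: is_iso_def)
  have nfK: "no_free_pair (G\<lparr>carrier := K\<rparr>)"
    using subgroup.subset[OF K(1)]
    by (intro no_free_pair_embed[OF gK G _ _ nf, of "\<lambda>x. x"]) (auto simp: hom_def)
  have nfF: "no_free_pair (free_group X)"
    using h by (intro no_free_pair_embed[OF group_free_group gK _ _ nfK, of h]) (auto simp: iso_def bij_betw_def)
  have "\<exists>x\<in>X. \<exists>y\<in>X. x \<noteq> y"
  proof (rule ccontr)
    assume "\<not> ?thesis"
    \<comment> \<open>The choice covers the empty basis together with the bases of one
      element.\<close>
    then have "X \<subseteq> {SOME x. x \<in> X}" by (metis singletonI some_in_eq subsetI empty_iff)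
    then have "comm_group (free_group X)" by (rule free_group_singleton_comm)
    then show False using K(3) comm_group.iso_imp_comm_group[OF _ iso group.is_monoid[OF gK]] by blast
  qed
  then obtain x y where xy: "x \<in> X" "y \<in> X" "x \<noteq> y" by blast
  let ?c = "word_class (FL X) (free_rels X)"
  let ?h = "\<lambda>i. if i then x else y"
  have "?c [(?h i, True)] \<in> carrier (free_group X)" for i using xy by (intro word_class_free_group) auto
  then obtain w where w: "w \<noteq> []" "reduced w" "word_val (free_group X) (\<lambda>i. ?c [(?h i, True)]) w = \<one>\<^bsub>free_group X\<^esub>"
    using no_free_pairD[OF nfF, of "\<lambda>i. ?c [(?h i, True)]"] by blast
  let ?w = "map (\<lambda>l. (?h (fst l), snd l)) w"
  have wl: "?w \<in> lists (FL X)" using xy by auto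
  have "word_val (free_group X) (\<lambda>x. ?c [(x, True)]) ?w = \<one>\<^bsub>free_group X\<^esub>"
    by (rule HOL.trans[OF word_val_map[of "free_group X" "\<lambda>x. ?c [(x, True)]" ?h w] w(3)])
  then have "word_cong (FL X) (free_rels X) ?w []"
    using word_val_free_group[OF wl] word_class_free_group(2)[OF wl] by simp
  moreover have "inj_on ?h (fst ` set w)" using xy(3) by (auto simp: inj_on_def)
  then have "reduced ?w" using reduced_map w(2) by blast
  ultimately have "?w = []" by (intro reduced_not_cong_Nil)
  then show False using w(1) by simp
qed

text \<open>A pair without relations is a basis of the subgroup that it generates. The free group is
  taken over the two elements themselves, as the definition of
  \<open>has_nonabelian_free_subgroup\<close> wants a basis in the type of the elements.\<close>

lemma imp_no_free_pair:
  assumes G: "group G" and nf: "\<not> has_nonabelian_free_subgroup G"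
  shows "no_free_pair G"
proof (rule ccontr)
  interpret group G by fact
  assume "\<not> no_free_pair G"
  then obtain f :: "bool \<Rightarrow> 'a" where f: "\<And>x. f x \<in> carrier G"
    and free: "\<And>w. w \<noteq> [] \<Longrightarrow> reduced w \<Longrightarrow> word_val G f w \<noteq> \<one>\<^bsub>G\<^esub>" unfolding no_free_pair_def by blast
  have ne: "f True \<noteq> f False"
    using free[of "[(True, True), (False, False)]"] f by (auto simp: flip_def)
  let ?X = "range f"
  let ?c = "word_class (FL ?X) (free_rels ?X)"
  have "\<And>x. x \<in> ?X \<Longrightarrow> id x \<in> carrier G" using f by auto
  then obtain \<theta> where \<theta>: "\<theta> \<in> hom (free_group ?X) G" "\<forall>w\<in>lists (FL ?X). \<theta> (?c w) = word_val G id w"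
    using free_group_hom[of ?X id] by blast
  interpret h: group_hom "free_group ?X" G \<theta>
    using \<theta>(1) G group_free_group by (simp add: group_hom_def group_hom_axioms_def)
  have inj: "inj_on \<theta> (carrier (free_group ?X))"
  proof -
    have "P = \<one>\<^bsub>free_group ?X\<^esub>" if P: "P \<in> carrier (free_group ?X)" "\<theta> P = \<one>\<^bsub>G\<^esub>" for P
    proof -
      obtain w where w: "w \<in> lists (FL ?X)" "P = ?c w" using P(1) by (auto simp: free_group_eq presented_def)
      obtain v where v: "v \<in> lists (FL ?X)" "reduced v" "word_cong (FL ?X) (free_rels ?X) w v"
        using reduced_form[OF w(1)] by blast
      have Pv: "P = ?c v" using w v(3) by (simp add: word_class_eq_iff)
      have "word_val G id v = \<one>\<^bsub>G\<^esub>" using P(2) \<theta>(2) v(1) Pv by simp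
      \<comment> \<open>Renames the two group elements to the indices of the pair, since the absence
        of relations is assumed for words over the indices.\<close>
      define k where "k x = (x = f True)" for x
      let ?v = "map (\<lambda>l. (k (fst l), snd l)) v"
      have fk: "f (k x) = x" if "x \<in> ?X" for x
        using that ne by (auto simp: k_def) (metis (full_types))
      have inj_k: "inj_on k ?X" using fk by (metis inj_onI)
      have fv: "fst ` set v \<subseteq> ?X" using v(1) by auto
      have red: "reduced ?v" using v(2) reduced_map[OF inj_on_subset[OF inj_k fv]] by blast
      have "word_val G (\<lambda>x. f (k x)) v = word_val G id v"
        using fv by (induction v) (auto simp: fk)
      then have "word_val G f ?v = \<one>\<^bsub>G\<^esub>"
        using \<open>word_val G id v = \<one>\<^bsub>G\<^esub>\<close> by (simp only: word_val_map)
      then have "?v = []" using free[OF _ red] by blast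
      then have "v = []" by simp
      then show ?thesis using Pv by (simp add: free_group_eq presented_def)
    qed
    then show ?thesis using h.inj_iff_trivial_ker by (auto simp: kernel_def)
  qed
  let ?K = "\<theta> ` carrier (free_group ?X)"
  have K: "subgroup ?K G" by (rule h.img_is_subgroup)
  have "\<theta> \<in> iso (free_group ?X) (G\<lparr>carrier := ?K\<rparr>)"
    using inj \<theta>(1) by (auto simp: iso_def hom_def bij_betw_def)
  then have "free_group ?X \<cong> G\<lparr>carrier := ?K\<rparr>" by (rule is_isoI)
  then have iso: "G\<lparr>carrier := ?K\<rparr> \<cong> free_group ?X" by (rule group.iso_sym[OF group_free_group])
  have fK: "f i \<in> ?K" for i
  proof -
    have l: "[(f i, True)] \<in> lists (FL ?X)" by simp
    have "\<theta> (?c [(f i, True)]) = f i" using \<theta>(2)[rule_format, OF l] f by simp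
    then show ?thesis using word_class_free_group(1)[OF l] by (metis image_eqI)
  qed
  have "\<not> comm_group (G\<lparr>carrier := ?K\<rparr>)"
  proof
    assume "comm_group (G\<lparr>carrier := ?K\<rparr>)"
    then interpret c: comm_group "G\<lparr>carrier := ?K\<rparr>" .
    have "f True \<otimes>\<^bsub>G\<^esub> f False = f False \<otimes>\<^bsub>G\<^esub> f True" using c.m_comm[of "f True" "f False"] fK by simp
    then have "word_val G f [(True, True), (False, True), (True, False), (False, False)] = \<one>\<^bsub>G\<^esub>"
      using f inv_mult_group[of "f False" "f True"] r_inv[of "f False \<otimes>\<^bsub>G\<^esub> f True"] by (simp add: m_assoc del: r_inv flip: m_assoc)
    then show False using free[of "[(True, True), (False, True), (True, False), (False, False)]"] by simp
  qed
  then show False using nf K iso unfolding has_nonabelian_free_subgroup_def by blast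
qed

section \<open>Amenability\<close>

definition prob_mean :: "'a set \<Rightarrow> ('a set \<Rightarrow> real) \<Rightarrow> bool" where
  "prob_mean X \<mu> \<longleftrightarrow> (\<forall>A. A \<subseteq> X \<longrightarrow> 0 \<le> \<mu> A) \<and> \<mu> X = 1 \<and>
     (\<forall>A B. A \<subseteq> X \<longrightarrow> B \<subseteq> X \<longrightarrow> A \<inter> B = {} \<longrightarrow> \<mu> (A \<union> B) = \<mu> A + \<mu> B)"

lemma prob_meanD:
  assumes "prob_mean X \<mu>"
  shows "A \<subseteq> X \<Longrightarrow> 0 \<le> \<mu> A" "\<mu> X = 1"
    "A \<subseteq> X \<Longrightarrow> B \<subseteq> X \<Longrightarrow> A \<inter> B = {} \<Longrightarrow> \<mu> (A \<union> B) = \<mu> A + \<mu> B"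
  using assms by (auto simp: prob_mean_def)

lemma prob_mean_le_1:
  assumes "prob_mean X \<mu>" "A \<subseteq> X"
  shows "\<mu> A \<le> 1"
proof -
  have "\<mu> (A \<union> (X - A)) = \<mu> A + \<mu> (X - A)" using assms(2) by (intro prob_meanD(3)[OF assms(1)]) auto
  moreover have "A \<union> (X - A) = X" using assms(2) by auto
  moreover have "0 \<le> \<mu> (X - A)" by (rule prob_meanD(1)[OF assms(1)]) auto
  ultimately show ?thesis using prob_meanD(2)[OF assms(1)] by simp
qed

lemma prob_mean_empty: "prob_mean X \<mu> \<Longrightarrow> \<mu> {} = 0"
  using prob_meanD(3)[of X \<mu> "{}" "{}"] by simp

lemma prob_mean_UN:
  assumes "prob_mean X \<mu>" "finite I" "\<And>i. i \<in> I \<Longrightarrow> A i \<subseteq> X" "\<And>i j. i \<in> I \<Longrightarrow> j \<in> I \<Longrightarrow> i \<noteq> j \<Longrightarrow> A i \<inter> A j = {}"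
  shows "\<mu> (\<Union>i\<in>I. A i) = (\<Sum>i\<in>I. \<mu> (A i))"
  using assms(2-4)
proof (induction I rule: finite_induct)
  case empty
  then show ?case using prob_mean_empty[OF assms(1)] by simp
next
  case (insert i I)
  have "\<mu> (A i \<union> (\<Union>j\<in>I. A j)) = \<mu> (A i) + \<mu> (\<Union>j\<in>I. A j)"
  proof (rule prob_meanD(3)[OF assms(1)])
    show "A i \<inter> (\<Union>j\<in>I. A j) = {}"
    proof -
      have "A i \<inter> A j = {}" if "j \<in> I" for j using insert.prems(2)[of i j] insert.hyps(2) that by auto
      then show ?thesis by auto
    qed
  qed (use insert.prems(1) in auto)
  then show ?case using insert by simp
qed

definition l_invariant :: "('a, 'b) monoid_scheme \<Rightarrow> ('a set \<Rightarrow> real) \<Rightarrow> bool" where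
  "l_invariant G \<mu> \<longleftrightarrow> (\<forall>g\<in>carrier G. \<forall>A. A \<subseteq> carrier G \<longrightarrow> \<mu> (g <#\<^bsub>G\<^esub> A) = \<mu> A)"

lemma amenable_iff: "amenable G \<longleftrightarrow> group G \<and> (\<exists>\<mu>. prob_mean (carrier G) \<mu> \<and> l_invariant G \<mu>)"
  unfolding amenable_def prob_mean_def l_invariant_def by (simp only: conj_assoc)

lemma l_coset_image: "g <#\<^bsub>G\<^esub> A = (\<lambda>x. g \<otimes>\<^bsub>G\<^esub> x) ` A"
  by (auto simp: l_coset_def)

lemma eq_0_if_le_inverse:
  fixes x :: real
  assumes "\<And>n. \<bar>x\<bar> \<le> inverse (real (Suc n))"
  shows "x = 0"
proof (rule ccontr)
  assume "x \<noteq> 0"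
  then obtain n where "inverse (real (Suc n)) < \<bar>x\<bar>" using reals_Archimedean[of "\<bar>x\<bar>"] by auto
  then show False using assms[of n] by linarith
qed

lemma compact_unit_functions: "compact {m :: 'i \<Rightarrow> real. \<forall>i. m i \<in> {0..1}}"
proof -
  have "compactin (product_topology (\<lambda>i::'i. euclidean) UNIV) (PiE UNIV (\<lambda>_. {0..1::real}))"
    by (simp add: compactin_PiE)
  moreover have "PiE UNIV (\<lambda>_. {0..1::real}) = {m :: 'i \<Rightarrow> real. \<forall>i. m i \<in> {0..1}}" by auto
  ultimately show ?thesis by (simp add: euclidean_product_topology flip: compactin_euclidean_iff)
qed

text \<open>Approximately additive and approximately invariant set functions suffice, by compactness of the
  space of all functions from the subsets of the group to the unit interval.\<close>

lemma amenable_approx: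
  fixes G (structure)
  assumes G: "group G"
    and approx: "\<And>S \<epsilon>. finite S \<Longrightarrow> S \<subseteq> carrier G \<Longrightarrow> \<epsilon> > 0 \<Longrightarrow> \<exists>m. (\<forall>A\<subseteq>carrier G. 0 \<le> m A \<and> m A \<le> (1::real)) \<and>
      m (carrier G) = 1 \<and>
      (\<forall>A\<subseteq>carrier G. \<forall>B\<subseteq>carrier G. A \<inter> B = {} \<longrightarrow> \<bar>m (A \<union> B) - m A - m B\<bar> \<le> \<epsilon>) \<and>
      (\<forall>g\<in>S. \<forall>A\<subseteq>carrier G. \<bar>m (g <# A) - m A\<bar> \<le> \<epsilon>)"
  shows "amenable G"
proof -
  let ?P = "{A. A \<subseteq> carrier G}"
  let ?X = "{m :: 'a set \<Rightarrow> real. \<forall>A. m A \<in> {0..1}}"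
  define D where "D = {(A, B). A \<subseteq> carrier G \<and> B \<subseteq> carrier G \<and> A \<inter> B = {}}"
  \<comment> \<open>Each of the conditions involves finitely many values of \<open>m\<close>, so it
    is closed for pointwise convergence, and so is their intersection.\<close>
  define E where "E S n = {m :: 'a set \<Rightarrow> real. m (carrier G) = 1} \<inter>
      (\<Inter>p\<in>D. {m. \<bar>m (fst p \<union> snd p) - m (fst p) - m (snd p)\<bar> \<le> inverse (real (Suc n))}) \<inter>
      (\<Inter>p\<in>S \<times> ?P. {m. \<bar>m (fst p <# snd p) - m (snd p)\<bar> \<le> inverse (real (Suc n))})" for S n
  have cont: "continuous_on UNIV (\<lambda>m :: 'a set \<Rightarrow> real. m A)" for A
    by (rule continuous_on_product_coordinates)
  have closed_E: "closed (E S n)" for S n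
    unfolding E_def
    by (intro closed_Int closed_INT ballI closed_Collect_le closed_Collect_eq continuous_intros cont)
  define I where "I = {S. finite S \<and> S \<subseteq> carrier G} \<times> (UNIV :: nat set)"
  have "?X \<inter> \<Inter>((\<lambda>p. E (fst p) (snd p)) ` I) \<noteq> {}"
  proof (rule compact_imp_fip[OF compact_unit_functions])
    fix T assume "T \<in> (\<lambda>p. E (fst p) (snd p)) ` I"
    then show "closed T" using closed_E by auto
  next
    fix F assume F: "finite F" "F \<subseteq> (\<lambda>p. E (fst p) (snd p)) ` I"
    then obtain J where J: "finite J" "J \<subseteq> I" "F = (\<lambda>p. E (fst p) (snd p)) ` J"
      using finite_subset_image[OF F] by blast
    \<comment> \<open>One approximate mean for all finitely many conditions: take all group elements
      together and the smallest of the tolerances.\<close>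
    define S where "S = (\<Union>p\<in>J. fst p)"
    define n where "n = Max (insert 0 (snd ` J))"
    have JS: "finite (fst p) \<and> fst p \<subseteq> carrier G" if "p \<in> J" for p
      using subsetD[OF J(2) that] by (simp add: I_def mem_Times_iff)
    have S: "finite S" "S \<subseteq> carrier G" using J(1) JS by (simp_all add: S_def UN_subset_iff)
    obtain m where m: "\<forall>A\<subseteq>carrier G. 0 \<le> m A \<and> m A \<le> (1::real)" "m (carrier G) = 1"
      "\<forall>A\<subseteq>carrier G. \<forall>B\<subseteq>carrier G. A \<inter> B = {} \<longrightarrow> \<bar>m (A \<union> B) - m A - m B\<bar> \<le> inverse (real (Suc n))"
      "\<forall>g\<in>S. \<forall>A\<subseteq>carrier G. \<bar>m (g <# A) - m A\<bar> \<le> inverse (real (Suc n))"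
      using approx[OF S, of "inverse (real (Suc n))"] by auto
    \<comment> \<open>The compact space consists of functions on all sets, whereas \<open>m\<close>
      is controlled on subsets of the carrier only.\<close>
    define m' where "m' A = (if A \<subseteq> carrier G then m A else 0)" for A
    have mX: "m' \<in> ?X" using m(1) by (simp add: m'_def)
    have sub: "g <# A \<subseteq> carrier G" if "g \<in> carrier G" "A \<subseteq> carrier G" for g A
      using that group.l_coset_subset_G[OF G] by blast
    have mE: "m' \<in> E T k" if "(T, k) \<in> J" for T k
    proof -
      have "T \<subseteq> S" using that unfolding S_def by force
      have "k \<le> n" unfolding n_def using that J(1) by (intro Max_ge) force+
      then have le: "inverse (real (Suc n)) \<le> inverse (real (Suc k))" by simp
      have 1: "\<bar>m' (fst p \<union> snd p) - m' (fst p) - m' (snd p)\<bar> \<le> inverse (real (Suc k))" if "p \<in> D" for p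
      proof -
        have p: "fst p \<subseteq> carrier G" "snd p \<subseteq> carrier G" "fst p \<inter> snd p = {}" using that by (auto simp: D_def)
        have "\<bar>m (fst p \<union> snd p) - m (fst p) - m (snd p)\<bar> \<le> inverse (real (Suc n))"
          using m(3) p by blast
        from order.trans[OF this le] show ?thesis using p by (simp add: m'_def)
      qed
      have 2: "\<bar>m' (fst p <# snd p) - m' (snd p)\<bar> \<le> inverse (real (Suc k))" if "p \<in> T \<times> ?P" for p
      proof -
        have p: "fst p \<in> S" "snd p \<subseteq> carrier G" using that \<open>T \<subseteq> S\<close> by auto
        have "\<bar>m (fst p <# snd p) - m (snd p)\<bar> \<le> inverse (real (Suc n))" using m(4) p by blast
        moreover have "fst p <# snd p \<subseteq> carrier G" using sub p S by blast
        ultimately show ?thesis using p order.trans[OF _ le] by (simp add: m'_def)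
      qed
      show ?thesis unfolding E_def using 1 2 m(2) by (auto simp: m'_def)
    qed
    have "m' \<in> ?X \<inter> \<Inter>F" unfolding J(3) using mX mE by auto
    then show "?X \<inter> \<Inter>F \<noteq> {}" by blast
  qed
  then obtain \<mu> where \<mu>_X: "\<mu> \<in> ?X" and \<mu>_I: "\<And>p. p \<in> I \<Longrightarrow> \<mu> \<in> E (fst p) (snd p)" by blast
  have "\<mu> \<in> E S n" if "finite S" "S \<subseteq> carrier G" for S n
    using \<mu>_I[of "(S, n)"] that by (simp add: I_def)
  note \<mu> = \<mu>_X this
  have E_D: "\<bar>m (fst p \<union> snd p) - m (fst p) - m (snd p)\<bar> \<le> inverse (real (Suc n))"
    if "m \<in> E S n" "p \<in> D" for m S n p using that unfolding E_def by blast
  have E_S: "\<bar>m (fst p <# snd p) - m (snd p)\<bar> \<le> inverse (real (Suc n))"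
    if "m \<in> E S n" "p \<in> S \<times> ?P" for m S n p using that unfolding E_def by blast
  have "prob_mean (carrier G) \<mu>"
    unfolding prob_mean_def
  proof (intro conjI allI impI)
    show "0 \<le> \<mu> A" for A using \<mu>(1) by auto
    show "\<mu> (carrier G) = 1" using \<mu>(2)[of "{}" 0] by (simp add: E_def)
    fix A B assume AB: "A \<subseteq> carrier G" "B \<subseteq> carrier G" "A \<inter> B = {}"
    have "\<bar>\<mu> (A \<union> B) - \<mu> A - \<mu> B\<bar> \<le> inverse (real (Suc n))" for n
    proof -
      have "(A, B) \<in> D" using AB by (simp add: D_def)
      then show ?thesis using E_D[OF \<mu>(2)[of "{}" n], of "(A, B)"] by simp
    qed
    then have "\<mu> (A \<union> B) - \<mu> A - \<mu> B = 0" by (rule eq_0_if_le_inverse)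
    then show "\<mu> (A \<union> B) = \<mu> A + \<mu> B" by simp
  qed
  moreover have "l_invariant G \<mu>"
    unfolding l_invariant_def
  proof (intro ballI allI impI)
    fix g A assume gA: "g \<in> carrier G" "A \<subseteq> carrier G"
    have "\<bar>\<mu> (g <# A) - \<mu> A\<bar> \<le> inverse (real (Suc n))" for n
    proof -
      have "(g, A) \<in> {g} \<times> ?P" using gA by simp
      then show ?thesis using E_S[OF \<mu>(2)[of "{g}" n], of "(g, A)"] gA by simp
    qed
    then have "\<mu> (g <# A) - \<mu> A = 0" by (rule eq_0_if_le_inverse)
    then show "\<mu> (g <# A) = \<mu> A" by simp
  qed
  ultimately show ?thesis using G by (auto simp: amenable_iff)
qed

lemma amenable_approx_mean:
  fixes G (structure)
  assumes G: "group G"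
    and approx: "\<And>S \<epsilon>. finite S \<Longrightarrow> S \<subseteq> carrier G \<Longrightarrow> \<epsilon> > 0 \<Longrightarrow> \<exists>m. prob_mean (carrier G) m \<and>
      (\<forall>g\<in>S. \<forall>A\<subseteq>carrier G. \<bar>m (g <# A) - m A\<bar> \<le> \<epsilon>)"
  shows "amenable G"
proof (rule amenable_approx[OF G])
  fix S and \<epsilon> :: real assume "finite S" "S \<subseteq> carrier G" "\<epsilon> > 0"
  then obtain m where m: "prob_mean (carrier G) m" "\<forall>g\<in>S. \<forall>A\<subseteq>carrier G. \<bar>m (g <# A) - m A\<bar> \<le> \<epsilon>" using approx by blast
  show "\<exists>m. (\<forall>A\<subseteq>carrier G. 0 \<le> m A \<and> m A \<le> (1::real)) \<and> m (carrier G) = 1 \<and>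
      (\<forall>A\<subseteq>carrier G. \<forall>B\<subseteq>carrier G. A \<inter> B = {} \<longrightarrow> \<bar>m (A \<union> B) - m A - m B\<bar> \<le> \<epsilon>) \<and>
      (\<forall>g\<in>S. \<forall>A\<subseteq>carrier G. \<bar>m (g <# A) - m A\<bar> \<le> \<epsilon>)"
  proof (intro exI[of _ m] conjI allI impI)
    fix A B assume "A \<subseteq> carrier G" "B \<subseteq> carrier G" "A \<inter> B = {}"
    then show "\<bar>m (A \<union> B) - m A - m B\<bar> \<le> \<epsilon>" using prob_meanD(3)[OF m(1)] \<open>\<epsilon> > 0\<close> by simp
  qed (use m(2) prob_meanD[OF m(1)] prob_mean_le_1[OF m(1)] in simp_all)
qed

lemma amenable_finite:
  fixes G (structure)
  assumes "group G" "finite (carrier G)"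
  shows "amenable G"
proof -
  interpret group G by fact
  let ?\<mu> = "\<lambda>A. real (card A) / real (card (carrier G))"
  have "card (carrier G) \<noteq> 0" using assms(2) by auto
  then have "prob_mean (carrier G) ?\<mu>"
    using assms(2) by (auto simp: prob_mean_def card_Un_disjoint finite_subset add_divide_distrib)
  moreover have "l_invariant G ?\<mu>"
    unfolding l_invariant_def
  proof (intro ballI allI impI)
    fix g A assume "g \<in> carrier G" "A \<subseteq> carrier G"
    then have "card (g <# A) = card A"
      unfolding l_coset_image by (intro card_image) (auto simp: inj_on_def subset_iff)
    then show "?\<mu> (g <# A) = ?\<mu> A" by simp
  qed
  ultimately show ?thesis using assms(1) by (auto simp: amenable_iff)
qed

text \<open>Averaging a mean over the powers of \<open>g\<close> with exponents below
  \<open>n\<close> makes it invariant under \<open>g\<close> up to \<open>1 / n\<close>, by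
  telescoping. The powers commute with the elements treated before, so the invariance reached for
  those survives.\<close>

lemma amenable_abelian:
  fixes G (structure)
  assumes "comm_group G"
  shows "amenable G"
proof (rule amenable_approx_mean)
  interpret comm_group G by fact
  show "group G" by (rule is_group)
  fix S and \<epsilon> :: real assume "finite S" "S \<subseteq> carrier G" and \<epsilon>: "\<epsilon> > 0"
  obtain n :: nat where n: "n > 0" "1 / real n < \<epsilon>"
    using reals_Archimedean[OF \<epsilon>] by (metis inverse_eq_divide zero_less_Suc)
  from \<open>finite S\<close> \<open>S \<subseteq> carrier G\<close>
  show "\<exists>m. prob_mean (carrier G) m \<and> (\<forall>g\<in>S. \<forall>A\<subseteq>carrier G. \<bar>m (g <# A) - m A\<bar> \<le> \<epsilon>)"
  proof (induction S rule: finite_induct)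
    case empty
    have "prob_mean (carrier G) (\<lambda>A. if \<one> \<in> A then 1 else 0)" by (auto simp: prob_mean_def)
    then show ?case by auto
  next
    case (insert g S)
    then have g: "g \<in> carrier G" and S: "S \<subseteq> carrier G" by auto
    obtain m where m: "prob_mean (carrier G) m" "\<forall>h\<in>S. \<forall>A\<subseteq>carrier G. \<bar>m (h <# A) - m A\<bar> \<le> \<epsilon>"
      using insert.IH[OF S] by blast
    define m' where "m' A = (\<Sum>i<n. m (g [^] i <# A)) / real n" for A
    have sub: "h <# A \<subseteq> carrier G" if "h \<in> carrier G" "A \<subseteq> carrier G" for h A
      using that l_coset_subset_G by blast
    have inj: "(h <# A) \<inter> (h <# B) = {}" if "h \<in> carrier G" "A \<subseteq> carrier G" "B \<subseteq> carrier G" "A \<inter> B = {}" for h A B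
      unfolding l_coset_image using that by (auto simp: subset_iff)
    have whole: "h <# carrier G = carrier G" if "h \<in> carrier G" for h
    proof
      show "carrier G \<subseteq> h <# carrier G"
      proof
        fix x assume "x \<in> carrier G"
        then show "x \<in> h <# carrier G" unfolding l_coset_image
          using that by (intro image_eqI[of _ _ "inv h \<otimes> x"]) (auto simp: m_assoc[symmetric])
      qed
    qed (rule sub[OF that subset_refl])
    have "prob_mean (carrier G) m'"
      unfolding prob_mean_def
    proof (intro conjI allI impI)
      fix A assume "A \<subseteq> carrier G"
      then show "0 \<le> m' A" unfolding m'_def
        using sub g by (intro divide_nonneg_nonneg sum_nonneg prob_meanD(1)[OF m(1)]) auto
    next
      show "m' (carrier G) = 1" using n(1) g by (simp add: m'_def whole prob_meanD(2)[OF m(1)])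
    next
      fix A B assume AB: "A \<subseteq> carrier G" "B \<subseteq> carrier G" "A \<inter> B = {}"
      have "m (g [^] i <# (A \<union> B)) = m (g [^] i <# A) + m (g [^] i <# B)" for i :: nat
      proof -
        have "g [^] i <# (A \<union> B) = (g [^] i <# A) \<union> (g [^] i <# B)" by (auto simp: l_coset_image)
        then show ?thesis using prob_meanD(3)[OF m(1) sub sub inj] AB g by simp
      qed
      then show "m' (A \<union> B) = m' A + m' B" by (simp add: m'_def sum.distrib add_divide_distrib)
    qed
    moreover have "\<bar>m' (h <# A) - m' A\<bar> \<le> \<epsilon>" if h: "h \<in> insert g S" and A: "A \<subseteq> carrier G" for h A
    proof (cases "h = g")
      case True
      have step: "g [^] i <# (g <# A) = g [^] Suc i <# A" for i :: nat
        using g A by (simp add: lcos_m_assoc)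
      have "m' (g <# A) - m' A = ((\<Sum>i<n. m (g [^] Suc i <# A)) - (\<Sum>i<n. m (g [^] i <# A))) / real n"
        unfolding m'_def step by (simp add: diff_divide_distrib)
      also have "\<dots> = (m (g [^] n <# A) - m (g [^] (0::nat) <# A)) / real n"
        using sum_lessThan_telescope[of "\<lambda>i. m (g [^] i <# A)" n] by (simp add: sum_subtractf)
      finally have eq: "m' (g <# A) - m' A = (m (g [^] n <# A) - m (g [^] (0::nat) <# A)) / real n" .
      have b: "0 \<le> m (g [^] i <# A)" "m (g [^] i <# A) \<le> 1" for i :: nat
        using sub[of "g [^] i" A] g A prob_meanD(1)[OF m(1)] prob_mean_le_1[OF m(1)] by auto
      have "\<bar>m (g [^] n <# A) - m (g [^] (0::nat) <# A)\<bar> \<le> 1" using b[of n] b[of 0] by linarith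
      then have "\<bar>m' (g <# A) - m' A\<bar> \<le> 1 / real n" unfolding eq by (simp add: divide_right_mono)
      then show ?thesis using n(2) True by simp
    next
      case False
      then have hS: "h \<in> S" "h \<in> carrier G" using h S by auto
      have comm: "g [^] i <# (h <# A) = h <# (g [^] i <# A)" for i :: nat
        using g A hS m_comm[of "g [^] i" h] by (simp add: lcos_m_assoc)
      have "\<bar>m' (h <# A) - m' A\<bar> = \<bar>\<Sum>i<n. m (h <# (g [^] i <# A)) - m (g [^] i <# A)\<bar> / real n"
        unfolding m'_def comm by (simp add: sum_subtractf flip: diff_divide_distrib)
      also have "\<dots> \<le> (\<Sum>i<n. \<epsilon>) / real n"
      proof (intro divide_right_mono order.trans[OF sum_abs sum_mono])
        fix i assume "i \<in> {..<n}"
        have "g [^] i <# A \<subseteq> carrier G" using sub[of "g [^] i" A] g A by simp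
        then show "\<bar>m (h <# (g [^] i <# A)) - m (g [^] i <# A)\<bar> \<le> \<epsilon>" using m(2) hS(1) by blast
      qed simp
      also have "\<dots> = \<epsilon>" using n(1) by simp
      finally show ?thesis .
    qed
    ultimately show ?case by blast
  qed
qed

text \<open>A finite set \<open>S\<close> lies in one member \<open>K\<close>. Intersecting sets
  with \<open>K\<close> extends the mean of \<open>K\<close> to the whole group, and the extension
  is invariant under \<open>S\<close> without error.\<close>

lemma amenable_union:
  fixes G (structure)
  assumes G: "group G" and ne: "\<K> \<noteq> {}" and sub: "\<And>K. K \<in> \<K> \<Longrightarrow> subgroup K G"
    and am: "\<And>K. K \<in> \<K> \<Longrightarrow> amenable (G\<lparr>carrier := K\<rparr>)"
    and dir: "\<And>K L. K \<in> \<K> \<Longrightarrow> L \<in> \<K> \<Longrightarrow> \<exists>M\<in>\<K>. K \<union> L \<subseteq> M"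
    and un: "\<Union>\<K> = carrier G"
  shows "amenable G"
proof (rule amenable_approx_mean[OF G])
  interpret group G by fact
  fix S and \<epsilon> :: real assume S: "finite S" "S \<subseteq> carrier G" and \<epsilon>: "\<epsilon> > 0"
  have "\<exists>K\<in>\<K>. S \<subseteq> K"
    using S
  proof (induction S rule: finite_induct)
    case empty
    then show ?case using ne by auto
  next
    case (insert x S)
    then obtain K where K: "K \<in> \<K>" "S \<subseteq> K" by auto
    have "x \<in> \<Union>\<K>" using insert.prems un by auto
    then obtain L where L: "L \<in> \<K>" "x \<in> L" by blast
    obtain M where "M \<in> \<K>" "K \<union> L \<subseteq> M" using dir[OF K(1) L(1)] by blast
    then show ?case using K(2) L(2) by (intro bexI[of _ M]) auto
  qed
  then obtain K where K: "K \<in> \<K>" "S \<subseteq> K" by blast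
  have KG: "K \<subseteq> carrier G" using subgroup.subset[OF sub[OF K(1)]] .
  obtain \<mu> where \<mu>: "prob_mean K \<mu>" "l_invariant (G\<lparr>carrier := K\<rparr>) \<mu>" using am[OF K(1)] by (auto simp: amenable_iff)
  have "prob_mean (carrier G) (\<lambda>A. \<mu> (A \<inter> K))"
    unfolding prob_mean_def
  proof (intro conjI allI impI)
    fix A show "0 \<le> \<mu> (A \<inter> K)" by (rule prob_meanD(1)[OF \<mu>(1)]) auto
  next
    show "\<mu> (carrier G \<inter> K) = 1" using KG prob_meanD(2)[OF \<mu>(1)] by (simp add: Int_absorb1)
  next
    fix A B assume "A \<inter> B = ({} :: 'a set)"
    then have "\<mu> ((A \<inter> K) \<union> (B \<inter> K)) = \<mu> (A \<inter> K) + \<mu> (B \<inter> K)" by (intro prob_meanD(3)[OF \<mu>(1)]) auto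
    then show "\<mu> ((A \<union> B) \<inter> K) = \<mu> (A \<inter> K) + \<mu> (B \<inter> K)" by (simp add: Int_Un_distrib2)
  qed
  moreover have "\<mu> ((g <# A) \<inter> K) = \<mu> (A \<inter> K)" if g: "g \<in> S" and A: "A \<subseteq> carrier G" for g A
  proof -
    have gK: "g \<in> K" "g \<in> carrier G" using g K KG by auto
    have "(g <# A) \<inter> K = g <#\<^bsub>G\<lparr>carrier := K\<rparr>\<^esub> (A \<inter> K)"
    proof (intro equalityI subsetI)
      fix x assume "x \<in> (g <# A) \<inter> K"
      then obtain a where a: "a \<in> A" "x = g \<otimes> a" "x \<in> K" by (auto simp: l_coset_image)
      have aeq: "a = inv g \<otimes> x" using a A gK by (simp add: inv_solve_left subset_iff)
      have "a \<in> K" unfolding aeq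
        by (rule subgroup.m_closed[OF sub[OF K(1)] subgroup.m_inv_closed[OF sub[OF K(1)] gK(1)] a(3)])
      then show "x \<in> g <#\<^bsub>G\<lparr>carrier := K\<rparr>\<^esub> (A \<inter> K)" using a by (auto simp: l_coset_image)
    next
      fix x assume "x \<in> g <#\<^bsub>G\<lparr>carrier := K\<rparr>\<^esub> (A \<inter> K)"
      then show "x \<in> (g <# A) \<inter> K" using gK subgroup.m_closed[OF sub[OF K(1)]] by (auto simp: l_coset_image)
    qed
    then show ?thesis using \<mu>(2) gK(1) by (simp add: l_invariant_def)
  qed
  ultimately show "\<exists>m. prob_mean (carrier G) m \<and> (\<forall>g\<in>S. \<forall>A\<subseteq>carrier G. \<bar>m (g <# A) - m A\<bar> \<le> \<epsilon>)"
    using \<epsilon> by (intro exI[of _ "\<lambda>A. \<mu> (A \<inter> K)"]) simp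
qed

section \<open>Integration against a finitely additive mean\<close>

definition mean_int :: "'q set \<Rightarrow> ('q set \<Rightarrow> real) \<Rightarrow> ('q \<Rightarrow> real) \<Rightarrow> real" where
  "mean_int X \<nu> H = (\<Sum>v\<in>H ` X. v * \<nu> {q \<in> X. H q = v})"

text \<open>The level sets of \<open>H\<close> are finite disjoint unions of fibres of
  \<open>P\<close>. With \<open>P\<close> a pair of functions, sums and comparisons of their
  integrals become termwise.\<close>

lemma mean_int_refine:
  assumes \<nu>: "prob_mean X \<nu>" and P: "finite (P ` X)" and H: "\<And>q. q \<in> X \<Longrightarrow> H q = w (P q)"
  shows "mean_int X \<nu> H = (\<Sum>t\<in>P ` X. w t * \<nu> {q \<in> X. P q = t})"
proof -
  have HX: "H ` X = w ` (P ` X)" using H by force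
  have "(\<Sum>t\<in>P ` X. w t * \<nu> {q \<in> X. P q = t}) = (\<Sum>v\<in>H ` X. \<Sum>t\<in>{t \<in> P ` X. w t = v}. w t * \<nu> {q \<in> X. P q = t})"
    unfolding HX by (rule sum.image_gen[OF P])
  also have "\<dots> = (\<Sum>v\<in>H ` X. v * \<nu> {q \<in> X. H q = v})"
  proof (rule sum.cong[OF HOL.refl])
    fix v assume "v \<in> H ` X"
    have "{q \<in> X. H q = v} = (\<Union>t\<in>{t \<in> P ` X. w t = v}. {q \<in> X. P q = t})" using H by auto
    moreover have "\<nu> (\<Union>t\<in>{t \<in> P ` X. w t = v}. {q \<in> X. P q = t}) = (\<Sum>t\<in>{t \<in> P ` X. w t = v}. \<nu> {q \<in> X. P q = t})"
      using P by (intro prob_mean_UN[OF \<nu>]) auto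
    ultimately show "(\<Sum>t\<in>{t \<in> P ` X. w t = v}. w t * \<nu> {q \<in> X. P q = t}) = v * \<nu> {q \<in> X. H q = v}"
      by (simp add: sum_distrib_left)
  qed
  finally show ?thesis by (simp add: mean_int_def)
qed

lemma mean_int_const:
  assumes "prob_mean X \<nu>" "X \<noteq> {}"
  shows "mean_int X \<nu> (\<lambda>_. c) = c"
  using assms prob_meanD(2)[OF assms(1)] by (simp add: mean_int_def image_constant_conv)

lemma mean_int_add:
  assumes \<nu>: "prob_mean X \<nu>" and f: "finite (F ` X)" and g: "finite (H ` X)"
  shows "mean_int X \<nu> (\<lambda>q. F q + H q) = mean_int X \<nu> F + mean_int X \<nu> H"
proof -
  let ?P = "\<lambda>q. (F q, H q)"
  have "?P ` X \<subseteq> F ` X \<times> H ` X" by auto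
  then have fin: "finite (?P ` X)" using f g finite_subset by blast
  show ?thesis
    using mean_int_refine[OF \<nu> fin, of F fst] mean_int_refine[OF \<nu> fin, of H snd]
      mean_int_refine[OF \<nu> fin, of "\<lambda>q. F q + H q" "\<lambda>t. fst t + snd t"]
    by (simp add: sum.distrib distrib_right)
qed

lemma mean_int_mono:
  assumes \<nu>: "prob_mean X \<nu>" and f: "finite (F ` X)" and g: "finite (H ` X)" and le: "\<And>q. q \<in> X \<Longrightarrow> F q \<le> H q"
  shows "mean_int X \<nu> F \<le> mean_int X \<nu> H"
proof -
  let ?P = "\<lambda>q. (F q, H q)"
  have "?P ` X \<subseteq> F ` X \<times> H ` X" by auto
  then have fin: "finite (?P ` X)" using f g finite_subset by blast
  have "(\<Sum>t\<in>?P ` X. fst t * \<nu> {q \<in> X. ?P q = t}) \<le> (\<Sum>t\<in>?P ` X. snd t * \<nu> {q \<in> X. ?P q = t})"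
  proof (rule sum_mono)
    fix t assume "t \<in> ?P ` X"
    then have "fst t \<le> snd t" using le by auto
    moreover have "0 \<le> \<nu> {q \<in> X. ?P q = t}" by (rule prob_meanD(1)[OF \<nu>]) auto
    ultimately show "fst t * \<nu> {q \<in> X. ?P q = t} \<le> snd t * \<nu> {q \<in> X. ?P q = t}" by (rule mult_right_mono)
  qed
  then show ?thesis
    using mean_int_refine[OF \<nu> fin, of F fst] mean_int_refine[OF \<nu> fin, of H snd] by simp
qed

lemma mean_int_shift:
  fixes Q (structure)
  assumes Q: "group Q" and \<nu>: "l_invariant Q \<nu>" and g: "g \<in> carrier Q"
    and HF: "\<And>q. q \<in> carrier Q \<Longrightarrow> H (g \<otimes> q) = F q"
  shows "mean_int (carrier Q) \<nu> H = mean_int (carrier Q) \<nu> F"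
proof -
  interpret group Q by fact
  have surj: "\<exists>r\<in>carrier Q. q = g \<otimes> r" if "q \<in> carrier Q" for q
    using that g by (intro bexI[of _ "inv g \<otimes> q"]) (auto simp: m_assoc[symmetric])
  have lev: "{q \<in> carrier Q. H q = v} = g <# {q \<in> carrier Q. F q = v}" for v
    unfolding l_coset_image
  proof (intro equalityI subsetI)
    fix q assume q: "q \<in> {q \<in> carrier Q. H q = v}"
    then obtain r where r: "r \<in> carrier Q" "q = g \<otimes> r" using surj by blast
    then have "F r = v" using HF q by auto
    then show "q \<in> (\<lambda>x. g \<otimes> x) ` {q \<in> carrier Q. F q = v}" using r by blast
  next
    fix q assume "q \<in> (\<lambda>x. g \<otimes> x) ` {q \<in> carrier Q. F q = v}"
    then show "q \<in> {q \<in> carrier Q. H q = v}" using HF g by auto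
  qed
  have "\<nu> {q \<in> carrier Q. H q = v} = \<nu> {q \<in> carrier Q. F q = v}" for v
    unfolding lev using \<nu> g by (auto simp: l_invariant_def)
  moreover have "H ` carrier Q = F ` carrier Q"
  proof (intro equalityI subsetI)
    fix v assume "v \<in> H ` carrier Q"
    then obtain q where q: "q \<in> carrier Q" "v = H q" by auto
    then obtain r where "r \<in> carrier Q" "q = g \<otimes> r" using surj by blast
    then show "v \<in> F ` carrier Q" using q HF by auto
  next
    fix v assume "v \<in> F ` carrier Q"
    then obtain q where "q \<in> carrier Q" "v = F q" by auto
    then show "v \<in> H ` carrier Q" using HF g by (intro image_eqI[of _ _ "g \<otimes> q"]) auto
  qed
  ultimately show ?thesis by (simp add: mean_int_def)
qed

text \<open>As \<open>\<pi>\<close> may miss part of \<open>Q\<close>, a section of it is replaced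
  as follows. Every right coset of the image gets a representative \<open>rp q\<close>, and
  \<open>\<kappa> q\<close> lifts \<open>q\<close> times the inverse of \<open>rp q\<close>, an
  element of the image. Multiplying \<open>q\<close> from the left by \<open>\<pi> k\<close> leaves
  the representative alone.\<close>

lemma equivariant_section:
  assumes K: "group K" and Q: "group Q" and \<pi>: "\<pi> \<in> hom K Q"
  shows "\<exists>\<kappa>. (\<forall>q\<in>carrier Q. \<kappa> q \<in> carrier K) \<and>
    (\<forall>k\<in>carrier K. \<forall>q\<in>carrier Q. \<pi> (\<kappa> (\<pi> k \<otimes>\<^bsub>Q\<^esub> q)) = \<pi> k \<otimes>\<^bsub>Q\<^esub> \<pi> (\<kappa> q))"
proof -
  interpret group_hom K Q \<pi> using assms by (simp add: group_hom_def group_hom_axioms_def)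
  let ?P = "\<pi> ` carrier K"
  have P: "subgroup ?P Q" by (rule img_is_subgroup)
  define rp where "rp q = (SOME r. r \<in> ?P #>\<^bsub>Q\<^esub> q)" for q
  have rp: "\<exists>p\<in>?P. rp q = p \<otimes>\<^bsub>Q\<^esub> q" if "q \<in> carrier Q" for q
  proof -
    have "q \<in> ?P #>\<^bsub>Q\<^esub> q" using H.rcos_self[OF that P] .
    then have "rp q \<in> ?P #>\<^bsub>Q\<^esub> q" unfolding rp_def by (rule someI)
    then show ?thesis by (auto simp: r_coset_def)
  qed
  have rp_inv: "rp (p \<otimes>\<^bsub>Q\<^esub> q) = rp q" if "p \<in> ?P" "q \<in> carrier Q" for p q
  proof -
    have "p \<in> carrier Q" using that(1) by auto
    then have "?P #>\<^bsub>Q\<^esub> (p \<otimes>\<^bsub>Q\<^esub> q) = (?P #>\<^bsub>Q\<^esub> p) #>\<^bsub>Q\<^esub> q"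
      using that(2) subgroup.subset[OF P] by (simp add: H.coset_mult_assoc)
    also have "?P #>\<^bsub>Q\<^esub> p = ?P" using that(1) \<open>p \<in> carrier Q\<close> P by (simp add: H.coset_join2)
    finally show ?thesis by (simp add: rp_def)
  qed
  define \<kappa> where "\<kappa> q = (SOME k. k \<in> carrier K \<and> \<pi> k = q \<otimes>\<^bsub>Q\<^esub> inv\<^bsub>Q\<^esub> rp q)" for q
  have \<kappa>: "\<kappa> q \<in> carrier K \<and> \<pi> (\<kappa> q) = q \<otimes>\<^bsub>Q\<^esub> inv\<^bsub>Q\<^esub> rp q" if q: "q \<in> carrier Q" for q
  proof -
    obtain k where k: "k \<in> carrier K" "rp q = \<pi> k \<otimes>\<^bsub>Q\<^esub> q" using rp[OF q] by auto
    have "q \<otimes>\<^bsub>Q\<^esub> inv\<^bsub>Q\<^esub> rp q = \<pi> (inv\<^bsub>K\<^esub> k)"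
      using k q by (simp add: H.inv_mult_group H.m_assoc[symmetric])
    then have "\<exists>k. k \<in> carrier K \<and> \<pi> k = q \<otimes>\<^bsub>Q\<^esub> inv\<^bsub>Q\<^esub> rp q" using k by (intro exI[of _ "inv\<^bsub>K\<^esub> k"]) simp
    then show ?thesis unfolding \<kappa>_def by (rule someI_ex)
  qed
  have "\<pi> (\<kappa> (\<pi> k \<otimes>\<^bsub>Q\<^esub> q)) = \<pi> k \<otimes>\<^bsub>Q\<^esub> \<pi> (\<kappa> q)" if "k \<in> carrier K" "q \<in> carrier Q" for k q
  proof -
    have c: "\<pi> k \<in> carrier Q" using that by simp
    have "rp q \<in> carrier Q" using rp[OF that(2)] that by auto
    then show ?thesis
      using \<kappa>[of q] \<kappa>[of "\<pi> k \<otimes>\<^bsub>Q\<^esub> q"] that c rp_inv[of "\<pi> k" q] by (simp add: H.m_assoc)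
  qed
  then show ?thesis using \<kappa> by blast
qed

text \<open>A set is measured coset by coset: \<open>F A q\<close> is the mean of its part in the
  coset of the kernel through \<open>\<kappa> q\<close>, and this is integrated over
  \<open>q\<close>. Rounding \<open>F\<close> to multiples of \<open>1 / n\<close> leaves finitely
  many values; the price is an error \<open>1 / n\<close> in additivity, which
  \<open>amenable_approx\<close> tolerates.\<close>

lemma amenable_extension:
  assumes K: "group K" and Q: "group Q" and \<pi>: "\<pi> \<in> hom K Q"
    and ker: "amenable (K\<lparr>carrier := kernel K Q \<pi>\<rparr>)" and amQ: "amenable Q"
  shows "amenable K"
proof (rule amenable_approx[OF K])
  interpret group_hom K Q \<pi> using assms by (simp add: group_hom_def group_hom_axioms_def)
  let ?N = "kernel K Q \<pi>" and ?X = "carrier Q"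
  have N: "subgroup ?N K" by (rule subgroup_kernel)
  obtain \<mu> where \<mu>: "prob_mean ?N \<mu>" "l_invariant (K\<lparr>carrier := ?N\<rparr>) \<mu>" using ker by (auto simp: amenable_iff)
  obtain \<nu> where \<nu>: "prob_mean ?X \<nu>" "l_invariant Q \<nu>" using amQ by (auto simp: amenable_iff)
  obtain \<kappa> where \<kappa>: "\<And>q. q \<in> ?X \<Longrightarrow> \<kappa> q \<in> carrier K"
    "\<And>k q. k \<in> carrier K \<Longrightarrow> q \<in> ?X \<Longrightarrow> \<pi> (\<kappa> (\<pi> k \<otimes>\<^bsub>Q\<^esub> q)) = \<pi> k \<otimes>\<^bsub>Q\<^esub> \<pi> (\<kappa> q)"
    using equivariant_section[OF K Q \<pi>] by blast
  define F where "F A q = \<mu> {x \<in> ?N. \<kappa> q \<otimes>\<^bsub>K\<^esub> x \<in> A}" for A q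
  have F01: "0 \<le> F A q" "F A q \<le> 1" for A q
    unfolding F_def by (auto intro!: prob_meanD(1)[OF \<mu>(1)] prob_mean_le_1[OF \<mu>(1)])
  have F_add: "F (A \<union> B) q = F A q + F B q" if "A \<inter> B = {}" for A B q
  proof -
    have "{x \<in> ?N. \<kappa> q \<otimes>\<^bsub>K\<^esub> x \<in> A \<union> B} = {x \<in> ?N. \<kappa> q \<otimes>\<^bsub>K\<^esub> x \<in> A} \<union> {x \<in> ?N. \<kappa> q \<otimes>\<^bsub>K\<^esub> x \<in> B}" by auto
    then show ?thesis unfolding F_def using that by (simp add: prob_meanD(3)[OF \<mu>(1)] disjoint_iff)
  qed
  have F_carrier: "F (carrier K) q = 1" if "q \<in> ?X" for q
  proof -
    have "{x \<in> ?N. \<kappa> q \<otimes>\<^bsub>K\<^esub> x \<in> carrier K} = ?N" using \<kappa>(1)[OF that] subgroup.subset[OF N] by auto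
    then show ?thesis using prob_meanD(2)[OF \<mu>(1)] by (simp add: F_def)
  qed
  \<comment> \<open>\<open>g\<close> carries the coset through \<open>\<kappa> q\<close> to the one
    through \<open>\<kappa> (\<pi> g q)\<close>. The two base points differ by the element
    \<open>n\<close> of the kernel, under which \<open>\<mu>\<close> is invariant.\<close>
  have F_shift: "F (g <#\<^bsub>K\<^esub> A) (\<pi> g \<otimes>\<^bsub>Q\<^esub> q) = F A q" if g: "g \<in> carrier K" and A: "A \<subseteq> carrier K" and q: "q \<in> ?X" for g A q
  proof -
    let ?k = "\<kappa> q" and ?k' = "\<kappa> (\<pi> g \<otimes>\<^bsub>Q\<^esub> q)"
    have k: "?k \<in> carrier K" "?k' \<in> carrier K" using \<kappa>(1) q g by auto
    define n where "n = inv\<^bsub>K\<^esub> ?k' \<otimes>\<^bsub>K\<^esub> (g \<otimes>\<^bsub>K\<^esub> ?k)"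
    have n: "n \<in> ?N" using k g q \<kappa>(2)[OF g q] by (simp add: n_def kernel_def)
    then have nK: "n \<in> carrier K" using subgroup.subset[OF N] by auto
    have kn: "?k' \<otimes>\<^bsub>K\<^esub> n = g \<otimes>\<^bsub>K\<^esub> ?k" using k g by (simp add: n_def G.m_assoc[symmetric])
    have "{x \<in> ?N. ?k' \<otimes>\<^bsub>K\<^esub> x \<in> g <#\<^bsub>K\<^esub> A} = n <#\<^bsub>K\<lparr>carrier := ?N\<rparr>\<^esub> {x \<in> ?N. ?k \<otimes>\<^bsub>K\<^esub> x \<in> A}"
    proof (intro equalityI subsetI)
      fix x assume "x \<in> {x \<in> ?N. ?k' \<otimes>\<^bsub>K\<^esub> x \<in> g <#\<^bsub>K\<^esub> A}"
      then obtain a where x: "x \<in> ?N" "a \<in> A" "?k' \<otimes>\<^bsub>K\<^esub> x = g \<otimes>\<^bsub>K\<^esub> a" by (auto simp: l_coset_image)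
      have c: "x \<in> carrier K" "a \<in> carrier K" using x A subgroup.subset[OF N] by auto
      let ?y = "inv\<^bsub>K\<^esub> n \<otimes>\<^bsub>K\<^esub> x"
      have y: "?y \<in> ?N" using n x(1) N by (simp add: subgroup.m_closed subgroup.m_inv_closed)
      have xy: "x = n \<otimes>\<^bsub>K\<^esub> ?y" using nK c by (simp add: G.m_assoc[symmetric])
      have "g \<otimes>\<^bsub>K\<^esub> a = g \<otimes>\<^bsub>K\<^esub> (?k \<otimes>\<^bsub>K\<^esub> ?y)"
      proof -
        have "g \<otimes>\<^bsub>K\<^esub> a = ?k' \<otimes>\<^bsub>K\<^esub> (n \<otimes>\<^bsub>K\<^esub> ?y)" using x(3) xy by simp
        also have "\<dots> = (?k' \<otimes>\<^bsub>K\<^esub> n) \<otimes>\<^bsub>K\<^esub> ?y" using k nK c by (simp add: G.m_assoc)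
        also have "\<dots> = g \<otimes>\<^bsub>K\<^esub> (?k \<otimes>\<^bsub>K\<^esub> ?y)" unfolding kn using k g nK c by (simp add: G.m_assoc)
        finally show ?thesis .
      qed
      then have "a = ?k \<otimes>\<^bsub>K\<^esub> ?y" using g c k nK by simp
      then have "?y \<in> {x \<in> ?N. ?k \<otimes>\<^bsub>K\<^esub> x \<in> A}" using y x(2) by simp
      then show "x \<in> n <#\<^bsub>K\<lparr>carrier := ?N\<rparr>\<^esub> {x \<in> ?N. ?k \<otimes>\<^bsub>K\<^esub> x \<in> A}"
        unfolding l_coset_image using xy by (intro image_eqI[of _ _ ?y]) simp
    next
      fix x assume "x \<in> n <#\<^bsub>K\<lparr>carrier := ?N\<rparr>\<^esub> {x \<in> ?N. ?k \<otimes>\<^bsub>K\<^esub> x \<in> A}"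
      then obtain y where y: "y \<in> ?N" "?k \<otimes>\<^bsub>K\<^esub> y \<in> A" "x = n \<otimes>\<^bsub>K\<^esub> y" by (auto simp: l_coset_image)
      have c: "y \<in> carrier K" using y subgroup.subset[OF N] by auto
      have "?k' \<otimes>\<^bsub>K\<^esub> x = (?k' \<otimes>\<^bsub>K\<^esub> n) \<otimes>\<^bsub>K\<^esub> y" using k nK c by (simp add: y(3) G.m_assoc)
      also have "\<dots> = g \<otimes>\<^bsub>K\<^esub> (?k \<otimes>\<^bsub>K\<^esub> y)" unfolding kn using k g c by (simp add: G.m_assoc)
      finally show "x \<in> {x \<in> ?N. ?k' \<otimes>\<^bsub>K\<^esub> x \<in> g <#\<^bsub>K\<^esub> A}"
        using y n N by (auto simp: l_coset_image subgroup.m_closed)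
    qed
    then have "F (g <#\<^bsub>K\<^esub> A) (\<pi> g \<otimes>\<^bsub>Q\<^esub> q) = \<mu> (n <#\<^bsub>K\<lparr>carrier := ?N\<rparr>\<^esub> {x \<in> ?N. ?k \<otimes>\<^bsub>K\<^esub> x \<in> A})"
      by (simp add: F_def)
    also have "\<dots> = F A q" using \<mu>(2) n by (simp add: l_invariant_def F_def)
    finally show ?thesis .
  qed
  fix S and \<epsilon> :: real assume S: "S \<subseteq> carrier K" and \<epsilon>: "\<epsilon> > 0"
  obtain n :: nat where n: "n > 0" "1 / real n < \<epsilon>"
    using reals_Archimedean[OF \<epsilon>] by (metis inverse_eq_divide zero_less_Suc)
  define R where "R A q = real_of_int \<lfloor>real n * F A q\<rfloor> / real n" for A q
  have fin: "finite (R A ` ?X)" for A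
  proof (rule finite_subset)
    show "R A ` ?X \<subseteq> (\<lambda>j. real_of_int j / real n) ` {0..int n}"
    proof
      fix v assume "v \<in> R A ` ?X"
      then obtain q where v: "v = R A q" by auto
      have "0 \<le> real n * F A q" "real n * F A q \<le> real n" using F01[of A q] by (simp_all add: mult_left_le)
      then have "\<lfloor>real n * F A q\<rfloor> \<in> {0..int n}" by (simp add: floor_le_iff)
      then show "v \<in> (\<lambda>j. real_of_int j / real n) ` {0..int n}" unfolding v R_def by (rule imageI)
    qed
  qed simp
  have ne: "?X \<noteq> {}" by auto
  have fin_const: "finite ((\<lambda>_. c) ` ?X)" for c :: real by (simp add: image_constant_conv)
  let ?m = "\<lambda>A. mean_int ?X \<nu> (R A)"
  have R01: "0 \<le> R A q" "R A q \<le> 1" for A q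
  proof -
    have "0 \<le> real n * F A q" "real n * F A q \<le> real n" using F01[of A q] by (simp_all add: mult_left_le)
    then have "0 \<le> \<lfloor>real n * F A q\<rfloor>" "real_of_int \<lfloor>real n * F A q\<rfloor> \<le> real n" by linarith+
    then show "0 \<le> R A q" "R A q \<le> 1" using n(1) by (simp_all add: R_def)
  qed
  have "0 \<le> ?m A \<and> ?m A \<le> 1" for A
    using mean_int_mono[OF \<nu>(1) fin_const fin, of 0 A] mean_int_mono[OF \<nu>(1) fin fin_const, of A 1] R01
      mean_int_const[OF \<nu>(1) ne] by simp
  moreover have "?m (carrier K) = 1"
  proof -
    have "?m (carrier K) = mean_int ?X \<nu> (\<lambda>_. 1)"
      using n(1) F_carrier by (intro order.antisym mean_int_mono[OF \<nu>(1)] fin fin_const) (simp_all add: R_def)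
    then show ?thesis using mean_int_const[OF \<nu>(1) ne] by simp
  qed
  moreover have "\<bar>?m (A \<union> B) - ?m A - ?m B\<bar> \<le> \<epsilon>" if "A \<inter> B = {}" for A B
  proof -
    \<comment> \<open>The floor of a sum exceeds the sum of the floors by 0 or 1.\<close>
    have pt: "R A q + R B q \<le> R (A \<union> B) q \<and> R (A \<union> B) q \<le> R A q + R B q + 1 / real n" for q
    proof -
      have "real n * F (A \<union> B) q = real n * F A q + real n * F B q"
        using F_add[OF that] by (simp add: distrib_left)
      then have "\<lfloor>real n * F A q\<rfloor> + \<lfloor>real n * F B q\<rfloor> \<le> \<lfloor>real n * F (A \<union> B) q\<rfloor>"
        "\<lfloor>real n * F (A \<union> B) q\<rfloor> \<le> \<lfloor>real n * F A q\<rfloor> + \<lfloor>real n * F B q\<rfloor> + 1" by linarith+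
      then have "real_of_int \<lfloor>real n * F A q\<rfloor> + real_of_int \<lfloor>real n * F B q\<rfloor> \<le> real_of_int \<lfloor>real n * F (A \<union> B) q\<rfloor>"
        "real_of_int \<lfloor>real n * F (A \<union> B) q\<rfloor> \<le> real_of_int \<lfloor>real n * F A q\<rfloor> + real_of_int \<lfloor>real n * F B q\<rfloor> + 1" by linarith+
      then show ?thesis using n(1) by (simp add: R_def divide_right_mono flip: add_divide_distrib)
    qed
    have fin2: "finite ((\<lambda>q. R A q + R B q) ` ?X)"
    proof (rule finite_subset)
      show "(\<lambda>q. R A q + R B q) ` ?X \<subseteq> (\<lambda>(u, v). u + v) ` (R A ` ?X \<times> R B ` ?X)" by auto
    qed (use fin in auto)
    have fin3: "finite ((\<lambda>q. R A q + R B q + 1 / real n) ` ?X)"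
      using finite_imageI[OF fin2, of "\<lambda>u. u + 1 / real n"] by (simp add: image_image)
    have "?m A + ?m B \<le> ?m (A \<union> B)"
      using mean_int_mono[OF \<nu>(1) fin2 fin, of "A \<union> B"] pt mean_int_add[OF \<nu>(1) fin fin, of A B] by simp
    moreover have "?m (A \<union> B) \<le> ?m A + ?m B + 1 / real n"
      using mean_int_mono[OF \<nu>(1) fin fin3, of "A \<union> B"] pt mean_int_add[OF \<nu>(1) fin fin, of A B]
        mean_int_add[OF \<nu>(1) fin2 fin_const, of "1 / real n"] mean_int_const[OF \<nu>(1) ne, of "1 / real n"] by simp
    ultimately show ?thesis using n(2) by linarith
  qed
  moreover have "?m (g <#\<^bsub>K\<^esub> A) = ?m A" if "g \<in> S" "A \<subseteq> carrier K" for g A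
  proof -
    have g: "g \<in> carrier K" using that S by auto
    show ?thesis
      using g that F_shift by (intro mean_int_shift[OF Q \<nu>(2), of "\<pi> g"]) (simp_all add: R_def)
  qed
  ultimately show "\<exists>m. (\<forall>A\<subseteq>carrier K. 0 \<le> m A \<and> m A \<le> (1::real)) \<and> m (carrier K) = 1 \<and>
      (\<forall>A\<subseteq>carrier K. \<forall>B\<subseteq>carrier K. A \<inter> B = {} \<longrightarrow> \<bar>m (A \<union> B) - m A - m B\<bar> \<le> \<epsilon>) \<and>
      (\<forall>g\<in>S. \<forall>A\<subseteq>carrier K. \<bar>m (g <#\<^bsub>K\<^esub> A) - m A\<bar> \<le> \<epsilon>)"
    using \<epsilon> by (intro exI[of _ ?m]) simp
qed

section \<open>Highly transitive representations and mixed identities\<close>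

lemma word_cong_step:
  "(u, v) \<in> R \<Longrightarrow> u \<in> lists A \<Longrightarrow> v \<in> lists A \<Longrightarrow> q \<in> lists A \<Longrightarrow> word_cong A R (u @ q) (v @ q)"
  using word_cong.rel[of u v R "[]" A q] by simp

lemma word_cong_Cons: "word_cong A R u v \<Longrightarrow> a \<in> A \<Longrightarrow> word_cong A R (a # u) (a # v)"
  using word_cong_append_left[of A R u v "[a]"] by simp

text \<open>\<open>tuples\<close> allows any length and is thus high transitivity;
  \<open>infinite_support\<close> includes faithfulness, see \<open>inj_rep\<close>.\<close>

locale highly_transitive_rep = group G for G :: "('a, 'm) monoid_scheme" (structure) +
  fixes \<psi> :: "'a \<Rightarrow> 'w \<Rightarrow> 'w"
  assumes bij_rep: "x \<in> carrier G \<Longrightarrow> bij (\<psi> x)"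
    and rep_mult: "x \<in> carrier G \<Longrightarrow> y \<in> carrier G \<Longrightarrow> \<psi> (x \<otimes> y) = \<psi> x \<circ> \<psi> y"
    and infinite_support: "x \<in> carrier G \<Longrightarrow> x \<noteq> \<one> \<Longrightarrow> infinite {w. \<psi> x w \<noteq> w}"
    and tuples: "length xs = length ys \<Longrightarrow> distinct xs \<Longrightarrow> distinct ys \<Longrightarrow> \<exists>x\<in>carrier G. map (\<psi> x) xs = ys"
    and infinite_space: "infinite (UNIV :: 'w set)"
begin

lemma rep_one: "\<psi> \<one> = id"
proof
  fix w
  have "\<psi> \<one> (\<psi> \<one> w) = \<psi> \<one> w" using rep_mult[of \<one> \<one>] by (metis comp_apply l_one one_closed)
  then show "\<psi> \<one> w = id w" using bij_is_inj[OF bij_rep[OF one_closed]] by (simp add: inj_eq)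
qed

lemma rep_inv: "x \<in> carrier G \<Longrightarrow> \<psi> (inv x) = inv_into UNIV (\<psi> x)"
  using rep_mult[of x "inv x"] rep_mult[of "inv x" x] by (intro inv_unique_comp[symmetric]) (simp_all add: rep_one)

lemma inj_rep: "inj_on \<psi> (carrier G)"
proof (rule inj_onI)
  fix x y assume xy: "x \<in> carrier G" "y \<in> carrier G" "\<psi> x = \<psi> y"
  then have "\<psi> (x \<otimes> inv y) = id"
    by (simp add: rep_mult rep_inv bij_rep bij_is_surj flip: surj_iff)
  then have "finite {w. \<psi> (x \<otimes> inv y) w \<noteq> w}" by simp
  then have "x \<otimes> inv y = \<one>" using infinite_support[of "x \<otimes> inv y"] xy by auto
  then show "x = y" using xy by (metis inv_closed inv_inv inv_equality)
qed

lemma infinite_carrier: "infinite (carrier G)"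
proof
  assume fin: "finite (carrier G)"
  obtain w0 :: 'w where True by blast
  have "(UNIV :: 'w set) \<subseteq> (\<lambda>x. \<psi> x w0) ` carrier G"
  proof
    fix w :: 'w
    obtain x where "x \<in> carrier G" "map (\<psi> x) [w0] = [w]" using tuples[of "[w0]" "[w]"] by auto
    then show "w \<in> (\<lambda>x. \<psi> x w0) ` carrier G" by auto
  qed
  from finite_subset[OF this finite_imageI[OF fin]] show False using infinite_space by simp
qed

text \<open>\<open>highly_transitive\<close> wants the set acted on to have its points in the type
  of the group elements; the bijection \<open>b\<close> serves to get there.\<close>

lemma highly_transitive_action:
  fixes b :: "'w \<Rightarrow> 'v"
  assumes b: "bij b"
  shows "highly_transitive_action G UNIV (\<lambda>x. b \<circ> \<psi> x \<circ> inv_into UNIV b)"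
proof -
  let ?\<phi> = "\<lambda>x. b \<circ> \<psi> x \<circ> inv_into UNIV b"
  have bb: "inv_into UNIV b (b w) = w" "b (inv_into UNIV b v) = v" for w v
    using b by (simp_all add: bij_is_inj bij_is_surj surj_f_inv_f)
  have Bij: "?\<phi> x \<in> Bij UNIV" if "x \<in> carrier G" for x
    using bij_rep[OF that] b by (simp add: Bij_def bij_comp bij_imp_bij_inv)
  have "?\<phi> \<in> hom G (BijGroup UNIV)"
    using Bij by (auto simp: hom_def BijGroup_def rep_mult compose_def bb fun_eq_iff)
  then have ga: "group_action G UNIV ?\<phi>"
    unfolding group_action_def group_hom_def group_hom_axioms_def using group_BijGroup is_group by blast
  have "inj_on ?\<phi> (carrier G)"
  proof (rule inj_onI)
    fix x y assume xy: "x \<in> carrier G" "y \<in> carrier G" "?\<phi> x = ?\<phi> y"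
    have "\<psi> x w = \<psi> y w" for w
      using fun_cong[OF xy(3), of "b w"] b by (simp add: bb bij_is_inj inj_eq)
    then show "x = y" using inj_rep xy by (meson ext inj_onD)
  qed
  then have "faithful_action G UNIV ?\<phi>"
    using ga by (simp add: faithful_action_def faithful_action_axioms_def)
  moreover have "k_transitive k G UNIV ?\<phi>" for k
    unfolding k_transitive_def
  proof (intro conjI allI impI)
    have "finite (UNIV :: 'v set) \<Longrightarrow> finite (UNIV :: 'w set)"
      using bij_betw_finite[of b UNIV UNIV] b by simp
    then show "infinite (UNIV :: 'v set) \<or> k \<le> card (UNIV :: 'v set)" using infinite_space by blast
    fix xs ys :: "'v list"
    let ?c = "inv_into UNIV b"
    assume *: "length xs = k" "length ys = k" "distinct xs" "distinct ys"
    have inj: "inj ?c" using b by (simp add: bij_imp_bij_inv bij_is_inj)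
    obtain x where x: "x \<in> carrier G" "map (\<psi> x) (map ?c xs) = map ?c ys"
      using tuples[of "map ?c xs" "map ?c ys"] * inj_on_subset[OF inj subset_UNIV] by (auto simp: distinct_map)
    have "?\<phi> x (xs ! i) = ys ! i" if "i < k" for i
    proof -
      have "\<psi> x (?c (xs ! i)) = ?c (ys ! i)" using arg_cong[OF x(2), of "\<lambda>zs. zs ! i"] that * by simp
      then show ?thesis by (simp add: bb)
    qed
    then show "\<exists>g\<in>carrier G. \<forall>i<k. ?\<phi> g (xs ! i) = ys ! i" using x(1) by blast
  qed (rule ga)
  ultimately show ?thesis by (simp add: highly_transitive_action_def)
qed

section \<open>Words in the free product with the integers\<close>

abbreviation FA :: "('a + int) set" where "FA \<equiv> carrier G <+> UNIV"

abbreviation FR where "FR \<equiv> free_product_rels G integer_group"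

lemma free_product_integer:
  "free_product G integer_group = presented FA FR" "free_product_inl G integer_group g = word_class FA FR [Inl g]"
  by (simp_all add: free_product_def free_product_inl_def)

declare word_cong.trans [trans]

definition letter :: "'a \<Rightarrow> 'a + int \<Rightarrow> 'a" where
  "letter x l = (case l of Inl g \<Rightarrow> g | Inr n \<Rightarrow> x [^] n)"

definition subst :: "'a \<Rightarrow> ('a + int) list \<Rightarrow> 'a" where
  "subst x w = foldr (\<lambda>l a. letter x l \<otimes> a) w \<one>"

lemma subst_simps [simp]: "subst x [] = \<one>" "subst x (l # w) = letter x l \<otimes> subst x w"
  by (simp_all add: subst_def)

lemma letter_closed: "x \<in> carrier G \<Longrightarrow> l \<in> FA \<Longrightarrow> letter x l \<in> carrier G"
  by (auto simp: letter_def)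

lemma subst_closed: "x \<in> carrier G \<Longrightarrow> w \<in> lists FA \<Longrightarrow> subst x w \<in> carrier G"
  by (induction w) (simp_all add: letter_closed)

lemma subst_append:
  "x \<in> carrier G \<Longrightarrow> u \<in> lists FA \<Longrightarrow> v \<in> lists FA \<Longrightarrow> subst x (u @ v) = subst x u \<otimes> subst x v"
proof (induction u)
  case (Cons l u)
  then show ?case using subst_closed[of x u] subst_closed[of x v] letter_closed[of x l] by (simp add: m_assoc)
qed (simp add: subst_closed)

lemma subst_cong:
  assumes x: "x \<in> carrier G"
  shows "word_cong FA FR u v \<Longrightarrow> subst x u = subst x v"
proof (induction rule: word_cong.induct)
  case (rel u v p q)
  have "subst x u = subst x v"
    using rel(1) x by (auto simp: free_product_rels_def letter_def int_pow_mult m_assoc)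
  then show ?case using rel x by (simp add: subst_append)
qed auto

lemma eval_hom:
  assumes x: "x \<in> carrier G"
  shows "\<exists>\<phi>\<in>hom (free_product G integer_group) G.
    (\<forall>g\<in>carrier G. \<phi> (free_product_inl G integer_group g) = g) \<and>
    (\<forall>w\<in>lists FA. \<phi> (word_class FA FR w) = subst x w)"
proof -
  define \<phi> where "\<phi> P = subst x (SOME w. w \<in> P)" for P
  have \<phi>: "\<phi> (word_class FA FR w) = subst x w" if "w \<in> lists FA" for w
  proof -
    have "w \<in> word_class FA FR w" using that by (simp add: word_class_def word_cong.refl)
    then have "(SOME v. v \<in> word_class FA FR w) \<in> word_class FA FR w" by (rule someI)
    then show ?thesis unfolding \<phi>_def using subst_cong[OF x] by (simp add: word_class_def)
  qed
  have "\<phi> \<in> hom (free_product G integer_group) G"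
  proof (rule homI)
    fix P assume "P \<in> carrier (free_product G integer_group)"
    then obtain u where u: "u \<in> lists FA" "P = word_class FA FR u" by (auto simp: free_product_integer presented_def)
    then show "\<phi> P \<in> carrier G" using \<phi> subst_closed x by simp
    fix Q assume "Q \<in> carrier (free_product G integer_group)"
    then obtain v where v: "v \<in> lists FA" "Q = word_class FA FR v" by (auto simp: free_product_integer presented_def)
    have "P \<otimes>\<^bsub>free_product G integer_group\<^esub> Q = word_class FA FR (u @ v)"
      using u v by (simp add: free_product_integer mult_presented)
    then show "\<phi> (P \<otimes>\<^bsub>free_product G integer_group\<^esub> Q) = \<phi> P \<otimes> \<phi> Q"
      using u v x by (simp add: \<phi> subst_append)
  qed
  moreover have "\<phi> (free_product_inl G integer_group g) = g" if "g \<in> carrier G" for g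
    using that \<phi>[of "[Inl g]"] by (auto simp: free_product_integer letter_def)
  ultimately show ?thesis using \<phi> by blast
qed

abbreviation unit_letter :: "bool \<Rightarrow> 'a + int" where "unit_letter s \<equiv> Inr (if s then 1 else -1)"

text \<open>Powers of the variable are spelled out with exponents 1 and -1, separated by group
  elements. Each step along a path then uses a single value of the variable or of its
  inverse.\<close>

definition enc :: "'a \<Rightarrow> (bool \<times> 'a) list \<Rightarrow> ('a + int) list" where
  "enc g l = Inl g # concat (map (\<lambda>(s, h). [unit_letter s, Inl h]) l)"

lemma enc_Cons: "enc g ((s, h) # l) = Inl g # unit_letter s # enc h l"
  by (simp add: enc_def)

lemma enc_Nil: "enc g [] = [Inl g]"
  by (simp add: enc_def)

text \<open>A trivial group element may separate equal exponents, as it must inside a power; only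
  opposite exponents around it would cancel.\<close>

primrec reduced_enc :: "(bool \<times> 'a) list \<Rightarrow> bool" where
  "reduced_enc [] \<longleftrightarrow> True"
| "reduced_enc (a # l) \<longleftrightarrow> reduced_enc l \<and> (l \<noteq> [] \<longrightarrow> snd a = \<one> \<longrightarrow> fst a = fst (hd l))"

lemma reduced_enc_Cons:
  "reduced_enc ((s, g) # l) \<longleftrightarrow> reduced_enc l \<and> (\<forall>t h k. l = (t, h) # k \<longrightarrow> g = \<one> \<longrightarrow> s = t)"
  by (cases l) (simp, force)

declare reduced_enc.simps(2) [simp del]

definition normal :: "'a \<Rightarrow> (bool \<times> 'a) list \<Rightarrow> bool" where
  "normal g l \<longleftrightarrow> g \<in> carrier G \<and> snd ` set l \<subseteq> carrier G \<and> reduced_enc l"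

lemma enc_lists: "g \<in> carrier G \<Longrightarrow> snd ` set l \<subseteq> carrier G \<Longrightarrow> enc g l \<in> lists FA"
  by (induction l arbitrary: g) (auto simp: enc_def)

lemma normal_lists: "normal g l \<Longrightarrow> enc g l \<in> lists FA"
  by (rule enc_lists; simp only: normal_def)

lemma rels: "g \<in> carrier G \<Longrightarrow> h \<in> carrier G \<Longrightarrow> ([Inl g, Inl h], [Inl (g \<otimes> h)]) \<in> FR"
  "([Inr m, Inr n], [Inr (m + n)]) \<in> FR" "([Inl \<one>], []) \<in> FR" "([Inr 0], []) \<in> FR"
  by (auto simp: free_product_rels_def)

lemma cong_rels:
  assumes "q \<in> lists FA"
  shows "g \<in> carrier G \<Longrightarrow> h \<in> carrier G \<Longrightarrow> word_cong FA FR (Inl g # Inl h # q) (Inl (g \<otimes> h) # q)"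
    "word_cong FA FR (Inr m # Inr n # q) (Inr (m + n) # q)"
    "word_cong FA FR (Inl \<one> # q) q" "word_cong FA FR (Inr 0 # q) q"
  using word_cong_step[OF rels(1), of g h FA q] word_cong_step[OF rels(2), of m n FA q]
    word_cong_step[OF rels(3), of FA q] word_cong_step[OF rels(4), of FA q] assms by auto

lemma normal_unit:
  assumes n: "normal g l"
  shows "\<exists>g' l'. normal g' l' \<and> word_cong FA FR (unit_letter s # enc g l) (enc g' l')"
\<comment> \<open>The new letter either cancels against the first one or is put in front with a
  trivial group element before it.\<close>
proof (cases "\<exists>h k. l = (\<not> s, h) # k \<and> g = \<one>")
  case True
  then obtain h k where l: "l = (\<not> s, h) # k" "g = \<one>" by blast
  then have nh: "normal h k" using n by (auto simp: normal_def reduced_enc_Cons)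
  have e: "enc h k \<in> lists FA" by (rule normal_lists[OF nh])
  have "word_cong FA FR (Inl \<one> # unit_letter (\<not> s) # enc h k) (unit_letter (\<not> s) # enc h k)"
    using e by (intro cong_rels(3)) auto
  then have "word_cong FA FR (unit_letter s # enc g l) (unit_letter s # unit_letter (\<not> s) # enc h k)"
    unfolding l enc_Cons by (intro word_cong_Cons) auto
  also have "word_cong FA FR \<dots> (Inr 0 # enc h k)"
    using cong_rels(2)[OF e, of "if s then 1 else -1" "if \<not> s then 1 else -1"] by (simp split: if_splits)
  also have "word_cong FA FR \<dots> (enc h k)" by (rule cong_rels(4)[OF e])
  finally show ?thesis using nh by blast
next
  case False
  have e: "enc g l \<in> lists FA" by (rule normal_lists[OF n])
  have "s = t" if "l = (t, h) # k" "g = \<one>" for t h k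
    using False that by (cases s; cases t) auto
  then have "normal \<one> ((s, g) # l)" using n by (auto simp: normal_def reduced_enc_Cons)
  moreover have "word_cong FA FR (unit_letter s # enc g l) (enc \<one> ((s, g) # l))"
    unfolding enc_Cons using e by (intro word_cong.sym[OF cong_rels(3)]) auto
  ultimately show ?thesis by blast
qed

lemma normal_power:
  "normal g l \<Longrightarrow> \<exists>g' l'. normal g' l' \<and> word_cong FA FR (Inr n # enc g l) (enc g' l')"
proof (induction n arbitrary: g l rule: int_induct[where k = 0])
  case base
  then show ?case using cong_rels(4)[OF normal_lists] by blast
next
  case (step1 i)
  obtain g1 l1 where 1: "normal g1 l1" "word_cong FA FR (Inr i # enc g l) (enc g1 l1)" using step1 by blast
  obtain g2 l2 where 2: "normal g2 l2" "word_cong FA FR (unit_letter True # enc g1 l1) (enc g2 l2)"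
    using normal_unit[OF 1(1)] by blast
  have "word_cong FA FR (Inr (i + 1) # enc g l) (Inr 1 # Inr i # enc g l)"
    using word_cong.sym[OF cong_rels(2)[OF normal_lists[OF step1.prems], of 1 i]] by (simp add: add.commute)
  also have "word_cong FA FR \<dots> (Inr 1 # enc g1 l1)" using 1(2) by (intro word_cong_Cons) auto
  finally have "word_cong FA FR (Inr (i + 1) # enc g l) (enc g2 l2)"
    using 2(2) word_cong.trans by fastforce
  then show ?case using 2(1) by blast
next
  case (step2 i)
  obtain g1 l1 where 1: "normal g1 l1" "word_cong FA FR (Inr i # enc g l) (enc g1 l1)" using step2 by blast
  obtain g2 l2 where 2: "normal g2 l2" "word_cong FA FR (unit_letter False # enc g1 l1) (enc g2 l2)"
    using normal_unit[OF 1(1)] by blast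
  have "word_cong FA FR (Inr (i - 1) # enc g l) (Inr (-1) # Inr i # enc g l)"
    using word_cong.sym[OF cong_rels(2)[OF normal_lists[OF step2.prems], of "-1" i]] by simp
  also have "word_cong FA FR \<dots> (Inr (-1) # enc g1 l1)" using 1(2) by (intro word_cong_Cons) auto
  finally have "word_cong FA FR (Inr (i - 1) # enc g l) (enc g2 l2)"
    using 2(2) word_cong.trans by fastforce
  then show ?case using 2(1) by blast
qed

lemma normal_form: "w \<in> lists FA \<Longrightarrow> \<exists>g l. normal g l \<and> word_cong FA FR w (enc g l)"
proof (induction w)
  case Nil
  have "word_cong FA FR [] (enc \<one> [])" unfolding enc_Nil using word_cong.sym[OF cong_rels(3)[of "[]"]] by simp
  then show ?case by (intro exI[of _ \<one>] exI[of _ "[]"]) (simp add: normal_def)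
next
  case (Cons a w)
  then obtain g l where n: "normal g l" and c: "word_cong FA FR w (enc g l)" by auto
  have c': "word_cong FA FR (a # w) (a # enc g l)" using c Cons.prems by (intro word_cong_Cons) auto
  show ?case
  proof (cases a)
    case (Inl h)
    then have h: "h \<in> carrier G" using Cons.prems by auto
    have g: "g \<in> carrier G" "snd ` set l \<subseteq> carrier G" using n by (auto simp: normal_def)
    define q where "q = concat (map (\<lambda>(s, h). [unit_letter s, Inl h]) l)"
    have e: "enc g' l = Inl g' # q" for g' by (simp add: enc_def q_def)
    have "q \<in> lists FA" using enc_lists[OF g] by (simp add: e)
    then have "word_cong FA FR (a # enc g l) (enc (h \<otimes> g) l)"
      unfolding e Inl using cong_rels(1) h g by blast
    moreover have "normal (h \<otimes> g) l" using n h by (simp add: normal_def)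
    ultimately show ?thesis using word_cong.trans[OF c'] by blast
  next
    case (Inr m)
    then show ?thesis using normal_power[OF n, of m] word_cong.trans[OF c'] by blast
  qed
qed

text \<open>\<open>X\<close> is an arbitrary map and need not come from the group: the path is laid
  out first, and a group element with the required values is found afterwards.\<close>

fun path :: "('w \<Rightarrow> 'w) \<Rightarrow> 'a \<Rightarrow> (bool \<times> 'a) list \<Rightarrow> 'w \<Rightarrow> 'w" where
  "path X g [] p = \<psi> g p"
| "path X g ((s, h) # l) p = \<psi> g ((if s then X else inv_into UNIV X) (path X h l p))"

lemma path_subst:
  assumes "x \<in> carrier G"
  shows "g \<in> carrier G \<Longrightarrow> snd ` set l \<subseteq> carrier G \<Longrightarrow> \<psi> (subst x (enc g l)) p = path (\<psi> x) g l p"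
proof (induction l arbitrary: g)
  case Nil
  then show ?case by (simp add: enc_Nil letter_def)
next
  case (Cons a l)
  obtain s h where a: "a = (s, h)" by force
  have h: "h \<in> carrier G" "snd ` set l \<subseteq> carrier G" using Cons.prems a by auto
  have S: "subst x (enc h l) \<in> carrier G" using subst_closed[OF assms enc_lists[OF h]] .
  have "\<psi> (letter x (unit_letter s)) = (if s then \<psi> x else inv_into UNIV (\<psi> x))"
    using assms by (simp add: letter_def int_pow_neg rep_inv)
  moreover have "letter x (unit_letter s) \<in> carrier G" by (rule letter_closed[OF assms InrI[OF UNIV_I]])
  ultimately show ?case
    using Cons.IH[OF h] Cons.prems S by (simp add: a enc_Cons letter_def[of x "Inl g"] rep_mult)
qed

text \<open>The images of the letters \<open>x\<close> and \<open>x\<^sup>-\<^sup>1\<close> along the path of a point can be chosen freely as long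
  as the path only visits new points; elements of infinite support leave room for this.\<close>

lemma path_exists:
  assumes "normal g l"
  shows "\<exists>p D r. finite D \<and> inj_on fst D \<and> inj_on snd D \<and>
    (\<forall>X. bij X \<longrightarrow> (\<forall>(a, b)\<in>D. X a = b) \<longrightarrow> path X g l p = r) \<and>
    (g \<noteq> \<one> \<or> l = [] \<longrightarrow> r \<notin> fst ` D \<union> snd ` D) \<and>
    (\<forall>s h k. l = (s, h) # k \<longrightarrow> g = \<one> \<longrightarrow> r \<notin> (if s then fst ` D else snd ` D)) \<and>
    (l \<noteq> [] \<longrightarrow> r \<noteq> p)"
  using assms
proof (induction l arbitrary: g)
  case Nil
  show ?case by (intro exI[of _ undefined] exI[of _ "{}"] exI[of _ "\<psi> g undefined"]) simp
next
  case (Cons a l)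
  obtain s h where a: "a = (s, h)" by force
  have g: "g \<in> carrier G" and nh: "normal h l"
    using Cons.prems a by (auto simp: normal_def reduced_enc_Cons)
  obtain p D r where IH: "finite D" "inj_on fst D" "inj_on snd D"
    "\<And>X. bij X \<Longrightarrow> \<forall>(a, b)\<in>D. X a = b \<Longrightarrow> path X h l p = r"
    "h \<noteq> \<one> \<or> l = [] \<Longrightarrow> r \<notin> fst ` D \<union> snd ` D"
    "\<And>t h' k. l = (t, h') # k \<Longrightarrow> h = \<one> \<Longrightarrow> r \<notin> (if t then fst ` D else snd ` D)"
    using Cons.IH[OF nh] by metis
  \<comment> \<open>The value to be prescribed at \<open>r\<close> must still be free. Either
    \<open>r\<close> is a new point, or \<open>h\<close> is trivial, and then reducedness gives the
    next letter the sign of the previous one, in whose direction \<open>r\<close> is free.\<close>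
  have r: "r \<notin> (if s then fst ` D else snd ` D)"
  proof (cases "h \<noteq> \<one> \<or> l = []")
    case True
    then show ?thesis using IH(5) by auto
  next
    case False
    then obtain t h' k where l: "l = (t, h') # k" "h = \<one>" by (cases l) auto
    have "reduced_enc ((s, h) # l)" using Cons.prems a by (simp add: normal_def)
    then have "s = t" using l unfolding reduced_enc_Cons by blast
    then show ?thesis using IH(6)[OF l] by simp
  qed
  \<comment> \<open>The target \<open>q\<close> and the point \<open>\<psi> g q\<close> reached from
    it must both be new. For nontrivial \<open>g\<close> they must also differ, so that the new end
    point is free in both directions; the infinite support of \<open>g\<close> makes this
    possible.\<close>
  define F where "F = fst ` D \<union> snd ` D \<union> {r, p}"
  have F: "finite F" using IH(1) by (simp add: F_def)
  have "finite (\<psi> g -` F)" using F bij_is_inj[OF bij_rep[OF g]] by (rule finite_vimageI)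
  moreover have "infinite {w. g \<noteq> \<one> \<longrightarrow> \<psi> g w \<noteq> w}"
    using infinite_support[OF g] infinite_space by (cases "g = \<one>") simp_all
  ultimately have "infinite ({w. g \<noteq> \<one> \<longrightarrow> \<psi> g w \<noteq> w} - (F \<union> \<psi> g -` F))"
    using F by (intro Diff_infinite_finite) auto
  then obtain q where "q \<in> {w. g \<noteq> \<one> \<longrightarrow> \<psi> g w \<noteq> w} - (F \<union> \<psi> g -` F)"
    using infinite_imp_nonempty by blast
  then have q: "g \<noteq> \<one> \<Longrightarrow> \<psi> g q \<noteq> q" "q \<notin> F" "\<psi> g q \<notin> F" by auto
  let ?D = "insert (if s then (r, q) else (q, r)) D"
  have i: "inj_on fst ?D" "inj_on snd ?D"
  proof -
    have "(r, q) \<notin> D" "(q, r) \<notin> D" using q(2) by (force simp: F_def)+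
    then show "inj_on fst ?D" "inj_on snd ?D"
      using IH(2,3) r q(2) by (cases s; simp add: inj_on_insert F_def)+
  qed
  have 4: "path X g (a # l) p = \<psi> g q" if X: "bij X" "\<forall>(a, b)\<in>?D. X a = b" for X
  proof -
    have "path X h l p = r" using IH(4)[OF X(1)] X(2) by auto
    moreover have "(if s then X else inv_into UNIV X) r = q"
      using X by (cases s) (auto intro: inv_f_eq bij_is_inj)
    ultimately show ?thesis by (simp add: a)
  qed
  have 5: "\<psi> g q \<notin> fst ` ?D \<union> snd ` ?D" if "g \<noteq> \<one>"
    using q(1)[OF that] q(3) by (auto simp: F_def)
  have 6: "\<psi> g q \<notin> (if s then fst ` ?D else snd ` ?D)" if "g = \<one>"
    using q(2) that by (auto simp: F_def rep_one)
  have 7: "\<psi> g q \<noteq> p" using q(3) by (auto simp: F_def)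
  show ?case
    using IH(1) i 4 5 6 7 by (intro exI[of _ p] exI[of _ ?D] exI[of _ "\<psi> g q"]) (simp add: a)
qed

text \<open>If the variable occurs in the normal form, \<open>path_exists\<close> gives a finite
  partial injection under which the word moves \<open>p\<close>, and high transitivity realizes it
  by an element \<open>x\<close>; so the word does not vanish at \<open>x\<close>. Otherwise the
  word is a constant of the group.\<close>

lemma mixed_identity_free: "mixed_identity_free G"
proof -
  have "\<not> has_mixed_identity G"
  proof
    assume "has_mixed_identity G"
    then obtain W where W: "W \<in> carrier (free_product G integer_group)" "W \<noteq> \<one>\<^bsub>free_product G integer_group\<^esub>"
      and hom: "\<And>\<phi>. \<phi> \<in> hom (free_product G integer_group) G \<Longrightarrow>
        \<forall>g\<in>carrier G. \<phi> (free_product_inl G integer_group g) = g \<Longrightarrow> \<phi> W = \<one>"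
      unfolding has_mixed_identity_def by blast
    obtain w where w: "w \<in> lists FA" "W = word_class FA FR w"
      using W(1) by (auto simp: free_product_integer presented_def)
    have ev: "subst x w = \<one>" if x: "x \<in> carrier G" for x
    proof -
      obtain \<phi> where \<phi>: "\<phi> \<in> hom (free_product G integer_group) G"
        "\<forall>g\<in>carrier G. \<phi> (free_product_inl G integer_group g) = g"
        "\<forall>w\<in>lists FA. \<phi> (word_class FA FR w) = subst x w" using eval_hom[OF x] by blast
      show ?thesis using hom[OF \<phi>(1,2)] \<phi>(3) w by simp
    qed
    obtain g l where n: "normal g l" and c: "word_cong FA FR w (enc g l)" using normal_form[OF w(1)] by blast
    have gl: "g \<in> carrier G" "snd ` set l \<subseteq> carrier G" using n by (auto simp: normal_def)
    have ev': "subst x (enc g l) = \<one>" if "x \<in> carrier G" for x using ev[OF that] subst_cong[OF that c] by simp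
    show False
    proof (cases l)
      case Nil
      then have "g = \<one>" using ev'[of \<one>] gl by (simp add: enc_Nil letter_def)
      then have "word_cong FA FR w []" using c cong_rels(3)[of "[]"] Nil by (auto simp: enc_Nil intro: word_cong.trans)
      then have "W = \<one>\<^bsub>free_product G integer_group\<^esub>"
        using w by (simp add: free_product_integer presented_def word_class_eq_iff)
      then show False using W(2) by simp
    next
      case (Cons a k)
      obtain p D r where D: "finite D" "inj_on fst D" "inj_on snd D"
        "\<And>X. bij X \<Longrightarrow> \<forall>(a, b)\<in>D. X a = b \<Longrightarrow> path X g l p = r" "r \<noteq> p"
        using path_exists[OF n] Cons by (metis list.distinct(1))
      obtain ds where ds: "set ds = D" "distinct ds" using finite_distinct_list[OF D(1)] by blast
      obtain x where x: "x \<in> carrier G" "map (\<psi> x) (map fst ds) = map snd ds"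
        using tuples[of "map fst ds" "map snd ds"] ds D by (auto simp: distinct_map)
      have "\<forall>(a, b)\<in>D. \<psi> x a = b" using x(2) ds(1) by (auto simp: map_eq_conv)
      then have "path (\<psi> x) g l p = r" using D(4) bij_rep[OF x(1)] by blast
      then have "\<psi> (subst x (enc g l)) p = r" using path_subst[OF x(1) gl] by simp
      then show False using ev'[OF x(1)] D(5) by (simp add: rep_one)
    qed
  qed
  then show ?thesis using is_group by (simp add: mixed_identity_free_def)
qed

end

section \<open>Permutations of a fibre\<close>

type_synonym fibre = "nat \<times> int"

locale free_perms =
  fixes HH :: "(nat \<Rightarrow> nat) set"
  assumes HH: "perm_group HH"
    and free: "f \<in> HH \<Longrightarrow> f x = x \<Longrightarrow> f = id"
begin

lemma free_eq:
  assumes "f \<in> HH" "g \<in> HH" "f x = g x"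
  shows "f = g"
proof -
  note P = perm_groupD[OF HH]
  have "(inv_into UNIV g \<circ> f) x = x" using P(2)[OF assms(2)] assms(3) by (simp add: bij_is_inj)
  then have "inv_into UNIV g \<circ> f = id" using free P assms by blast
  then have "g \<circ> (inv_into UNIV g \<circ> f) = g" by simp
  then show ?thesis using P(2)[OF assms(2)] by (metis bij_is_surj comp_assoc id_comp surj_iff)
qed

text \<open>An enlargement of the restricted wreath product of \<open>HH\<close> by the integers:
  the lamps are trivial far to the left, but far to the right they have a constant value
  \<open>h\<close>, to make room for the permutations that act on a half of the fibre.\<close>

definition lamp_rep :: "(fibre \<Rightarrow> fibre) \<Rightarrow> int \<Rightarrow> (int \<Rightarrow> nat \<Rightarrow> nat) \<Rightarrow> (nat \<Rightarrow> nat) \<Rightarrow> bool" where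
  "lamp_rep u k \<phi> h \<longleftrightarrow> (\<forall>i. \<phi> i \<in> HH) \<and> h \<in> HH \<and>
     (\<exists>n::int. (\<forall>i < - n. \<phi> i = id) \<and> (\<forall>i>n. \<phi> i = h)) \<and> (\<forall>x i. u (x, i) = (\<phi> i x, i + k))"

definition lamp_group :: "(fibre \<Rightarrow> fibre) set" where
  "lamp_group = {u. \<exists>k \<phi> h. lamp_rep u k \<phi> h}"

lemma lamp_rep_comp:
  assumes "lamp_rep u k \<phi> h" "lamp_rep v l \<psi> g"
  shows "lamp_rep (u \<circ> v) (k + l) (\<lambda>i. \<phi> (i + l) \<circ> \<psi> i) (h \<circ> g)"
proof -
  obtain n m where n: "\<And>i. i < - n \<Longrightarrow> \<phi> i = id" "\<And>i. i > n \<Longrightarrow> \<phi> i = h"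
    and m: "\<And>i. i < -m \<Longrightarrow> \<psi> i = id" "\<And>i. i > m \<Longrightarrow> \<psi> i = g"
    using assms by (auto simp: lamp_rep_def)
  \<comment> \<open>\<open>\<phi>\<close> is read at \<open>i + l\<close>, so its bound grows by the
    size of the shift \<open>l\<close>.\<close>
  have "\<forall>i< - (max (\<bar>n\<bar> + \<bar>l\<bar>) \<bar>m\<bar>). \<phi> (i + l) \<circ> \<psi> i = id" "\<forall>i>max (\<bar>n\<bar> + \<bar>l\<bar>) \<bar>m\<bar>. \<phi> (i + l) \<circ> \<psi> i = h \<circ> g"
    by (auto simp: n m)
  then show ?thesis
    using assms perm_groupD(4)[OF HH] by (auto simp: lamp_rep_def intro!: exI[of _ "max (\<bar>n\<bar> + \<bar>l\<bar>) \<bar>m\<bar>"])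
qed

lemma lamp_rep_inv:
  assumes "lamp_rep u k \<phi> h"
  shows "bij u" "lamp_rep (inv_into UNIV u) (-k) (\<lambda>i. inv_into UNIV (\<phi> (i - k))) (inv_into UNIV h)"
proof -
  note P = perm_groupD[OF HH]
  define v :: "fibre \<Rightarrow> fibre" where "v = (\<lambda>(x, i). (inv_into UNIV (\<phi> (i - k)) x, i - k))"
  have \<phi>: "bij (\<phi> i)" for i using assms P by (auto simp: lamp_rep_def)
  have u: "u (x, i) = (\<phi> i x, i + k)" for x i using assms by (auto simp: lamp_rep_def)
  have vu: "v (u w) = w" for w
    using \<phi> by (cases w) (simp add: v_def u bij_is_inj)
  have uv: "u (v w) = w" for w
    using \<phi> by (cases w) (simp add: v_def u bij_is_surj surj_f_inv_f)
  show "bij u" using vu uv by (metis bijI')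
  have "inv_into UNIV u = v" using vu uv by (intro inv_equality) auto
  moreover obtain n where n: "\<And>i. i < - n \<Longrightarrow> \<phi> i = id" "\<And>i. i > n \<Longrightarrow> \<phi> i = h"
    using assms by (auto simp: lamp_rep_def)
  have "\<forall>i< - (\<bar>n\<bar> + \<bar>k\<bar>). inv_into UNIV (\<phi> (i - k)) = id"
    "\<forall>i>\<bar>n\<bar> + \<bar>k\<bar>. inv_into UNIV (\<phi> (i - k)) = inv_into UNIV h"
    by (auto simp: n inv_id)
  then show "lamp_rep (inv_into UNIV u) (-k) (\<lambda>i. inv_into UNIV (\<phi> (i - k))) (inv_into UNIV h)"
    using assms P calculation by (auto simp: lamp_rep_def v_def intro!: exI[of _ "\<bar>n\<bar> + \<bar>k\<bar>"])
qed

lemma lamp_rep_id: "lamp_rep id 0 (\<lambda>i. id) id"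
  using perm_groupD(1)[OF HH] by (auto simp: lamp_rep_def)

lemma perm_group_lamp_group: "perm_group lamp_group"
  using lamp_rep_id lamp_rep_comp lamp_rep_inv by (intro perm_groupI) (auto simp: lamp_group_def, blast+)

lemma lamp_rep_unique:
  assumes "lamp_rep u k \<phi> h" "lamp_rep u l \<psi> g"
  shows "k = l" "\<phi> = \<psi>" "h = g"
proof -
  have u: "(\<phi> i x, i + k) = (\<psi> i x, i + l)" for i x using assms by (metis lamp_rep_def)
  then show "k = l" "\<phi> = \<psi>" by (auto intro!: ext)
  obtain n m where "\<And>i. i > n \<Longrightarrow> \<phi> i = h" "\<And>i. i > m \<Longrightarrow> \<psi> i = g"
    using assms by (auto simp: lamp_rep_def)
  then have "\<phi> (max n m + 1) = h" "\<psi> (max n m + 1) = g" by auto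
  then show "h = g" using \<open>\<phi> = \<psi>\<close> by simp
qed

text \<open>Every row of the fibre is infinite, so two elements that agree off a finite set agree
  somewhere in each row, and freeness makes them equal there. Hence behaviour at almost all points
  determines an element of \<open>lamp_group\<close>.\<close>

lemma lamp_group_germ:
  assumes "u \<in> lamp_group" "v \<in> lamp_group" "finite {y. u y \<noteq> v y}"
  shows "u = v"
proof -
  obtain k \<phi> h l \<psi> g where r: "lamp_rep u k \<phi> h" "lamp_rep v l \<psi> g" using assms(1,2) by (auto simp: lamp_group_def)
  have u: "u (x, i) = (\<phi> i x, i + k)" "v (x, i) = (\<psi> i x, i + l)" for x i using r by (auto simp: lamp_rep_def)
  have ex: "\<exists>x. u (x, i) = v (x, i)" for i
  proof (rule ccontr)
    assume "\<nexists>x. u (x, i) = v (x, i)"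
    then have "range (\<lambda>x. (x, i)) \<subseteq> {y. u y \<noteq> v y}" by auto
    then have "finite (range (\<lambda>x::nat. (x, i)))" using assms(3) finite_subset by blast
    then show False using finite_imageD[of "\<lambda>x::nat. (x, i)" UNIV] by (auto simp: inj_on_def)
  qed
  have "\<phi> i = \<psi> i \<and> k = l" for i
  proof -
    obtain x where "u (x, i) = v (x, i)" using ex by blast
    moreover have "\<phi> i \<in> HH" "\<psi> i \<in> HH" using r by (auto simp: lamp_rep_def)
    ultimately show ?thesis using free_eq by (auto simp: u)
  qed
  then show ?thesis by (auto simp: u)
qed

end

locale free_perms_in_class = free_perms HH + group_class C for HH C +
  assumes HH_in_class: "perm_in_class HH"
begin

lemma lamp_group_fixed_support_in_class:
  fixes n :: int
  assumes "A = {u. \<exists>\<phi>. (\<forall>i. \<phi> i \<in> HH) \<and> (\<forall>i. \<bar>i\<bar> > n \<longrightarrow> \<phi> i = id) \<and> (\<forall>x i. u (x, i) = (\<phi> i x, i))}"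
    and A: "perm_group A"
  shows "perm_in_class A"
proof (rule perm_in_class_extension_family[where I = "{-n..n}" and Q = "perm_monoid HH" and R = "\<lambda>i u f. \<forall>x. u (x, i) = (f x, i)"])
  show "locally_in_class (perm_monoid HH)" using HH_in_class by (simp add: perm_in_class_def)
next
  fix i f assume "f \<in> A"
  then show "\<exists>q\<in>carrier (perm_monoid HH). \<forall>x. f (x, i) = (q x, i)" using assms(1) by fastforce
next
  assume P: "perm_group {f \<in> A. \<forall>i\<in>{-n..n}. \<forall>x. f (x, i) = (\<one>\<^bsub>perm_monoid HH\<^esub> x, i)}"
  have "f = id" if f: "f \<in> A" "\<forall>i\<in>{-n..n}. \<forall>x. f (x, i) = (x, i)" for f
  proof
    fix y :: fibre
    obtain x i where y: "y = (x, i)" by force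
    obtain \<phi> where \<phi>: "\<And>i. \<bar>i\<bar> > n \<Longrightarrow> \<phi> i = id" "\<And>x i. f (x, i) = (\<phi> i x, i)" using f(1) assms(1) by auto
    show "f y = id y"
    proof (cases "\<bar>i\<bar> > n")
      case False
      then have "i \<in> {-n..n}" by auto
      then show ?thesis using f(2) y by simp
    qed (simp add: y \<phi>)
  qed
  then have "{f \<in> A. \<forall>i\<in>{-n..n}. \<forall>x. f (x, i) = (\<one>\<^bsub>perm_monoid HH\<^esub> x, i)} \<subseteq> {id}" by auto
  then have "finite {f \<in> A. \<forall>i\<in>{-n..n}. \<forall>x. f (x, i) = (\<one>\<^bsub>perm_monoid HH\<^esub> x, i)}"
    using finite_subset by blast
  then show "perm_in_class {f \<in> A. \<forall>i\<in>{-n..n}. \<forall>x. f (x, i) = (\<one>\<^bsub>perm_monoid HH\<^esub> x, i)}"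
    using P by (intro perm_in_class_finite)
next
  fix i f p q
  assume "\<forall>x. f (x, i) = (p x, i)" "\<forall>x. f (x, i) = (q x, i)"
  then show "p = q" by auto
qed (use A in auto)

text \<open>Two quotients are split off: the shift, with values in the integers, and the limit
  \<open>h\<close>, with values in \<open>HH\<close>. What remains acts on finitely many rows and is
  a directed union of finite powers of \<open>HH\<close>.\<close>

lemma lamp_group_in_class: "perm_in_class lamp_group"
proof (rule perm_in_class_extension[OF perm_group_lamp_group, where Q = integer_group and R = "\<lambda>u k. \<exists>\<phi> h. lamp_rep u k \<phi> h"])
  show "locally_in_class integer_group" by (intro locally_in_class_abelian abelian_integer_group)
next
  fix f g p q assume "\<exists>\<phi> h. lamp_rep f p \<phi> h" "\<exists>\<phi> h. lamp_rep g q \<phi> h"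
  then show "\<exists>\<phi> h. lamp_rep (f \<circ> g) (p \<otimes>\<^bsub>integer_group\<^esub> q) \<phi> h" using lamp_rep_comp by fastforce
next
  let ?K = "{f \<in> lamp_group. \<exists>\<phi> h. lamp_rep f \<one>\<^bsub>integer_group\<^esub> \<phi> h}"
  assume K: "perm_group ?K"
  show "perm_in_class ?K"
  proof (rule perm_in_class_extension[OF K, where Q = "perm_monoid HH" and R = "\<lambda>u h. \<exists>\<phi>. lamp_rep u 0 \<phi> h"])
    show "locally_in_class (perm_monoid HH)" using HH_in_class by (simp add: perm_in_class_def)
  next
    fix f assume "f \<in> ?K"
    then obtain \<phi> h where "lamp_rep f 0 \<phi> h" by auto
    then show "\<exists>q\<in>carrier (perm_monoid HH). \<exists>\<phi>. lamp_rep f 0 \<phi> q" by (auto simp: lamp_rep_def)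
  next
    fix f g p q assume "\<exists>\<phi>. lamp_rep f 0 \<phi> p" "\<exists>\<phi>. lamp_rep g 0 \<phi> q"
    then show "\<exists>\<phi>. lamp_rep (f \<circ> g) 0 \<phi> (p \<otimes>\<^bsub>perm_monoid HH\<^esub> q)" using lamp_rep_comp by fastforce
  next
    let ?L = "{f \<in> ?K. \<exists>\<phi>. lamp_rep f 0 \<phi> \<one>\<^bsub>perm_monoid HH\<^esub>}"
    let ?A = "\<lambda>n::nat. {u. \<exists>\<phi>. (\<forall>i. \<phi> i \<in> HH) \<and> (\<forall>i. \<bar>i\<bar> > int n \<longrightarrow> \<phi> i = id) \<and> (\<forall>x i. u (x, i) = (\<phi> i x, i))}"
    assume L: "perm_group ?L"
    show "perm_in_class ?L"
    proof (rule perm_in_class_union[OF L, where \<K> = "range ?A"])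
      fix A assume "A \<in> range ?A"
      then obtain n where n: "A = ?A n" by blast
      have rep: "\<exists>\<phi>. lamp_rep u 0 \<phi> id \<and> (\<forall>i. \<bar>i\<bar> > int n \<longrightarrow> \<phi> i = id)" if u: "u \<in> A" for u
      proof -
        obtain \<phi> where "\<forall>i. \<phi> i \<in> HH" "\<forall>i. \<bar>i\<bar> > int n \<longrightarrow> \<phi> i = id" "\<forall>x i. u (x, i) = (\<phi> i x, i)"
          using u unfolding n by blast
        then show ?thesis using perm_groupD(1)[OF HH]
          by (intro exI[of _ \<phi>]) (auto simp: lamp_rep_def intro!: exI[of _ "int n"])
      qed
      have A: "u \<in> A" if "lamp_rep u 0 \<phi> h" "\<forall>i. \<bar>i\<bar> > int n \<longrightarrow> \<phi> i = id" for u \<phi> h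
        using that unfolding n by (auto simp: lamp_rep_def)
      have "perm_group A"
      proof (rule perm_groupI)
        show "id \<in> A" by (rule A[OF lamp_rep_id]) simp
        fix f assume "f \<in> A"
        then obtain \<phi> where \<phi>: "lamp_rep f 0 \<phi> id" "\<forall>i. \<bar>i\<bar> > int n \<longrightarrow> \<phi> i = id" using rep by blast
        show "bij f" using lamp_rep_inv(1)[OF \<phi>(1)] .
        show "inv_into UNIV f \<in> A"
          using A[of "inv_into UNIV f"] lamp_rep_inv(2)[OF \<phi>(1)] \<phi>(2) by (auto simp: inv_id)
        fix g assume "g \<in> A"
        then obtain \<psi> where \<psi>: "lamp_rep g 0 \<psi> id" "\<forall>i. \<bar>i\<bar> > int n \<longrightarrow> \<psi> i = id" using rep by blast
        show "f \<circ> g \<in> A" using A[of "f \<circ> g"] lamp_rep_comp[OF \<phi>(1) \<psi>(1)] \<phi>(2) \<psi>(2) by auto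
      qed
      then show "perm_in_class A" by (rule lamp_group_fixed_support_in_class[OF n])
    next
      fix A B assume "A \<in> range ?A" "B \<in> range ?A"
      then obtain n m where "A = ?A n" "B = ?A m" by blast
      moreover have mono: "?A n \<subseteq> ?A k" if nk: "n \<le> k" for n k
      proof
        fix u assume "u \<in> ?A n"
        then obtain \<phi> where \<phi>: "\<forall>i. \<phi> i \<in> HH" "\<forall>i. \<bar>i\<bar> > int n \<longrightarrow> \<phi> i = id" "\<forall>x i. u (x, i) = (\<phi> i x, i)"
          by blast
        have "\<forall>i. \<bar>i\<bar> > int k \<longrightarrow> \<phi> i = id" using \<phi>(2) nk by auto
        then show "u \<in> ?A k" using \<phi> by blast
      qed
      ultimately have "A \<union> B \<subseteq> ?A (max n m)"
        using mono[of n "max n m"] mono[of m "max n m"] by simp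
      then show "\<exists>M\<in>range ?A. A \<union> B \<subseteq> M" by (rule bexI) (rule rangeI)
    next
      show "\<Union> (range ?A) = ?L"
      proof (intro equalityI subsetI)
        fix u assume "u \<in> \<Union> (range ?A)"
        then obtain n \<phi> where \<phi>: "\<forall>i. \<phi> i \<in> HH" "\<forall>i. \<bar>i\<bar> > int n \<longrightarrow> \<phi> i = id" "\<forall>x i. u (x, i) = (\<phi> i x, i)"
          by auto
        then have "lamp_rep u 0 \<phi> id" using perm_groupD(1)[OF HH]
          by (auto simp: lamp_rep_def intro!: exI[of _ "int n"])
        then show "u \<in> ?L" by (auto simp: lamp_group_def)
      next
        fix u assume "u \<in> ?L"
        then obtain \<phi> where \<phi>: "lamp_rep u 0 \<phi> id" by auto
        then obtain n where n: "\<And>i. i < - n \<Longrightarrow> \<phi> i = id" "\<And>i. i > n \<Longrightarrow> \<phi> i = id" by (auto simp: lamp_rep_def)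
        have "\<phi> i = id" if "\<bar>i\<bar> > int (nat \<bar>n\<bar>)" for i
        proof -
          have "i < - n \<or> i > n" using that by linarith
          then show ?thesis using n by blast
        qed
        then have "u \<in> ?A (nat \<bar>n\<bar>)" using \<phi> by (auto simp: lamp_rep_def)
        then show "u \<in> \<Union> (range ?A)" by blast
      qed
    qed auto
  qed (use lamp_rep_unique in auto)
qed (use lamp_rep_unique in \<open>auto simp: lamp_group_def\<close>)

end

section \<open>Self-similar patterns of integers\<close>

inductive_set V :: "int set" where
  zero: "0 \<in> V"
| even: "v \<in> V \<Longrightarrow> 5 * v \<in> V"
| odd: "v \<in> V \<Longrightarrow> 5 * v + 1 \<in> V"

text \<open>These are the integers \<open>5 ^ m * (5 * v + 2)\<close> with \<open>v\<close> in
  \<open>V\<close>: the lowest nonzero digit is 2, all digits above it are 0 or 1, and the label is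
  the place of the digit 2.\<close>

inductive Lab :: "nat \<Rightarrow> int \<Rightarrow> bool" where
  zero: "v \<in> V \<Longrightarrow> Lab 0 (5 * v + 2)"
| Suc: "Lab m z \<Longrightarrow> Lab (Suc m) (5 * z)"

lemma digit_unique:
  fixes q q' r r' :: int
  assumes "5 * q + r = 5 * q' + r'" "0 \<le> r" "r < 5" "0 \<le> r'" "r' < 5"
  shows "q = q'" "r = r'"
  using assms by presburger+

lemma V_digit:
  assumes "0 \<le> r" "r < 5"
  shows "5 * q + r \<in> V \<longleftrightarrow> q \<in> V \<and> (r = 0 \<or> r = 1)"
proof
  assume "5 * q + r \<in> V"
  then show "q \<in> V \<and> (r = 0 \<or> r = 1)"
  proof cases
    case zero
    then have "q = 0 \<and> r = 0" using assms by presburger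
    then show ?thesis using V.zero by simp
  next
    case (even v)
    then have "q = v \<and> r = 0" using digit_unique[of q r v 0] assms by simp
    then show ?thesis using even by simp
  next
    case (odd v)
    then have "q = v \<and> r = 1" using digit_unique[of q r v 1] assms by simp
    then show ?thesis using odd by simp
  qed
qed (auto intro: V.even V.odd)

lemma Lab_digit:
  assumes "0 \<le> r" "r < 5"
  shows "Lab m (5 * q + r) \<longleftrightarrow> r = 2 \<and> m = 0 \<and> q \<in> V \<or> (\<exists>m'. r = 0 \<and> m = Suc m' \<and> Lab m' q)"
proof
  assume "Lab m (5 * q + r)"
  then show "r = 2 \<and> m = 0 \<and> q \<in> V \<or> (\<exists>m'. r = 0 \<and> m = Suc m' \<and> Lab m' q)"
  proof cases
    case (zero v)
    then have "q = v \<and> r = 2" using digit_unique[of q r v 2] assms by simp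
    then show ?thesis using zero by simp
  next
    case (Suc m' z)
    then have "q = z \<and> r = 0" using digit_unique[of q r z 0] assms by simp
    then show ?thesis using Suc by simp
  qed
qed (auto intro: Lab.intros)

lemma V_nonneg: "v \<in> V \<Longrightarrow> 0 \<le> v"
  by (induction rule: V.induct) auto

text \<open>The digits -2 and -1 are the digits 3 and 4 of the next smaller number, which occur
  neither in \<open>V\<close> nor in labelled integers. The range is that of
  \<open>blk_near\<close>.\<close>

lemma V_wide:
  assumes "-2 \<le> r" "r \<le> 4"
  shows "5 * q + r \<in> V \<longleftrightarrow> q \<in> V \<and> (r = 0 \<or> r = 1)"
proof (cases "0 \<le> r")
  case True
  then show ?thesis using V_digit assms by simp
next
  case False
  then have "5 * (q - 1) + (r + 5) \<notin> V" using V_digit[of "r + 5" "q - 1"] assms by auto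
  then show ?thesis using False by (simp add: algebra_simps)
qed

lemma Lab_wide:
  assumes "-2 \<le> r" "r \<le> 4"
  shows "Lab m (5 * q + r) \<longleftrightarrow> r = 2 \<and> m = 0 \<and> q \<in> V \<or> (\<exists>m'. r = 0 \<and> m = Suc m' \<and> Lab m' q)"
proof (cases "0 \<le> r")
  case True
  then show ?thesis using Lab_digit assms by simp
next
  case False
  then have "\<not> Lab m (5 * (q - 1) + (r + 5))" using Lab_digit[of "r + 5" m "q - 1"] assms by auto
  then show ?thesis using False by (simp add: algebra_simps)
qed

lemma V_5_2 [simp]: "5 * v + 2 \<notin> V" and V_5: "5 * v \<in> V \<longleftrightarrow> v \<in> V"
  using V_digit[of 2 v] V_digit[of 0 v] by auto

lemma Lab_not_V: "Lab m z \<Longrightarrow> z \<notin> V"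
  by (induction rule: Lab.induct) (auto simp: V_5)

lemma Lab_unique: "Lab m z \<Longrightarrow> Lab m' z \<Longrightarrow> m = m'"
proof (induction m z arbitrary: m' rule: Lab.induct)
  case (zero v)
  then show ?case using Lab_digit[of 2 m' v] by auto
next
  case (Suc m z)
  then have "Lab m' (5 * z + 0)" by simp
  then obtain m'' where "m' = Suc m''" "Lab m'' z" by (subst (asm) Lab_digit) auto
  then show ?case using Suc.IH by simp
qed

lemma infinite_V: "infinite V"
proof
  assume fin: "finite V"
  have "Max V \<in> V" using fin V.zero by (intro Max_in) auto
  then have "5 * Max V + 1 \<le> Max V" by (intro Max_ge fin V.odd)
  then show False using V_nonneg[OF \<open>Max V \<in> V\<close>] by simp
qed

lemma Lab_power: "v \<in> V \<Longrightarrow> Lab m (2 * 5 ^ m + 5 ^ (m + 1) * v)"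
proof (induction m)
  case 0
  then show ?case using Lab.zero[of v] by (simp add: algebra_simps)
next
  case (Suc m)
  then have "Lab (Suc m) (5 * (2 * 5 ^ m + 5 ^ (m + 1) * v))" by (intro Lab.Suc)
  then show ?case by (simp add: algebra_simps)
qed

lemma infinite_Lab: "infinite {z. Lab m z}"
proof
  let ?f = "\<lambda>v::int. 2 * 5 ^ m + 5 ^ (m + 1) * v"
  assume "finite {z. Lab m z}"
  moreover have "?f ` V \<subseteq> {z. Lab m z}" using Lab_power by auto
  ultimately have "finite (?f ` V)" using finite_subset by blast
  moreover have "inj_on ?f V" by (auto simp: inj_on_def)
  ultimately show False using infinite_V finite_imageD by blast
qed

lemma V_power: "5 ^ n * v \<in> V \<longleftrightarrow> v \<in> V"
  by (induction n) (auto simp: V_5 mult.assoc)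

text \<open>Adding 1 leaves all digits 0 or 1 only if the last digit was 0. So intersecting with a
  translate thins \<open>V\<close> out to its own copy at the next scale.\<close>

lemma V_Int_shift: "v \<in> V \<and> v + 1 \<in> V \<longleftrightarrow> (\<exists>w\<in>V. v = 5 * w)"
proof
  assume "v \<in> V \<and> v + 1 \<in> V"
  then have v: "v \<in> V" "v + 1 \<in> V" by auto
  from v(1) show "\<exists>w\<in>V. v = 5 * w"
  proof cases
    case zero then show ?thesis using V.zero by auto
  next
    case (odd w)
    then show ?thesis using v(2) by (simp add: add.assoc)
  qed auto
qed (auto intro: V.even V.odd)

text \<open>The only overlap of the shifted patterns used to isolate a commutator.\<close>

lemma V_plus_power_Lab:
  "v \<in> V \<Longrightarrow> Lab c (v + 2 * 5 ^ m) \<Longrightarrow> c = m \<and> (\<exists>w\<in>V. v = 5 ^ (m + 1) * w)"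
proof (induction m arbitrary: v c)
  case 0
  from \<open>v \<in> V\<close> show ?case
  proof cases
    case zero
    then show ?thesis using 0 Lab_digit[of 2 c 0] V.zero by auto
  next
    case (even w)
    then show ?thesis using 0 Lab_digit[of 2 c w] by auto
  next
    case (odd w)
    then have "Lab c (5 * w + 3)" using 0 by (simp add: add.commute)
    then show ?thesis using Lab_digit[of 3 c w] by auto
  qed
next
  case (Suc m)
  from \<open>v \<in> V\<close> show ?case
  proof cases
    case zero
    then have "Lab c (5 * (0 + 2 * 5 ^ m) + 0)" using Suc.prems by simp
    then obtain c' where "c = Suc c'" "Lab c' (0 + 2 * 5 ^ m)"
      using Lab_digit[of 0 c "0 + 2 * 5 ^ m"] by auto
    then show ?thesis using Suc.IH[of 0 c'] V.zero zero by auto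
  next
    case (even w)
    then have "Lab c (5 * (w + 2 * 5 ^ m) + 0)" using Suc.prems by (simp add: algebra_simps)
    then obtain c' where "c = Suc c'" "Lab c' (w + 2 * 5 ^ m)"
      using Lab_digit[of 0 c "w + 2 * 5 ^ m"] by auto
    then show ?thesis using Suc.IH[of w c'] even by auto
  next
    case (odd w)
    then have "Lab c (5 * (w + 2 * 5 ^ m) + 1)" using Suc.prems by (simp add: algebra_simps)
    then show ?thesis using Lab_digit[of 1 c "w + 2 * 5 ^ m"] by auto
  qed
qed

text \<open>If \<open>z + 2\<close> ends in the digit 2, then \<open>z\<close> is five times an
  element of \<open>V\<close> and \<open>V_plus_power_Lab\<close> applies. Otherwise 5 divides
  \<open>z + 2\<close>, and the second number ends in the digit 3, which no labelled integer does.
  Two translates of \<open>label_perm\<close> thus interact on \<open>5 ^ (m + 2) * w\<close> with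
  \<open>w\<close> in \<open>V\<close> only.\<close>

lemma Lab_overlap:
  assumes "Lab a (z + 2)" "Lab c (z + 2 * 5 ^ Suc m)"
  shows "a = 0 \<and> c = Suc m \<and> (\<exists>w\<in>V. z = 5 ^ (m + 2) * w)"
proof -
  from assms(1) show ?thesis
  proof cases
    case (zero v)
    then have z: "z = 5 * v" by simp
    then have "Lab c (5 * (v + 2 * 5 ^ m) + 0)" using assms(2) by (simp add: algebra_simps)
    then obtain c' where c: "c = Suc c'" "Lab c' (v + 2 * 5 ^ m)"
      using Lab_digit[of 0 c "v + 2 * 5 ^ m"] by auto
    then have "c' = m \<and> (\<exists>w\<in>V. v = 5 ^ (m + 1) * w)" using V_plus_power_Lab zero by blast
    then show ?thesis using c zero z by auto
  next
    case (Suc a' y)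
    then have "z + 2 * 5 ^ Suc m = 5 * (y - 1 + 2 * 5 ^ m) + 3" by simp
    then have "Lab c (5 * (y - 1 + 2 * 5 ^ m) + 3)" using assms(2) by metis
    then show ?thesis by (subst (asm) Lab_digit) simp_all
  qed
qed

text \<open>At scale \<open>n\<close> the integers are cut into the windows \<open>5\<^sup>n q + [-a, 5\<^sup>n - a)\<close> with
  \<open>a = (5\<^sup>n - 1) / 4\<close>. The window of \<open>q\<close> at scale \<open>n + 1\<close> is made of the windows
  \<open>5 q - 1, \<dots>, 5 q + 3\<close> at scale \<open>n\<close>.\<close>

definition margin :: "nat \<Rightarrow> int" where "margin n = (5 ^ n - 1) div 4"

definition blk :: "nat \<Rightarrow> int \<Rightarrow> int" where "blk n z = (z + margin n) div 5 ^ n"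

definition pos :: "nat \<Rightarrow> int \<Rightarrow> int" where "pos n z = z - 5 ^ n * blk n z"

lemma margin_eq: "5 ^ n = 4 * margin n + 1"
proof (induction n)
  case (Suc n)
  then have "(5::int) ^ Suc n - 1 = 4 * (5 * margin n + 1)" by simp
  then have "margin (Suc n) = 5 * margin n + 1" by (simp add: margin_def)
  then show ?case using Suc by simp
qed (simp add: margin_def)

lemma margin_nonneg: "0 \<le> margin n"
  using margin_eq[of n] one_le_power[of "5::int" n] by linarith

lemma margin_Suc: "margin (Suc n) = 5 * margin n + 1"
  using margin_eq[of n] margin_eq[of "Suc n"] by simp

text \<open>As \<open>5 ^ n = 4 * margin n + 1\<close>, the last point of a window lies
  \<open>3 * margin n\<close> to the right of its origin. In this form questions about windows
  become linear inequalities.\<close>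

lemma blk_iff: "blk n z = q \<longleftrightarrow> -margin n \<le> z - 5 ^ n * q \<and> z - 5 ^ n * q \<le> 3 * margin n"
proof -
  let ?P = "5 ^ n :: int" and ?x = "z + margin n"
  have "blk n z = q \<longleftrightarrow> ?P * q \<le> ?x \<and> ?x < ?P * q + ?P"
  proof
    assume "blk n z = q"
    then have "?x = ?P * q + ?x mod ?P" using mult_div_mod_eq[of ?P ?x] by (simp add: blk_def)
    moreover have "0 \<le> ?x mod ?P" "?x mod ?P < ?P" by simp_all
    ultimately show "?P * q \<le> ?x \<and> ?x < ?P * q + ?P" by linarith
  next
    assume "?P * q \<le> ?x \<and> ?x < ?P * q + ?P"
    then show "blk n z = q" unfolding blk_def by (intro int_div_pos_eq[of _ _ _ "?x - ?P * q"]) auto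
  qed
  then show ?thesis using margin_eq[of n] by auto
qed

lemma blk_add: "blk n j = 0 \<Longrightarrow> blk n (5 ^ n * q + j) = q"
  by (simp add: blk_iff)

lemma pos_add: "blk n j = 0 \<Longrightarrow> pos n (5 ^ n * q + j) = j"
  by (simp add: pos_def blk_add)

lemma blk_pos [simp]: "blk n (pos n z) = 0"
  using blk_iff[of n z "blk n z"] blk_iff[of n "pos n z" 0] by (simp add: pos_def)

lemma pos_blk0: "blk n z = 0 \<Longrightarrow> pos n z = z"
  by (simp add: pos_def)

lemma blk_0 [simp]: "blk 0 z = z" "pos 0 z = 0"
  by (simp_all add: blk_def pos_def margin_def)

lemma finite_blk0: "finite {z. blk n z = 0}"
proof -
  have "{z. blk n z = 0} \<subseteq> {-margin n..3 * margin n}" by (auto simp: blk_iff)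
  then show ?thesis using finite_subset by blast
qed

text \<open>A translation by at most 1 can carry a point of the parts -1 to 3 into the neighbouring
  part on either side, hence the range from -2 to 4.\<close>

lemma blk_near:
  assumes "blk (Suc n) z = q" "\<bar>k\<bar> \<le> 1"
  obtains r where "blk n (z - k) = 5 * q + r" "-2 \<le> r" "r \<le> 4"
proof -
  let ?r = "blk n (z - k) - 5 * q"
  have M: "5 ^ n = 4 * margin n + 1" by (rule margin_eq)
  have *: "-margin n \<le> z - k - 5 ^ n * blk n (z - k)" "z - k - 5 ^ n * blk n (z - k) \<le> 3 * margin n"
    using blk_iff[of n "z - k" "blk n (z - k)"] by auto
  have **: "-(5 * margin n + 1) \<le> z - 5 ^ n * (5 * q)" "z - 5 ^ n * (5 * q) \<le> 3 * (5 * margin n + 1)"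
    using blk_iff[of "Suc n" z q] assms(1) by (auto simp: margin_Suc algebra_simps)
  have e: "5 ^ n * ?r = (z - 5 ^ n * (5 * q)) - k - (z - k - 5 ^ n * blk n (z - k))"
    by (simp add: algebra_simps)
  have "5 ^ n * ?r \<le> 3 * (5 * margin n + 1) + 1 + margin n" using * ** e assms(2) by linarith
  also have "\<dots> < 5 ^ n * 5" using M margin_nonneg[of n] by simp
  finally have "?r < 5" by simp
  moreover have "5 ^ n * ?r \<ge> -(5 * margin n + 1) - 1 - 3 * margin n" using * ** e assms(2) by linarith
  then have "5 ^ n * (-3) < 5 ^ n * ?r" using M margin_nonneg[of n] by linarith
  then have "-3 < ?r" by (subst (asm) mult_less_cancel_left_pos) simp_all
  ultimately show ?thesis using that[of ?r] by simp
qed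

text \<open>The parts 0 and 1 lie in the interior of the window, so their points stay inside under a
  translation by at most 1. These are the parts indexed by \<open>V\<close>, the only ones where
  points may leave their fibre.\<close>

lemma blk_Suc_near:
  assumes "blk n z = 5 * q + r" "0 \<le> r" "r \<le> 1" "\<bar>k\<bar> \<le> 1"
  shows "blk (Suc n) (z + k) = q"
proof -
  have M: "5 ^ n = 4 * margin n + 1" by (rule margin_eq)
  have "-margin n \<le> z - 5 ^ n * (5 * q + r)" "z - 5 ^ n * (5 * q + r) \<le> 3 * margin n"
    using blk_iff[of n z "5 * q + r"] assms(1) by auto
  moreover have "5 ^ n * (5 * q + r) = 5 ^ n * (5 * q) + r * 5 ^ n" by (simp add: algebra_simps)
  moreover have "r = 0 \<or> r = 1" using assms by linarith
  ultimately have "- (5 * margin n + 1) \<le> z + k - 5 ^ n * (5 * q)" "z + k - 5 ^ n * (5 * q) \<le> 3 * (5 * margin n + 1)"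
    using M margin_nonneg[of n] assms(4) by auto
  then show ?thesis by (simp add: blk_iff margin_Suc algebra_simps)
qed

section \<open>Self-similar permutations\<close>

type_synonym point = "fibre \<times> int"

definition transl :: "int \<Rightarrow> point \<Rightarrow> point" where "transl k = (\<lambda>(y, z). (y, z + k))"

lemma transl_simps [simp]: "transl k (y, z) = (y, z + k)" "transl k (transl l w) = transl (k + l) w" "transl 0 w = w"
    "fst (transl k w) = fst w" "snd (transl k w) = snd w + k"
  by (cases w; simp add: transl_def)+

lemma transl_0: "transl 0 = id"
  by auto

lemma transl_comp: "transl k \<circ> transl l = transl (k + l)"
  by auto

lemma bij_transl: "bij (transl k)" and inv_transl: "inv_into UNIV (transl k) = transl (-k)"
proof -
  have *: "transl (-k) (transl k w) = w" "transl k (transl (-k) w) = w" for w by simp_all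
  then show "bij (transl k)" by (metis bijI')
  show "inv_into UNIV (transl k) = transl (-k)" using * by (intro inv_equality) auto
qed

definition perm_power :: "('b \<Rightarrow> 'b) \<Rightarrow> int \<Rightarrow> 'b \<Rightarrow> 'b" where
  "perm_power f k = f [^]\<^bsub>perm_monoid {f. bij f}\<^esub> k"

lemma perm_power_0: "perm_power f 0 = id"
  by (simp add: perm_power_def)

lemma perm_power_1: "bij f \<Longrightarrow> perm_power f 1 = f"
  using group.int_pow_1[OF group_perm_monoid[OF perm_group_bij], of f] by (simp add: perm_power_def)

lemma perm_power_add: "bij f \<Longrightarrow> perm_power f (k + l) = perm_power f k \<circ> perm_power f l"
  using group.int_pow_mult[OF group_perm_monoid[OF perm_group_bij], of f k l] by (simp add: perm_power_def)

lemma perm_power_add_apply: "bij f \<Longrightarrow> perm_power f k (perm_power f l y) = perm_power f (k + l) y"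
  by (simp add: perm_power_add)

lemma perm_power_closed: "perm_group A \<Longrightarrow> f \<in> A \<Longrightarrow> perm_power f k \<in> A"
  unfolding perm_power_def
  by (intro group.subgroup_int_pow_closed[OF group_perm_monoid[OF perm_group_bij]] subgroup_perm_monoid perm_group_bij)
    (auto dest: perm_groupD)

lemma blk_shift: "blk n (z - 5 ^ n * p) = blk n z - p" "pos n (z - 5 ^ n * p) = pos n z"
proof -
  have "blk n (5 ^ n * (blk n z - p) + pos n z) = blk n z - p" by (rule blk_add) simp
  moreover have "5 ^ n * (blk n z - p) + pos n z = z - 5 ^ n * p" by (simp add: pos_def algebra_simps)
  ultimately show "blk n (z - 5 ^ n * p) = blk n z - p" by simp
  then show "pos n (z - 5 ^ n * p) = pos n z" by (simp add: pos_def right_diff_distrib)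
qed

locale pattern = free_perms HH for HH +
  fixes e :: "nat \<Rightarrow> nat \<Rightarrow> nat"
  assumes e: "range e = HH"
    and transitive: "\<exists>f\<in>HH. f x = y"
begin

definition shift1 :: "fibre \<Rightarrow> fibre" where "shift1 = (\<lambda>(x, i). (x, i + 1))"

definition half :: "(nat \<Rightarrow> nat) \<Rightarrow> fibre \<Rightarrow> fibre" where
  "half f = (\<lambda>(x, i). (if i \<ge> 0 then f x else x, i))"

text \<open>The shift is put at label 0, the one that \<open>Lab_overlap\<close> brings together
  with each other label.\<close>

fun label :: "nat \<Rightarrow> fibre \<Rightarrow> fibre" where
  "label 0 = shift1"
| "label (Suc m) = half (e m)"

lemma label_lamp_group: "label m \<in> lamp_group"
proof (cases m)
  case 0
  have "lamp_rep shift1 1 (\<lambda>i. id) id"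
    using perm_groupD(1)[OF HH] by (auto simp: lamp_rep_def shift1_def)
  then show ?thesis using 0 by (auto simp: lamp_group_def)
next
  case (Suc m')
  have "e m' \<in> HH" using e by auto
  then have "lamp_rep (half (e m')) 0 (\<lambda>i. if i \<ge> 0 then e m' else id) (e m')"
    using perm_groupD(1)[OF HH] by (auto simp: lamp_rep_def half_def intro!: exI[of _ 0])
  then show ?thesis using Suc by (auto simp: lamp_group_def)
qed

lemma bij_label: "bij (label m)"
  using label_lamp_group perm_groupD(2)[OF perm_group_lamp_group] by blast

text \<open>The permutations that look alike in all windows of the same type at scale \<open>n\<close>. In the windows
  indexed by \<open>V\<close> they are copies of one permutation that is almost everywhere given by \<open>lamp_group\<close>; in a
  window with label \<open>m\<close> only powers of \<open>label (n + m)\<close> occur, with exponents that do not depend on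
  \<open>m\<close>, so that the infinitely many labels contribute an abelian group only.\<close>

definition acts :: "nat \<Rightarrow> (point \<Rightarrow> point) \<Rightarrow> (int \<Rightarrow> int) \<Rightarrow> fibre \<Rightarrow> int \<Rightarrow> bool" where
  "acts n g \<alpha> y z \<longleftrightarrow>
     (blk n z \<in> V \<longrightarrow> g (y, z) = transl (5 ^ n * blk n z) (g (y, pos n z))) \<and>
     (\<forall>m. Lab m (blk n z) \<longrightarrow> g (y, z) = (perm_power (label (n + m)) (\<alpha> (pos n z)) y, z)) \<and>
     (blk n z \<notin> V \<longrightarrow> (\<forall>m. \<not> Lab m (blk n z)) \<longrightarrow> g (y, z) = (y, z))"

text \<open>The germs in \<open>lamp_group\<close> give one homomorphism for each of the finitely
  many fibres of window 0. Their common kernel moves finitely many points of that window, which is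
  the starting point of \<open>level_in_class\<close>.\<close>

definition level :: "nat \<Rightarrow> (point \<Rightarrow> point) set" where
  "level n = {g. bij g \<and> (\<exists>\<alpha>. \<forall>y z. acts n g \<alpha> y z) \<and>
     (\<forall>y j. blk n j = 0 \<longrightarrow> blk n (snd (g (y, j))) = 0) \<and>
     (\<forall>j. blk n j = 0 \<longrightarrow> (\<exists>u\<in>lamp_group. finite {y. g (y, j) \<noteq> (u y, j)}))}"

lemma level_D:
  assumes "g \<in> level n"
  shows "bij g" "\<exists>\<alpha>. \<forall>y z. acts n g \<alpha> y z" "blk n j = 0 \<Longrightarrow> blk n (snd (g (y, j))) = 0"
    "blk n j = 0 \<Longrightarrow> \<exists>u\<in>lamp_group. finite {y. g (y, j) \<noteq> (u y, j)}"
  using assms unfolding level_def by blast+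

lemma level_I:
  assumes "bij g" "\<And>y z. acts n g \<alpha> y z" "\<And>y j. blk n j = 0 \<Longrightarrow> blk n (snd (g (y, j))) = 0"
    "\<And>j. blk n j = 0 \<Longrightarrow> \<exists>u\<in>lamp_group. finite {y. g (y, j) \<noteq> (u y, j)}"
  shows "g \<in> level n"
  using assms unfolding level_def by blast

lemma acts_cases [case_names V Lab other]:
  assumes "acts n g \<alpha> y z"
  obtains "blk n z \<in> V" "g (y, z) = transl (5 ^ n * blk n z) (g (y, pos n z))"
  | m where "blk n z \<notin> V" "Lab m (blk n z)" "g (y, z) = (perm_power (label (n + m)) (\<alpha> (pos n z)) y, z)"
  | "blk n z \<notin> V" "\<And>m. \<not> Lab m (blk n z)" "g (y, z) = (y, z)"
  using assms unfolding acts_def by blast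

lemma level_blk:
  assumes "g \<in> level n"
  shows "blk n (snd (g (y, z))) = blk n z"
proof -
  obtain \<alpha> where \<alpha>: "acts n g \<alpha> y z" using level_D(2)[OF assms] by metis
  from \<alpha> show ?thesis
  proof (cases rule: acts_cases)
    case V
    have "blk n (snd (g (y, pos n z))) = 0" by (intro level_D(3)[OF assms]) simp
    then show ?thesis using V blk_add by (simp add: add.commute)
  qed auto
qed

lemma level_comp:
  assumes f: "f \<in> level n" and g: "g \<in> level n"
  shows "f \<circ> g \<in> level n"
proof -
  obtain \<alpha> where \<alpha>: "\<And>y z. acts n f \<alpha> y z" using level_D(2)[OF f] by metis
  obtain \<beta> where \<beta>: "\<And>y z. acts n g \<beta> y z" using level_D(2)[OF g] by metis
  have "acts n (f \<circ> g) (\<lambda>j. \<alpha> j + \<beta> j) y z" for y z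
    using \<beta>[of y z]
  proof (cases rule: acts_cases)
    case V
    obtain y' j' where g': "g (y, pos n z) = (y', j')" by (metis surj_pair)
    then have j': "blk n j' = 0" using level_blk[OF g, of y "pos n z"] by simp
    then have *: "blk n (j' + 5 ^ n * blk n z) = blk n z" "pos n (j' + 5 ^ n * blk n z) = j'"
      using blk_add[OF j'] pos_add[OF j'] by (simp_all add: add.commute)
    have "f (y', j' + 5 ^ n * blk n z) = transl (5 ^ n * blk n z) (f (y', j'))"
      using \<alpha>[of y' "j' + 5 ^ n * blk n z"] V by (simp add: acts_def *)
    then have "(f \<circ> g) (y, z) = transl (5 ^ n * blk n z) ((f \<circ> g) (y, pos n z))"
      by (simp add: V(2) g')
    moreover have "\<not> Lab m (blk n z)" for m using V(1) Lab_not_V by blast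
    ultimately show ?thesis using V(1) by (simp only: acts_def) simp
  next
    case (Lab m)
    have "f (g (y, z)) = (perm_power (label (n + m)) (\<alpha> (pos n z) + \<beta> (pos n z)) y, z)"
      using \<alpha>[of "perm_power (label (n + m)) (\<beta> (pos n z)) y" z] Lab
      by (simp add: acts_def perm_power_add_apply[OF bij_label])
    moreover have "m' = m" if "Lab m' (blk n z)" for m' using Lab_unique[OF that Lab(2)] .
    ultimately show ?thesis using Lab(1,2) unfolding acts_def by (metis comp_apply)
  next
    case other
    then show ?thesis using \<alpha>[of y z] by (auto simp: acts_def)
  qed
  moreover have "\<exists>u\<in>lamp_group. finite {y. (f \<circ> g) (y, j) \<noteq> (u y, j)}" if j: "blk n j = 0" for j
  proof -
    obtain u v where u: "u \<in> lamp_group" "finite {y. f (y, j) \<noteq> (u y, j)}" and v: "v \<in> lamp_group" "finite {y. g (y, j) \<noteq> (v y, j)}"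
      using level_D(4)[OF f j] level_D(4)[OF g j] by blast
    \<comment> \<open>The composition deviates from \<open>u \<circ> v\<close> only where
      \<open>g\<close> deviates from \<open>v\<close>, or where \<open>f\<close> deviates from
      \<open>u\<close> at \<open>v y\<close>; the latter set is finite as \<open>v\<close> is
      injective.\<close>
    have "{y. (f \<circ> g) (y, j) \<noteq> ((u \<circ> v) y, j)} \<subseteq> {y. g (y, j) \<noteq> (v y, j)} \<union> v -` {y. f (y, j) \<noteq> (u y, j)}"
      by auto
    moreover have "inj v" using perm_groupD(2)[OF perm_group_lamp_group v(1)] by (simp add: bij_is_inj)
    ultimately have "finite {y. (f \<circ> g) (y, j) \<noteq> ((u \<circ> v) y, j)}"
      using finite_subset finite_UnI[OF v(2) finite_vimageI[OF u(2)]] by blast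
    then show ?thesis using perm_groupD(4)[OF perm_group_lamp_group u(1) v(1)] by blast
  qed
  moreover have "blk n (snd ((f \<circ> g) (y, j))) = 0" if "blk n j = 0" for y j
    using level_blk[OF f, of "fst (g (y, j))" "snd (g (y, j))"] level_blk[OF g, of y j] that by simp
  ultimately show ?thesis using level_D(1)[OF f] level_D(1)[OF g] bij_comp by (intro level_I) blast+
qed

lemma level_inv:
  assumes g: "g \<in> level n"
  shows "inv_into UNIV g \<in> level n"
proof -
  let ?h = "inv_into UNIV g"
  obtain \<alpha> where \<alpha>: "\<And>y z. acts n g \<alpha> y z" using level_D(2)[OF g] by metis
  have bij: "bij g" by (rule level_D(1)[OF g])
  have hg: "?h (g w) = w" and gh: "g (?h w) = w" for w
    using bij by (simp_all add: bij_is_inj bij_is_surj surj_f_inv_f)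
  have hI: "?h w = w'" if "g w' = w" for w w' using hg that by metis
  have h_blk: "blk n (snd (?h (y, z))) = blk n z" for y z
    using level_blk[OF g, of "fst (?h (y, z))" "snd (?h (y, z))"] by (simp add: gh)
  have "acts n ?h (\<lambda>j. - \<alpha> j) y z" for y z
    unfolding acts_def
  proof (intro conjI impI allI)
    assume V: "blk n z \<in> V"
    obtain y' j' where h': "?h (y, pos n z) = (y', j')" by (metis surj_pair)
    then have j': "blk n j' = 0" using h_blk[of y "pos n z"] by simp
    have "g (y', j') = (y, pos n z)" using gh h' by metis
    moreover have "g (y', 5 ^ n * blk n z + j') = transl (5 ^ n * blk n z) (g (y', j'))"
      using \<alpha>[of y' "5 ^ n * blk n z + j'"] V by (simp add: acts_def blk_add[OF j'] pos_add[OF j'])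
    ultimately have "g (transl (5 ^ n * blk n z) (y', j')) = (y, z)" by (simp add: pos_def add.commute)
    then show "?h (y, z) = transl (5 ^ n * blk n z) (?h (y, pos n z))" unfolding h' by (rule hI)
  next
    fix m assume L: "Lab m (blk n z)"
    show "?h (y, z) = (perm_power (label (n + m)) (- \<alpha> (pos n z)) y, z)"
      using \<alpha>[of "perm_power (label (n + m)) (- \<alpha> (pos n z)) y" z] L
      by (intro hI) (simp add: acts_def perm_power_add_apply[OF bij_label] perm_power_0)
  next
    assume "blk n z \<notin> V" "\<forall>m. \<not> Lab m (blk n z)"
    then show "?h (y, z) = (y, z)" using \<alpha>[of y z] by (intro hI) (simp add: acts_def)
  qed
  moreover have "\<exists>u\<in>lamp_group. finite {y. ?h (y, j) \<noteq> (u y, j)}" if j: "blk n j = 0" for j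
  proof -
    obtain u where u: "u \<in> lamp_group" "finite {y. g (y, j) \<noteq> (u y, j)}" using level_D(4)[OF g j] by blast
    let ?v = "inv_into UNIV u"
    note P = perm_groupD[OF perm_group_lamp_group]
    have uv: "u (?v y) = y" for y using P(2)[OF u(1)] by (simp add: bij_is_surj surj_f_inv_f)
    have "{y. ?h (y, j) \<noteq> (?v y, j)} \<subseteq> ?v -` {y. g (y, j) \<noteq> (u y, j)}"
    proof (intro subsetI vimageI2 CollectI)
      fix y assume "y \<in> {y. ?h (y, j) \<noteq> (?v y, j)}"
      then show "g (?v y, j) \<noteq> (u (?v y), j)" using hI[of "(?v y, j)" "(y, j)"] by (auto simp only: uv)
    qed
    moreover have "inj ?v" using P(2)[OF P(3)[OF u(1)]] by (simp add: bij_is_inj)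
    ultimately have "finite {y. ?h (y, j) \<noteq> (?v y, j)}"
      using finite_subset finite_vimageI[OF u(2)] by blast
    then show ?thesis using P(3)[OF u(1)] by blast
  qed
  ultimately show ?thesis using bij_imp_bij_inv[OF bij] h_blk by (intro level_I) auto
qed

lemma perm_group_level: "perm_group (level n)"
proof (rule perm_groupI)
  have "acts n id (\<lambda>_. 0) y z" for y z by (auto simp: acts_def perm_power_0 pos_def)
  then show "id \<in> level n" using perm_groupD(1)[OF perm_group_lamp_group] by (intro level_I) (auto intro!: bexI[of _ id])
qed (use level_comp level_inv level_D(1) in blast)+

text \<open>By \<open>V_wide\<close> and \<open>Lab_wide\<close>, the type of the part
  \<open>5 * q + r\<close> depends on \<open>r\<close> and on the type of \<open>q\<close> only. So
  windows of one type at scale \<open>Suc n\<close> still look alike after the translation. A window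
  with label \<open>m\<close> acts in its part 0 alone, which has label \<open>Suc m\<close> at
  scale \<open>n\<close>; the index of \<open>label\<close> is
  \<open>n + Suc m = Suc n + m\<close>.\<close>

lemma level_step:
  assumes g: "g \<in> level n" and k: "\<bar>k\<bar> \<le> 1"
  shows "transl k \<circ> g \<circ> transl (-k) \<in> level (Suc n)"
proof -
  let ?g = "transl k \<circ> g \<circ> transl (-k)"
  obtain \<alpha> where \<alpha>: "\<And>y z. acts n g \<alpha> y z" using level_D(2)[OF g] by metis
  \<comment> \<open>The new exponents: those of the old scale in the part 0, and none elsewhere,
    because a labelled window is trivial outside that part.\<close>
  define \<beta> where "\<beta> j = (if blk n (j - k) = 0 then \<alpha> (pos n (j - k)) else 0)" for j
  have bij: "bij g" by (rule level_D(1)[OF g])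
  have g': "?g (y, z) = transl k (g (y, z - k))" for y z by simp
  have form: "?g (y, z) =
      (if 5 * q + r \<in> V then transl (k + 5 ^ n * (5 * q + r)) (g (y, pos n (z - k)))
       else if r = 2 \<and> q \<in> V then (perm_power (label n) (\<alpha> (pos n (z - k))) y, z)
       else if r = 0 \<and> (\<exists>m. Lab m q) then (perm_power (label (n + Suc (THE m. Lab m q))) (\<alpha> (pos n (z - k))) y, z)
       else (y, z))"
    if r: "blk n (z - k) = 5 * q + r" "-2 \<le> r" "r \<le> 4" for y z q r
    using \<alpha>[of y "z - k"]
  proof (cases rule: acts_cases)
    case V
    then show ?thesis by (simp add: r(1))
  next
    case (Lab m)
    then consider "r = 2" "m = 0" "q \<in> V" | m' where "r = 0" "m = Suc m'" "Lab m' q"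
      using Lab_wide[OF r(2,3)] r(1) by auto
    then show ?thesis
    proof cases
      case 2
      then have "(THE m. Lab m q) = m'" using Lab_unique by blast
      then show ?thesis using 2 Lab by (auto simp: r(1))
    qed (use Lab in \<open>auto simp: r(1)\<close>)
  next
    case other
    then have "\<not> (r = 2 \<and> q \<in> V)" "\<not> (r = 0 \<and> (\<exists>m. Lab m q))"
      using Lab_wide[OF r(2,3)] r(1) by metis+
    then show ?thesis using other unfolding g' r(1) by auto
  qed
  have "acts (Suc n) ?g \<beta> y z" for y z
  proof -
    let ?q = "blk (Suc n) z" and ?j = "pos (Suc n) z"
    obtain r where r: "blk n (z - k) = 5 * ?q + r" "-2 \<le> r" "r \<le> 4" using blk_near[OF HOL.refl k] by blast
    have j: "?j - k = (z - k) - 5 ^ n * (5 * ?q)" by (simp add: pos_def)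
    have rj: "blk n (?j - k) = 5 * 0 + r" "pos n (?j - k) = pos n (z - k)"
      unfolding j blk_shift using r(1) by simp_all
    note F = form[OF r, of y] form[OF rj(1) r(2,3), of y]
    show ?thesis
      unfolding acts_def
    proof (intro conjI impI allI)
      assume q: "?q \<in> V"
      have "5 * ?q + r \<in> V \<longleftrightarrow> 5 * 0 + r \<in> V"
        using q V.zero V_wide[OF r(2,3), of ?q] V_wide[OF r(2,3), of 0] by simp
      moreover have "\<not> Lab m ?q" "\<not> Lab m 0" for m using q V.zero Lab_not_V by blast+
      moreover have "z = ?j + 5 ^ Suc n * ?q" by (simp add: pos_def)
      ultimately show "?g (y, z) = transl (5 ^ Suc n * ?q) (?g (y, ?j))"
        using q V.zero unfolding F rj(2) by (auto simp: algebra_simps)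
    next
      fix m assume L: "Lab m ?q"
      then have "?q \<notin> V" "(THE m. Lab m ?q) = m" using Lab_not_V Lab_unique by blast+
      then show "?g (y, z) = (perm_power (label (Suc n + m)) (\<beta> ?j) y, z)"
        using L V_wide[OF r(2,3), of ?q] unfolding F by (auto simp: \<beta>_def rj perm_power_0)
    next
      assume "?q \<notin> V" "\<forall>m. \<not> Lab m ?q"
      then show "?g (y, z) = (y, z)" using V_wide[OF r(2,3), of ?q] unfolding F by auto
    qed
  qed
  moreover have "blk (Suc n) (snd (?g (y, j))) = 0 \<and> (\<exists>u\<in>lamp_group. finite {y. ?g (y, j) \<noteq> (u y, j)})"
    if j: "blk (Suc n) j = 0" for y j
  proof -
    obtain r where r: "blk n (j - k) = 5 * 0 + r" "-2 \<le> r" "r \<le> 4" using blk_near[OF j k] by blast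
    note F = form[OF r]
    show ?thesis
    proof (cases "5 * 0 + r \<in> V")
      case True
      then have r01: "0 \<le> r" "r \<le> 1" using V_wide[OF r(2,3), of 0] by auto
      have "blk (Suc n) (snd (g (y, j - k)) + k) = 0"
        using level_blk[OF g, of y "j - k"] r(1) r01 k by (intro blk_Suc_near[of _ _ 0 r]) auto
      moreover obtain u where u: "u \<in> lamp_group" "finite {y. g (y, pos n (j - k)) \<noteq> (u y, pos n (j - k))}"
        using level_D(4)[OF g blk_pos] by blast
      have "j = pos n (j - k) + (k + 5 ^ n * r)" using r(1) by (simp add: pos_def)
      then have "{y. ?g (y, j) \<noteq> (u y, j)} \<subseteq> {y. g (y, pos n (j - k)) \<noteq> (u y, pos n (j - k))}"
        using True unfolding F by auto
      ultimately show ?thesis using u finite_subset by (auto simp: g')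
    next
      case False
      have "\<not> Lab m 0" for m using V.zero Lab_not_V by blast
      \<comment> \<open>Part 2 of window 0 has label 0 at scale \<open>n\<close>. What was an
        abelian contribution becomes part of the repeated window, with a power of
        \<open>label n\<close> as its germ.\<close>
      then have "?g (y, j) = ((if r = 2 then perm_power (label n) (\<alpha> (pos n (j - k))) else id) y, j)" for y
        using False V.zero unfolding F by simp
      moreover have "(if r = 2 then perm_power (label n) (\<alpha> (pos n (j - k))) else id) \<in> lamp_group"
        using perm_power_closed[OF perm_group_lamp_group label_lamp_group] perm_groupD(1)[OF perm_group_lamp_group] by simp
      ultimately have "\<exists>u\<in>lamp_group. \<forall>y. ?g (y, j) = (u y, j)" by blast
      then obtain u where "u \<in> lamp_group" "\<And>y. ?g (y, j) = (u y, j)" by blast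
      then show ?thesis using j by (auto intro!: bexI[of _ u])
    qed
  qed
  ultimately show ?thesis using bij bij_transl by (intro level_I bij_comp) blast+
qed

end

locale pattern_in_class = pattern HH e + free_perms_in_class HH C for HH e C
begin

text \<open>Being trivial on window 0 means being trivial on all windows indexed by
  \<open>V\<close>. On a labelled fibre both maps are powers of the same \<open>label\<close>, so
  they commute.\<close>

lemma level_trivial_window_commute:
  assumes f: "f \<in> level n" and g: "g \<in> level n"
    and f0: "\<And>w. blk n (snd w) = 0 \<Longrightarrow> f w = w" and g0: "\<And>w. blk n (snd w) = 0 \<Longrightarrow> g w = w"
  shows "f \<circ> g = g \<circ> f"
proof
  fix w :: point
  obtain y z where w: "w = (y, z)" by (metis surj_pair)
  obtain \<alpha> where \<alpha>: "\<And>y z. acts n f \<alpha> y z" using level_D(2)[OF f] by metis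
  obtain \<beta> where \<beta>: "\<And>y z. acts n g \<beta> y z" using level_D(2)[OF g] by metis
  have zz: "pos n z + 5 ^ n * blk n z = z" for z by (simp add: pos_def)
  have fV: "f (y, z) = (y, z)" and gV: "g (y, z) = (y, z)" if "blk n z \<in> V" for y z
    using \<alpha>[of y z] \<beta>[of y z] f0[of "(y, pos n z)"] g0[of "(y, pos n z)"] that
    by (simp_all add: acts_def zz)
  consider "blk n z \<in> V" | m where "Lab m (blk n z)" | "blk n z \<notin> V" "\<And>m. \<not> Lab m (blk n z)" by blast
  then show "(f \<circ> g) w = (g \<circ> f) w"
  proof cases
    case 1
    then show ?thesis by (simp add: w fV gV)
  next
    case (2 m)
    have "f (y, z) = (perm_power (label (n + m)) (\<alpha> (pos n z)) y, z)" "g (y, z) = (perm_power (label (n + m)) (\<beta> (pos n z)) y, z)" for y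
      using \<alpha>[of y z] \<beta>[of y z] 2 by (simp_all add: acts_def)
    then show ?thesis by (simp add: w perm_power_add_apply[OF bij_label] add.commute)
  next
    case 3
    then show ?thesis using \<alpha>[of y z] \<beta>[of y z] by (simp add: w acts_def)
  qed
qed

text \<open>Restriction to the finite set \<open>F\<close> is a homomorphism to a finite symmetric
  group. Its kernel fixes window 0 pointwise and is abelian by
  \<open>level_trivial_window_commute\<close>.\<close>

lemma level_finitary_in_class:
  assumes F: "finite F" "F \<subseteq> {w. blk n (snd w) = 0}"
  defines "A \<equiv> {g \<in> level n. \<forall>w. blk n (snd w) = 0 \<longrightarrow> w \<notin> F \<longrightarrow> g w = w}"
  shows "perm_in_class A"
proof -
  note P = perm_groupD[OF perm_group_level[of n]]
  have A_level: "g \<in> level n" and A_fix: "blk n (snd w) = 0 \<Longrightarrow> w \<notin> F \<Longrightarrow> g w = w" if "g \<in> A" for g w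
    using that unfolding A_def by blast+
  have A: "perm_group A"
  proof (rule perm_groupI)
    show "id \<in> A" using P(1) by (simp add: A_def)
    fix g assume g: "g \<in> A"
    show bij: "bij g" using P(2) A_level[OF g] by blast
    have "inv_into UNIV g w = w" if "blk n (snd w) = 0" "w \<notin> F" for w
      using A_fix[OF g that] bij_is_inj[OF bij] by (intro inv_f_eq)
    then show "inv_into UNIV g \<in> A" using P(3) A_level[OF g] by (simp add: A_def)
    fix h assume h: "h \<in> A"
    show "g \<circ> h \<in> A" using P(4)[OF A_level[OF g] A_level[OF h]] A_fix[OF g] A_fix[OF h] by (simp add: A_def)
  qed
  \<comment> \<open>The rest of the window is fixed pointwise, so an injective map that preserves
    the window cannot send a point of \<open>F\<close> there.\<close>
  have AF: "g w \<in> F" if g: "g \<in> A" and w: "w \<in> F" for g w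
  proof (rule ccontr)
    assume n: "g w \<notin> F"
    have "blk n (snd w) = 0" using w F by auto
    then have "blk n (snd (g w)) = 0" using level_blk[OF A_level[OF g], of "fst w" "snd w"] by simp
    then have "g (g w) = g w" using A_fix[OF g _ n] by simp
    then have "g w = w" using bij_is_inj[OF P(2)[OF A_level[OF g]]] by (simp add: inj_eq)
    then show False using w n by simp
  qed
  let ?S = "{\<sigma>. \<sigma> permutes F}"
  have S: "perm_group ?S"
    by (intro perm_groupI) (auto simp: permutes_id permutes_bij permutes_inv permutes_compose)
  show ?thesis
  proof (rule perm_in_class_extension[OF A, where Q = "perm_monoid ?S" and R = "\<lambda>g \<sigma>. \<forall>w\<in>F. g w = \<sigma> w"])
    show "locally_in_class (perm_monoid ?S)"
      using S F(1) by (intro locally_in_class_finite group_perm_monoid) (auto intro: finite_permutations)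
  next
    fix g assume g: "g \<in> A"
    let ?\<sigma> = "\<lambda>w. if w \<in> F then g w else w"
    have "inj_on g F" using bij_is_inj[OF P(2)[OF A_level[OF g]]] by (rule inj_on_subset) simp
    moreover have "g ` F \<subseteq> F" using AF[OF g] by auto
    ultimately have "bij_betw g F F" using F(1) by (simp add: bij_betw_def endo_inj_surj)
    then have "?\<sigma> permutes F"
      by (intro bij_imp_permutes) (auto cong: bij_betw_cong)
    then show "\<exists>q\<in>carrier (perm_monoid ?S). \<forall>w\<in>F. g w = q w" by (intro bexI[of _ ?\<sigma>]) auto
  next
    fix f g p q assume "f \<in> A" "g \<in> A" "\<forall>w\<in>F. f w = p w" "\<forall>w\<in>F. g w = q w"
    then show "\<forall>w\<in>F. (f \<circ> g) w = (p \<otimes>\<^bsub>perm_monoid ?S\<^esub> q) w" using AF by (metis comp_apply perm_monoid_simps(2))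
  next
    fix f p q assume "p \<in> carrier (perm_monoid ?S)" "q \<in> carrier (perm_monoid ?S)" "\<forall>w\<in>F. f w = p w" "\<forall>w\<in>F. f w = q w"
    then have "p w = q w" for w by (cases "w \<in> F") (auto simp: permutes_not_in)
    then show "p = q" by blast
  next
    let ?K = "{f \<in> A. \<forall>w\<in>F. f w = \<one>\<^bsub>perm_monoid ?S\<^esub> w}"
    assume K: "perm_group ?K"
    have K_level: "f \<in> level n" and K_fix: "blk n (snd w) = 0 \<Longrightarrow> f w = w" if f: "f \<in> ?K" for f w
    proof -
      have fA: "f \<in> A" "\<And>w. w \<in> F \<Longrightarrow> f w = w" using f by simp_all
      then show "f \<in> level n" using A_level by blast
      show "blk n (snd w) = 0 \<Longrightarrow> f w = w" using fA A_fix by (cases "w \<in> F") auto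
    qed
    show "perm_in_class ?K"
    proof (rule perm_in_class_abelian[OF K])
      fix f g assume f: "f \<in> ?K" and g: "g \<in> ?K"
      show "f \<circ> g = g \<circ> f"
        by (rule level_trivial_window_commute[OF K_level[OF f] K_level[OF g] K_fix[OF f] K_fix[OF g]])
    qed
  qed
qed

text \<open>The germs on the fibres of window 0 are well defined by \<open>lamp_group_germ\<close>
  and have values in \<open>lamp_group\<close>. An element with trivial germs moves only a finite
  set \<open>F\<close> of points of the window, so the kernel is the directed union of the groups in
  \<open>level_finitary_in_class\<close>.\<close>

lemma level_in_class: "perm_in_class (level n)"
proof (rule perm_in_class_extension_family[where I = "{j. blk n j = 0}" and Q = "perm_monoid lamp_group"
      and R = "\<lambda>j g u. finite {y. g (y, j) \<noteq> (u y, j)}"])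
  show "finite {j. blk n j = 0}" by (rule finite_blk0)
  show "perm_group (level n)" by (rule perm_group_level)
  show "locally_in_class (perm_monoid lamp_group)" using lamp_group_in_class by (simp add: perm_in_class_def)
next
  fix j f assume "j \<in> {j. blk n j = 0}" "f \<in> level n"
  then show "\<exists>u\<in>carrier (perm_monoid lamp_group). finite {y. f (y, j) \<noteq> (u y, j)}" using level_D(4) by auto
next
  fix j f g u v
  assume *: "u \<in> carrier (perm_monoid lamp_group)" "v \<in> carrier (perm_monoid lamp_group)"
    "finite {y. f (y, j) \<noteq> (u y, j)}" "finite {y. g (y, j) \<noteq> (v y, j)}"
  have "{y. (f \<circ> g) (y, j) \<noteq> ((u \<circ> v) y, j)} \<subseteq> {y. g (y, j) \<noteq> (v y, j)} \<union> v -` {y. f (y, j) \<noteq> (u y, j)}"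
    by auto
  moreover have "inj v" using perm_groupD(2)[OF perm_group_lamp_group] * by (simp add: bij_is_inj)
  ultimately show "finite {y. (f \<circ> g) (y, j) \<noteq> ((u \<otimes>\<^bsub>perm_monoid lamp_group\<^esub> v) y, j)}"
    unfolding perm_monoid_simps using finite_subset finite_UnI[OF *(4) finite_vimageI[OF *(3)]] by blast
next
  fix j f u v
  assume *: "u \<in> carrier (perm_monoid lamp_group)" "v \<in> carrier (perm_monoid lamp_group)"
    "finite {y. f (y, j) \<noteq> (u y, j)}" "finite {y. f (y, j) \<noteq> (v y, j)}"
  have "{y. u y \<noteq> v y} \<subseteq> {y. f (y, j) \<noteq> (u y, j)} \<union> {y. f (y, j) \<noteq> (v y, j)}" by auto
  then have "finite {y. u y \<noteq> v y}" using * finite_subset finite_UnI by blast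
  then show "u = v" using lamp_group_germ * by simp
next
  let ?K = "{f \<in> level n. \<forall>j\<in>{j. blk n j = 0}. finite {y. f (y, j) \<noteq> (\<one>\<^bsub>perm_monoid lamp_group\<^esub> y, j)}}"
  let ?W = "{w::point. blk n (snd w) = 0}"
  let ?A = "\<lambda>F. {g \<in> level n. \<forall>w. blk n (snd w) = 0 \<longrightarrow> w \<notin> F \<longrightarrow> g w = w}"
  assume K: "perm_group ?K"
  show "perm_in_class ?K"
  proof (rule perm_in_class_union[OF K, where \<K> = "?A ` {F. finite F \<and> F \<subseteq> ?W}"])
    show "?A ` {F. finite F \<and> F \<subseteq> ?W} \<noteq> {}" by auto
  next
    fix B assume "B \<in> ?A ` {F. finite F \<and> F \<subseteq> ?W}"
    then show "perm_in_class B" using level_finitary_in_class by blast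
  next
    fix B B' assume "B \<in> ?A ` {F. finite F \<and> F \<subseteq> ?W}" "B' \<in> ?A ` {F. finite F \<and> F \<subseteq> ?W}"
    then obtain F F' where F: "finite F" "F \<subseteq> ?W" "finite F'" "F' \<subseteq> ?W" "B = ?A F" "B' = ?A F'" by blast
    show "\<exists>M\<in>?A ` {F. finite F \<and> F \<subseteq> ?W}. B \<union> B' \<subseteq> M"
    proof (rule bexI)
      show "B \<union> B' \<subseteq> ?A (F \<union> F')" unfolding F(5,6) by blast
      show "?A (F \<union> F') \<in> ?A ` {F. finite F \<and> F \<subseteq> ?W}" using F(1-4) by blast
    qed
  next
    show "\<Union> (?A ` {F. finite F \<and> F \<subseteq> ?W}) = ?K"
    proof (intro equalityI subsetI)
      fix g assume "g \<in> \<Union> (?A ` {F. finite F \<and> F \<subseteq> ?W})"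
      then obtain F where F: "finite F" "g \<in> level n" and fix_g: "\<And>w. blk n (snd w) = 0 \<Longrightarrow> w \<notin> F \<Longrightarrow> g w = w" by blast
      have "finite {y. g (y, j) \<noteq> (y, j)}" if "blk n j = 0" for j
      proof (rule finite_subset)
        show "{y. g (y, j) \<noteq> (y, j)} \<subseteq> fst ` F"
        proof
          fix y assume "y \<in> {y. g (y, j) \<noteq> (y, j)}"
          then have "(y, j) \<in> F" using fix_g[of "(y, j)"] that by auto
          then show "y \<in> fst ` F" by force
        qed
      qed (use F in simp)
      then show "g \<in> ?K" using F by simp
    next
      fix g assume "g \<in> ?K"
      then have g: "g \<in> level n" and fin: "\<And>j. blk n j = 0 \<Longrightarrow> finite {y. g (y, j) \<noteq> (y, j)}" by simp_all
      let ?F = "{w. blk n (snd w) = 0 \<and> g w \<noteq> w}"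
      have "?F \<subseteq> (\<Union>j\<in>{j. blk n j = 0}. (\<lambda>y. (y, j)) ` {y. g (y, j) \<noteq> (y, j)})" by force
      moreover have "finite (\<Union>j\<in>{j. blk n j = 0}. (\<lambda>y. (y, j)) ` {y. g (y, j) \<noteq> (y, j)})"
        using fin finite_blk0 by (intro finite_UN_I) auto
      ultimately have "finite ?F" using finite_subset by blast
      then show "g \<in> \<Union> (?A ` {F. finite F \<and> F \<subseteq> ?W})" using g by (intro UN_I[of ?F]) auto
    qed
  qed
qed

end

section \<open>The union of all scales, translations and infinite supports\<close>

context pattern
begin

definition levels :: "(point \<Rightarrow> point) set" where "levels = (\<Union>n. level n)"

lemma level_mono: "n \<le> m \<Longrightarrow> level n \<subseteq> level m"
proof (induction rule: dec_induct)
  case (step k)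
  moreover have "g \<in> level (Suc k)" if "g \<in> level k" for g
    using level_step[OF that, of 0] by (simp add: transl_0)
  ultimately show ?case by blast
qed simp

lemma levels_pair:
  assumes "f \<in> levels" "g \<in> levels"
  obtains n where "f \<in> level n" "g \<in> level n"
proof -
  obtain n m where "f \<in> level n" "g \<in> level m" using assms by (auto simp: levels_def)
  then show ?thesis using that[of "max n m"] level_mono[of n "max n m"] level_mono[of m "max n m"] by auto
qed

lemma perm_group_levels: "perm_group levels"
proof (rule perm_groupI)
  show "id \<in> levels" using perm_groupD(1)[OF perm_group_level] by (auto simp: levels_def)
next
  fix f assume "f \<in> levels"
  then show "bij f" "inv_into UNIV f \<in> levels" using perm_groupD(2,3)[OF perm_group_level] unfolding levels_def by blast+
next
  fix f g assume "f \<in> levels" "g \<in> levels"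
  then obtain n where "f \<in> level n" "g \<in> level n" by (rule levels_pair)
  then show "f \<circ> g \<in> levels" using perm_groupD(4)[OF perm_group_level] unfolding levels_def by blast
qed

lemma levels_conj_step: "g \<in> levels \<Longrightarrow> \<bar>k\<bar> \<le> 1 \<Longrightarrow> transl k \<circ> g \<circ> transl (-k) \<in> levels"
  using level_step unfolding levels_def by blast

lemma levels_conj:
  assumes "g \<in> levels"
  shows "transl k \<circ> g \<circ> transl (-k) \<in> levels"
proof (induction k rule: int_induct[where k = 0])
  case base
  then show ?case using assms by (simp add: transl_0)
next
  case (step1 i)
  have "transl 1 \<circ> (transl i \<circ> g \<circ> transl (-i)) \<circ> transl (-1) = transl (i + 1) \<circ> g \<circ> transl (-(i + 1))"
    by (auto simp: fun_eq_iff algebra_simps)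
  moreover have "transl 1 \<circ> (transl i \<circ> g \<circ> transl (-i)) \<circ> transl (-1) \<in> levels" by (rule levels_conj_step[OF step1(2)]) simp
  ultimately show ?case by (simp only:)
next
  case (step2 i)
  have "transl (-1) \<circ> (transl i \<circ> g \<circ> transl (-i)) \<circ> transl 1 = transl (i - 1) \<circ> g \<circ> transl (-(i - 1))"
    by (auto simp: fun_eq_iff algebra_simps)
  moreover have "transl (-1) \<circ> (transl i \<circ> g \<circ> transl (-i)) \<circ> transl (-(-1)) \<in> levels" by (rule levels_conj_step[OF step2(2)]) simp
  ultimately show ?case by (simp only: minus_minus)
qed

text \<open>The semidirect product of \<open>levels\<close> with the translations. It contains all
  generators, and its structure is visible, in contrast to that of the group they generate.\<close>

definition envelope :: "(point \<Rightarrow> point) set" where "envelope = {transl k \<circ> g | k g. g \<in> levels}"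

lemma transl_mult:
  assumes "g \<in> levels" "h \<in> levels"
  shows "\<exists>g'\<in>levels. (transl k \<circ> g) \<circ> (transl l \<circ> h) = transl (k + l) \<circ> g'"
proof
  show "(transl (-l) \<circ> g \<circ> transl (-(-l))) \<circ> h \<in> levels"
    using levels_conj[OF assms(1), of "-l"] assms(2) perm_groupD(4)[OF perm_group_levels] by blast
  show "(transl k \<circ> g) \<circ> (transl l \<circ> h) = transl (k + l) \<circ> ((transl (-l) \<circ> g \<circ> transl (-(-l))) \<circ> h)"
    by (auto simp: fun_eq_iff algebra_simps)
qed

lemma perm_group_envelope: "perm_group envelope"
proof (rule perm_groupI)
  have "id = transl 0 \<circ> id" by (simp add: transl_0)
  then show "id \<in> envelope" using perm_groupD(1)[OF perm_group_levels] unfolding envelope_def by blast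
next
  fix f assume "f \<in> envelope"
  then obtain k g where f: "f = transl k \<circ> g" and g: "g \<in> levels" by (auto simp: envelope_def)
  note P = perm_groupD[OF perm_group_levels]
  show "bij f" unfolding f using P(2)[OF g] bij_transl by (intro bij_comp)
  have "inv_into UNIV f = inv_into UNIV g \<circ> transl (-k)"
    unfolding f by (simp add: o_inv_distrib P(2)[OF g] bij_transl inv_transl)
  also have "\<dots> = (transl 0 \<circ> inv_into UNIV g) \<circ> (transl (-k) \<circ> id)" by (simp add: transl_0)
  finally show "inv_into UNIV f \<in> envelope"
    using transl_mult[OF P(3)[OF g] P(1), of 0 "-k"] by (auto simp: envelope_def)
next
  fix f f' assume "f \<in> envelope" "f' \<in> envelope"
  then obtain k g l h where f: "f = transl k \<circ> g" "f' = transl l \<circ> h" and g: "g \<in> levels" "h \<in> levels"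
    unfolding envelope_def by blast
  then show "f \<circ> f' \<in> envelope" using transl_mult[OF g, of k l] unfolding envelope_def f by blast
qed

lemma levels_germ: "g \<in> levels \<Longrightarrow> \<exists>u\<in>lamp_group. finite {y. g (y, 0) \<noteq> (u y, 0)}"
proof -
  have "blk n 0 = 0" for n by (simp add: blk_iff margin_nonneg)
  then show "g \<in> levels \<Longrightarrow> \<exists>u\<in>lamp_group. finite {y. g (y, 0) \<noteq> (u y, 0)}" using level_D(4) unfolding levels_def by blast
qed

lemma infinite_fibre: "infinite (UNIV :: fibre set)"
  using infinite_UNIV_int finite_prod by blast

text \<open>Up to finitely many points, \<open>g\<close> maps the fibre at 0 into itself, so the
  translation that follows moves almost all of it.\<close>

lemma infinite_support_transl:
  assumes "g \<in> levels" "k \<noteq> 0"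
  shows "infinite {w. (transl k \<circ> g) w \<noteq> w}"
proof
  obtain u where u: "u \<in> lamp_group" "finite {y. g (y, 0) \<noteq> (u y, 0)}" using levels_germ[OF assms(1)] by blast
  assume fin: "finite {w. (transl k \<circ> g) w \<noteq> w}"
  have "UNIV \<subseteq> {y. g (y, 0) \<noteq> (u y, 0)} \<union> fst ` {w. (transl k \<circ> g) w \<noteq> w}"
  proof
    fix y :: fibre
    show "y \<in> {y. g (y, 0) \<noteq> (u y, 0)} \<union> fst ` {w. (transl k \<circ> g) w \<noteq> w}"
    proof (cases "g (y, 0) = (u y, 0)")
      case True
      then have "(transl k \<circ> g) (y, 0) \<noteq> (y, 0)" using assms(2) by simp
      then have "y \<in> fst ` {w. (transl k \<circ> g) w \<noteq> w}" by (intro image_eqI[of _ _ "(y, 0)"]) auto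
      then show ?thesis by simp
    qed simp
  qed
  then have "finite (UNIV :: fibre set)" by (rule finite_subset[OF _ finite_UnI[OF u(2) finite_imageI[OF fin]]])
  then show False using infinite_fibre by simp
qed

text \<open>A moved point recurs at the same position in every window of the same type, and both
  \<open>V\<close> and the set of integers with a given label are infinite.\<close>

lemma infinite_support_level:
  assumes "g \<in> level n" "g \<noteq> id"
  shows "infinite {w. g w \<noteq> w}"
proof -
  obtain \<alpha> where \<alpha>: "\<And>y z. acts n g \<alpha> y z" using level_D(2)[OF assms(1)] by metis
  obtain y z where w: "g (y, z) \<noteq> (y, z)" using assms(2) by (metis eq_id_iff surj_pair)
  let ?f = "\<lambda>q. (y, 5 ^ n * q + pos n z)"
  have f: "blk n (5 ^ n * q + pos n z) = q" "pos n (5 ^ n * q + pos n z) = pos n z" for q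
    by (rule blk_add pos_add, rule blk_pos)+
  have inj: "inj_on ?f A" for A by (auto simp: inj_on_def)
  have "\<exists>A. infinite A \<and> (\<forall>q\<in>A. g (?f q) \<noteq> ?f q)"
    using \<alpha>[of y z]
  proof (cases rule: acts_cases)
    case V
    have "g (?f q) \<noteq> ?f q" if "q \<in> V" for q
    proof -
      have "g (?f q) = transl (5 ^ n * q) (g (y, pos n z))"
        using \<alpha>[of y "5 ^ n * q + pos n z"] that by (simp add: acts_def f)
      moreover have "g (y, pos n z) \<noteq> (y, pos n z)" using V w by (auto simp: pos_def)
      ultimately show ?thesis
        by (cases "g (y, pos n z)") auto
    qed
    then show ?thesis using infinite_V by blast
  next
    case (Lab m)
    have "g (?f q) \<noteq> ?f q" if "Lab m q" for q
      using \<alpha>[of y "5 ^ n * q + pos n z"] that Lab(3) w by (simp add: acts_def f)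
    then show ?thesis using infinite_Lab[of m] by (intro exI[of _ "{z. Lab m z}"]) auto
  next
    case other
    then show ?thesis using w by simp
  qed
  then obtain A where A: "infinite A" "?f ` A \<subseteq> {w. g w \<noteq> w}" by auto
  then have "infinite (?f ` A)" using finite_imageD[OF _ inj] by blast
  then show ?thesis using A(2) finite_subset by blast
qed

lemma infinite_support_envelope:
  assumes "g \<in> envelope" "g \<noteq> id"
  shows "infinite {w. g w \<noteq> w}"
proof -
  obtain k h where g: "g = transl k \<circ> h" "h \<in> levels" using assms(1) by (auto simp: envelope_def)
  show ?thesis
  proof (cases "k = 0")
    case True
    then show ?thesis using g assms(2) infinite_support_level unfolding levels_def by (auto simp: transl_0)
  next
    case False
    then show ?thesis using infinite_support_transl[OF g(2)] g(1) by blast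
  qed
qed

lemma transl_unique:
  assumes "transl k \<circ> g = transl l \<circ> h" "g \<in> levels" "h \<in> levels"
  shows "k = l"
proof (rule ccontr)
  assume "k \<noteq> l"
  note P = perm_groupD[OF perm_group_levels]
  have "g = transl (-k) \<circ> (transl k \<circ> g)" by (auto simp: fun_eq_iff)
  also have "\<dots> = transl (l - k) \<circ> h" unfolding assms(1) by (auto simp: fun_eq_iff)
  finally have "transl (l - k) \<circ> (h \<circ> inv_into UNIV g) = g \<circ> inv_into UNIV g" by (simp add: comp_assoc)
  also have "\<dots> = id" using P(2)[OF assms(2)] by (simp add: bij_is_surj flip: surj_iff)
  finally have eq: "transl (l - k) \<circ> (h \<circ> inv_into UNIV g) = id" .
  have "finite {w. (transl (l - k) \<circ> (h \<circ> inv_into UNIV g)) w \<noteq> w}" unfolding eq by simp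
  moreover have "infinite {w. (transl (l - k) \<circ> (h \<circ> inv_into UNIV g)) w \<noteq> w}"
    using P(4)[OF assms(3) P(3)[OF assms(2)]] \<open>k \<noteq> l\<close> by (intro infinite_support_transl) auto
  ultimately show False by blast
qed

end

context pattern_in_class
begin

lemma levels_in_class: "perm_in_class levels"
proof (rule perm_in_class_union[OF perm_group_levels, where \<K> = "range level"])
  fix A B assume "A \<in> range level" "B \<in> range level"
  then obtain n m where "A = level n" "B = level m" by blast
  then have "A \<union> B \<subseteq> level (max n m)" using level_mono[of n "max n m"] level_mono[of m "max n m"] by simp
  then show "\<exists>M\<in>range level. A \<union> B \<subseteq> M" by blast
qed (use level_in_class in \<open>auto simp: levels_def\<close>)

lemma envelope_in_class: "perm_in_class envelope"
proof (rule perm_in_class_extension[OF perm_group_envelope, where Q = integer_group and R = "\<lambda>f k. \<exists>g\<in>levels. f = transl k \<circ> g"])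
  show "locally_in_class integer_group" by (intro locally_in_class_abelian abelian_integer_group)
next
  fix f assume "f \<in> envelope"
  then show "\<exists>k\<in>carrier integer_group. \<exists>g\<in>levels. f = transl k \<circ> g" by (auto simp: envelope_def)
next
  fix f g p q assume "\<exists>f'\<in>levels. f = transl p \<circ> f'" "\<exists>g'\<in>levels. g = transl q \<circ> g'"
  then show "\<exists>g'\<in>levels. f \<circ> g = transl (p \<otimes>\<^bsub>integer_group\<^esub> q) \<circ> g'"
    using transl_mult by (metis mult_integer_group)
next
  fix f p q assume "\<exists>g\<in>levels. f = transl p \<circ> g" "\<exists>g\<in>levels. f = transl q \<circ> g"
  then show "p = q" using transl_unique by blast
next
  have "{f \<in> envelope. \<exists>g\<in>levels. f = transl \<one>\<^bsub>integer_group\<^esub> \<circ> g} = levels"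
    by (auto simp: transl_0 envelope_def intro: exI[of _ 0])
  then show "perm_in_class {f \<in> envelope. \<exists>g\<in>levels. f = transl \<one>\<^bsub>integer_group\<^esub> \<circ> g}" using levels_in_class by simp
qed

end

section \<open>The finitely generated group\<close>

definition spread :: "nat \<Rightarrow> int set \<Rightarrow> (point \<Rightarrow> point) \<Rightarrow> point \<Rightarrow> point" where
  "spread n S \<sigma> = (\<lambda>(y, z). if blk n z \<in> S then transl (5 ^ n * blk n z) (\<sigma> (y, pos n z)) else (y, z))"

definition keeps :: "nat \<Rightarrow> (point \<Rightarrow> point) \<Rightarrow> bool" where
  "keeps n \<sigma> \<longleftrightarrow> (\<forall>y z. blk n z = 0 \<longrightarrow> blk n (snd (\<sigma> (y, z))) = 0)"

lemma spread_apply: "spread n S \<sigma> (y, z) = (if blk n z \<in> S then transl (5 ^ n * blk n z) (\<sigma> (y, pos n z)) else (y, z))"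
  by (simp add: spread_def)

lemma spread_transl:
  assumes "blk n (snd w) = 0"
  shows "spread n S \<sigma> (transl (5 ^ n * q) w) = transl (5 ^ n * q) (if q \<in> S then \<sigma> w else w)"
proof -
  obtain y j where w: "w = (y, j)" by (metis surj_pair)
  then have j: "blk n j = 0" using assms by simp
  have "blk n (j + 5 ^ n * q) = q" "pos n (j + 5 ^ n * q) = j"
    using blk_add[OF j, of q] pos_add[OF j, of q] by (simp_all add: add.commute)
  then show ?thesis by (simp add: w spread_apply)
qed

lemma point_cases:
  obtains q w where "p = transl (5 ^ n * q) w" "blk n (snd w) = 0"
proof -
  obtain y z where p: "p = (y, z)" by (metis surj_pair)
  have "p = transl (5 ^ n * blk n z) (y, pos n z)" by (simp add: p pos_def)
  then show ?thesis using that[of "blk n z" "(y, pos n z)"] by simp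
qed

lemma spread_comp:
  assumes "keeps n \<tau>"
  shows "spread n S \<sigma> \<circ> spread n S \<tau> = spread n S (\<sigma> \<circ> \<tau>)"
proof
  fix p
  obtain q w where p: "p = transl (5 ^ n * q) w" "blk n (snd w) = 0" by (rule point_cases)
  have "blk n (snd (\<tau> w)) = 0" using assms p(2) by (cases w) (auto simp: keeps_def)
  then show "(spread n S \<sigma> \<circ> spread n S \<tau>) p = spread n S (\<sigma> \<circ> \<tau>) p"
    by (simp add: p(1) spread_transl[OF p(2)] spread_transl)
qed

lemma spread_id: "spread n S id = id"
proof
  fix p
  obtain q w where p: "p = transl (5 ^ n * q) w" "blk n (snd w) = 0" by (rule point_cases)
  then show "spread n S id p = id p" by (simp add: spread_transl)
qed

lemma spread_inv:
  assumes "keeps n \<sigma>" "keeps n \<tau>" "\<sigma> \<circ> \<tau> = id" "\<tau> \<circ> \<sigma> = id"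
  shows "bij (spread n S \<sigma>)" "inv_into UNIV (spread n S \<sigma>) = spread n S \<tau>"
proof -
  have *: "spread n S \<sigma> \<circ> spread n S \<tau> = id" "spread n S \<tau> \<circ> spread n S \<sigma> = id"
    using assms by (simp_all add: spread_comp spread_id)
  then show "bij (spread n S \<sigma>)" by (metis o_bij)
  show "inv_into UNIV (spread n S \<sigma>) = spread n S \<tau>" using * by (intro inv_unique_comp)
qed

text \<open>In a window indexed by only one of the two sets, a permutation meets just its own
  inverse and cancels.\<close>

lemma spread_commutator:
  assumes k: "keeps n \<sigma>" "keeps n \<sigma>'" "keeps n \<tau>" "keeps n \<tau>'"
    and inv: "\<sigma> \<circ> \<sigma>' = id" "\<tau> \<circ> \<tau>' = id"
  shows "spread n S \<sigma> \<circ> spread n T \<tau> \<circ> spread n S \<sigma>' \<circ> spread n T \<tau>' = spread n (S \<inter> T) (\<sigma> \<circ> \<tau> \<circ> \<sigma>' \<circ> \<tau>')"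
proof
  fix p
  obtain q w where p: "p = transl (5 ^ n * q) w" "blk n (snd w) = 0" by (rule point_cases)
  have K: "blk n (snd (\<rho> w)) = 0" if "keeps n \<rho>" "blk n (snd w) = 0" for \<rho> w
    using that by (cases w) (auto simp: keeps_def)
  have i: "\<sigma> (\<sigma>' w) = w" "\<tau> (\<tau>' w) = w" for w using inv by (metis comp_apply id_apply)+
  show "(spread n S \<sigma> \<circ> spread n T \<tau> \<circ> spread n S \<sigma>' \<circ> spread n T \<tau>') p = spread n (S \<inter> T) (\<sigma> \<circ> \<tau> \<circ> \<sigma>' \<circ> \<tau>') p"
    using p(2) k by (cases "q \<in> S"; cases "q \<in> T") (simp_all add: p(1) spread_transl K i)
qed

definition base_pt :: "int \<Rightarrow> point" where "base_pt i = ((0, 0), i)"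

text \<open>One point in each fibre of window 0 at scale 1, which is the interval from -1 to
  3.\<close>

definition five_points :: "point set" where "five_points = base_pt ` {-1..3}"

lemma inj_base_pt: "base_pt i = base_pt j \<longleftrightarrow> i = j"
  by (simp add: base_pt_def)

lemma transl_base_pt: "transl k (base_pt i) = base_pt (i + k)"
  by (simp add: base_pt_def)

lemma finite_five_points: "finite five_points" and card_five_points: "card five_points = 5"
  by (auto simp: five_points_def card_image inj_on_def inj_base_pt)

lemma margin_ge: "int n \<le> margin n"
proof (induction n)
  case (Suc n)
  then show ?case using margin_nonneg[of n] by (simp add: margin_Suc)
qed (simp add: margin_def)

lemma five_points_blk:
  assumes "n \<ge> 1" "w \<in> five_points"
  shows "blk n (snd w) = 0"
  using assms margin_ge[of n] by (auto simp: five_points_def base_pt_def blk_iff)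

lemma keeps_five_points:
  assumes "n \<ge> 1" "\<sigma> permutes five_points"
  shows "keeps n \<sigma>"
  unfolding keeps_def
proof (intro allI impI)
  fix y z assume z: "blk n z = 0"
  show "blk n (snd (\<sigma> (y, z))) = 0"
  proof (cases "(y, z) \<in> five_points")
    case True
    then have "\<sigma> (y, z) \<in> five_points" using assms(2) by (simp add: permutes_in_image)
    then show ?thesis by (rule five_points_blk[OF assms(1)])
  next
    case False
    then show ?thesis using assms(2) z by (simp add: permutes_not_in)
  qed
qed

lemma permutes_five_points_inv:
  assumes "\<sigma> permutes five_points"
  shows "inv_into UNIV \<sigma> permutes five_points" "\<sigma> \<circ> inv_into UNIV \<sigma> = id" "inv_into UNIV \<sigma> \<circ> \<sigma> = id"
  using assms permutes_inv permutes_inv_o by blast+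

text \<open>By \<open>V_Int_shift\<close> the windows on the right are those of
  \<open>5 * v\<close>. Such a window at scale \<open>n\<close> and the window of \<open>v\<close>
  at scale \<open>Suc n\<close> have the same origin, and \<open>\<sigma>\<close> moves only points
  near it, which lie in both.\<close>

lemma spread_Suc:
  assumes n: "n \<ge> 1" and \<sigma>: "\<sigma> permutes five_points"
  shows "spread (Suc n) V \<sigma> = spread n (V \<inter> {q. q + 1 \<in> V}) \<sigma>"
proof
  fix p :: point
  obtain y z where p: "p = (y, z)" by (metis surj_pair)
  have eq: "blk (Suc n) z = v \<and> pos (Suc n) z = pos n z" if "blk n z = 5 * v" for v
  proof -
    have "blk (Suc n) (z + 0) = v" using that by (intro blk_Suc_near[of n z v 0]) auto
    then show ?thesis using that by (simp add: pos_def)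
  qed
  show "spread (Suc n) V \<sigma> p = spread n (V \<inter> {q. q + 1 \<in> V}) \<sigma> p"
  proof (cases "\<exists>v\<in>V. blk n z = 5 * v")
    case True
    then obtain v where v: "v \<in> V" "blk n z = 5 * v" by blast
    then have "blk n z \<in> V \<inter> {q. q + 1 \<in> V}" using V_Int_shift by auto
    then show ?thesis using eq[OF v(2)] v by (simp add: p spread_apply mult.left_commute mult.assoc)
  next
    case False
    then have 1: "blk n z \<notin> V \<inter> {q. q + 1 \<in> V}" using V_Int_shift by auto
    \<comment> \<open>A point of \<open>five_points\<close> relative to the larger window would lie
      in the smaller window of \<open>5 * blk (Suc n) z\<close>, contrary to the case.\<close>
    have "(y, pos (Suc n) z) \<notin> five_points" if "blk (Suc n) z \<in> V"
    proof
      assume "(y, pos (Suc n) z) \<in> five_points"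
      then have "blk n (pos (Suc n) z) = 0" using five_points_blk[OF n] by fastforce
      then have "blk n (5 ^ n * (5 * blk (Suc n) z) + pos (Suc n) z) = 5 * blk (Suc n) z" by (rule blk_add)
      moreover have "5 ^ n * (5 * blk (Suc n) z) + pos (Suc n) z = z" by (simp add: pos_def)
      ultimately show False using that False by auto
    qed
    then show ?thesis using 1 \<sigma> by (auto simp: p spread_apply permutes_not_in pos_def)
  qed
qed

section \<open>Three-cycles, generated groups and pointwise closures\<close>

definition cyc :: "'b \<Rightarrow> 'b \<Rightarrow> 'b \<Rightarrow> 'b \<Rightarrow> 'b" where
  "cyc a b c w = (if w = a then b else if w = b then c else if w = c then a else w)"

lemma cyc_eq_transpose: "distinct [a, b, c] \<Longrightarrow> cyc a b c = Transposition.transpose a b \<circ> Transposition.transpose b c"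
  by (auto simp: cyc_def transpose_def)

lemma cyc_permutes: "distinct [a, b, c] \<Longrightarrow> {a, b, c} \<subseteq> A \<Longrightarrow> cyc a b c permutes A"
  by (simp add: cyc_eq_transpose permutes_compose permutes_swap_id)

lemma cyc_inv: "distinct [a, b, c] \<Longrightarrow> cyc a b c \<circ> cyc c b a = id"
  by (auto simp: cyc_def)

text \<open>The two 3-cycles share the point \<open>a\<close> only. Among the permutations of five
  points every 3-cycle is thus a commutator of 3-cycles, so taking commutators can be repeated at
  every scale.\<close>

lemma cyc_commutator:
  assumes "distinct [a, b, c, d, f]"
  shows "cyc a b d \<circ> cyc a c f \<circ> cyc d b a \<circ> cyc f c a = cyc a b c"
proof
  fix w
  have ne: "a \<noteq> b" "a \<noteq> c" "a \<noteq> d" "a \<noteq> f" "b \<noteq> c" "b \<noteq> d" "b \<noteq> f" "c \<noteq> d" "c \<noteq> f" "d \<noteq> f"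
    using assms by auto
  note ne = ne ne[symmetric]
  consider "w = a" | "w = b" | "w = c" | "w = d" | "w = f" | "w \<notin> {a, b, c, d, f}" by blast
  then show "(cyc a b d \<circ> cyc a c f \<circ> cyc d b a \<circ> cyc f c a) w = cyc a b c w"
    by cases (simp_all add: cyc_def ne)
qed

lemma conj_cyc: "bij g \<Longrightarrow> g \<circ> cyc a b c \<circ> inv_into UNIV g = cyc (g a) (g b) (g c)"
  by (auto simp: cyc_def fun_eq_iff bij_is_inj bij_is_surj surj_f_inv_f inv_f_eq)

lemma conj_transpose: "bij g \<Longrightarrow> g \<circ> Transposition.transpose a b \<circ> inv_into UNIV g = Transposition.transpose (g a) (g b)"
  by (auto simp: transpose_def fun_eq_iff bij_is_inj bij_is_surj surj_f_inv_f inv_f_eq)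

lemma perm_group_generate:
  assumes "\<And>f. f \<in> S \<Longrightarrow> bij f"
  shows "perm_group (generate (perm_monoid {f. bij f}) S)" "S \<subseteq> generate (perm_monoid {f. bij f}) S"
    "perm_group A \<Longrightarrow> S \<subseteq> A \<Longrightarrow> generate (perm_monoid {f. bij f}) S \<subseteq> A"
proof -
  interpret group "perm_monoid {f::'a \<Rightarrow> 'a. bij f}" by (rule group_perm_monoid[OF perm_group_bij])
  have S: "S \<subseteq> carrier (perm_monoid {f. bij f})" using assms by auto
  show "perm_group (generate (perm_monoid {f. bij f}) S)"
    by (rule subgroup_perm_monoid_perm_group[OF perm_group_bij generate_is_subgroup[OF S]])
  show "S \<subseteq> generate (perm_monoid {f. bij f}) S" by (auto intro: generate.incl)
  assume A: "perm_group A" "S \<subseteq> A"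
  show "generate (perm_monoid {f. bij f}) S \<subseteq> A"
    by (rule generate_subgroup_incl[OF A(2) subgroup_perm_monoid[OF perm_group_bij A(1)]]) (use perm_groupD(2)[OF A(1)] in auto)
qed

text \<open>The closure of \<open>A\<close> in the group of all permutations, for pointwise
  convergence. Transitivity on finite tuples is the same for \<open>A\<close> and its
  closure.\<close>

definition closure_perm :: "('b \<Rightarrow> 'b) set \<Rightarrow> ('b \<Rightarrow> 'b) set" where
  "closure_perm A = {\<sigma>. bij \<sigma> \<and> (\<forall>F. finite F \<longrightarrow> (\<exists>g\<in>A. \<forall>w\<in>F. g w = \<sigma> w))}"

lemma closure_permD: "\<sigma> \<in> closure_perm A \<Longrightarrow> finite F \<Longrightarrow> \<exists>g\<in>A. \<forall>w\<in>F. g w = \<sigma> w"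
  unfolding closure_perm_def by blast

lemma closure_perm_incl: "perm_group A \<Longrightarrow> A \<subseteq> closure_perm A"
  by (auto simp: closure_perm_def perm_groupD)

lemma perm_group_closure:
  assumes "perm_group A"
  shows "perm_group (closure_perm A)"
proof (rule perm_groupI)
  note P = perm_groupD[OF assms]
  show "id \<in> closure_perm A" using closure_perm_incl[OF assms] P(1) by blast
  fix \<sigma> assume \<sigma>: "\<sigma> \<in> closure_perm A"
  then show bij: "bij \<sigma>" by (simp add: closure_perm_def)
  have "\<exists>g\<in>A. \<forall>w\<in>F. g w = inv_into UNIV \<sigma> w" if F: "finite F" for F
  proof -
    obtain g where g: "g \<in> A" "\<forall>w\<in>inv_into UNIV \<sigma> ` F. g w = \<sigma> w"
      using closure_permD[OF \<sigma> finite_imageI[OF F]] by blast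
    have "inv_into UNIV g w = inv_into UNIV \<sigma> w" if "w \<in> F" for w
      using bspec[OF g(2) imageI[OF that]] bij P(2)[OF g(1)]
      by (intro inv_f_eq) (auto simp: bij_is_inj bij_is_surj surj_f_inv_f)
    then show ?thesis using P(3)[OF g(1)] by blast
  qed
  then show "inv_into UNIV \<sigma> \<in> closure_perm A" using bij by (simp add: closure_perm_def bij_imp_bij_inv)
  fix \<tau> assume \<tau>: "\<tau> \<in> closure_perm A"
  have "\<exists>g\<in>A. \<forall>w\<in>F. g w = (\<sigma> \<circ> \<tau>) w" if F: "finite F" for F
  proof -
    obtain g where g: "g \<in> A" "\<forall>w\<in>F. g w = \<tau> w"
      using closure_permD[OF \<tau> F] by blast
    obtain h where h: "h \<in> A" "\<forall>w\<in>\<tau> ` F. h w = \<sigma> w"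
      using closure_permD[OF \<sigma> finite_imageI[OF F]] by blast
    show ?thesis using P(4)[OF h(1) g(1)] g(2) h(2) by (intro bexI[of _ "h \<circ> g"]) auto
  qed
  then show "\<sigma> \<circ> \<tau> \<in> closure_perm A" using \<sigma> \<tau> by (simp add: closure_perm_def bij_comp)
qed

lemma closure_perm_closed:
  assumes "bij \<sigma>" "\<And>F. finite F \<Longrightarrow> \<exists>\<tau>\<in>closure_perm A. \<forall>w\<in>F. \<tau> w = \<sigma> w"
  shows "\<sigma> \<in> closure_perm A"
proof -
  have "\<exists>g\<in>A. \<forall>w\<in>F. g w = \<sigma> w" if F: "finite F" for F
  proof -
    obtain \<tau> where \<tau>: "\<tau> \<in> closure_perm A" "\<And>w. w \<in> F \<Longrightarrow> \<tau> w = \<sigma> w" using assms(2)[OF F] by blast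
    then obtain g where "g \<in> A" "\<forall>w\<in>F. g w = \<tau> w" using closure_permD[OF \<tau>(1) F] by blast
    then show ?thesis using \<tau>(2) by auto
  qed
  then show ?thesis using assms(1) by (simp add: closure_perm_def)
qed

text \<open>Images are corrected one at a time: the transposition of \<open>\<sigma> x\<close> and
  \<open>y\<close> leaves the images already in place alone, since these differ from both points. At
  the end the limit is replaced by an element of \<open>A\<close> with the same values on
  \<open>xs\<close>.\<close>

lemma closure_perm_transpositions:
  assumes A: "perm_group A" and tp: "\<And>a b. Transposition.transpose a b \<in> closure_perm A"
    and "length xs = length ys" "distinct xs" "distinct ys"
  shows "\<exists>g\<in>A. map g xs = ys"
proof -
  have "\<exists>\<sigma>\<in>closure_perm A. map \<sigma> xs = ys"
    using assms(3-5)
  proof (induction xs ys rule: list_induct2)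
    case Nil
    then show ?case using perm_groupD(1)[OF perm_group_closure[OF A]] by auto
  next
    case (Cons x xs y ys)
    then obtain \<sigma> where \<sigma>: "\<sigma> \<in> closure_perm A" "map \<sigma> xs = ys" by auto
    note P = perm_groupD[OF perm_group_closure[OF A]]
    have inj: "inj \<sigma>" using P(2)[OF \<sigma>(1)] by (rule bij_is_inj)
    have "map (Transposition.transpose (\<sigma> x) y \<circ> \<sigma>) xs = map \<sigma> xs"
    proof (rule map_cong[OF HOL.refl])
      fix w assume w: "w \<in> set xs"
      then have "\<sigma> w \<noteq> \<sigma> x" using Cons.prems inj by (auto simp: inj_eq)
      moreover have "\<sigma> w \<in> set ys" using w \<sigma>(2) by auto
      ultimately show "(Transposition.transpose (\<sigma> x) y \<circ> \<sigma>) w = \<sigma> w"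
        using Cons.prems by (auto simp: transpose_def)
    qed
    then have "map (Transposition.transpose (\<sigma> x) y \<circ> \<sigma>) (x # xs) = y # ys" using \<sigma>(2) by simp
    then show ?case by (intro bexI[of _ "Transposition.transpose (\<sigma> x) y \<circ> \<sigma>"] P(4)[OF tp \<sigma>(1)])
  qed
  then obtain \<sigma> where \<sigma>: "\<sigma> \<in> closure_perm A" "map \<sigma> xs = ys" by blast
  then obtain g where "g \<in> A" "\<forall>w\<in>set xs. g w = \<sigma> w" using closure_permD[OF \<sigma>(1), of "set xs"] by auto
  then show ?thesis using \<sigma>(2) by (intro bexI[of _ g]) (auto cong: map_cong)
qed

context pattern
begin

lemma keepsD: "keeps n \<sigma> \<Longrightarrow> blk n z = 0 \<Longrightarrow> blk n (snd (\<sigma> (y, z))) = 0"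
  unfolding keeps_def by blast

definition label_at :: "int \<Rightarrow> fibre \<Rightarrow> fibre" where
  "label_at z = (if \<exists>m. Lab m z then label (THE m. Lab m z) else id)"

definition label_perm :: "point \<Rightarrow> point" where "label_perm = (\<lambda>(y, z). (label_at z y, z))"

lemma label_at_Lab: "Lab m z \<Longrightarrow> label_at z = label m"
proof -
  assume L: "Lab m z"
  then have "(THE m. Lab m z) = m" using Lab_unique by blast
  then show "label_at z = label m" using L by (auto simp: label_at_def)
qed

lemma label_at_id: "(\<And>m. \<not> Lab m z) \<Longrightarrow> label_at z = id"
  by (simp add: label_at_def)

lemma bij_label_at: "bij (label_at z)"
  using bij_label by (simp add: label_at_def)

lemma bij_fibrewise:
  assumes "\<And>z. bij (\<beta> z)"
  shows "bij (\<lambda>(y, z). (\<beta> z y, z))" "inv_into UNIV (\<lambda>(y, z). (\<beta> z y, z)) = (\<lambda>(y, z). (inv_into UNIV (\<beta> z) y, z))"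
proof -
  have *: "(\<lambda>(y, z). (\<beta> z y, z)) \<circ> (\<lambda>(y, z). (inv_into UNIV (\<beta> z) y, z)) = id"
    "(\<lambda>(y, z). (inv_into UNIV (\<beta> z) y, z)) \<circ> (\<lambda>(y, z). (\<beta> z y, z)) = id"
    using assms by (auto simp: fun_eq_iff bij_is_inj bij_is_surj surj_f_inv_f)
  show "bij (\<lambda>(y, z). (\<beta> z y, z))" by (rule o_bij[OF *(2,1)])
  show "inv_into UNIV (\<lambda>(y, z). (\<beta> z y, z)) = (\<lambda>(y, z). (inv_into UNIV (\<beta> z) y, z))"
    by (rule inv_unique_comp[OF *])
qed

lemma bij_label_perm: "bij label_perm"
  unfolding label_perm_def by (intro bij_fibrewise bij_label_at)

lemma label_perm_level: "label_perm \<in> level 0"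
\<comment> \<open>At scale 0 a window is a single integer, and every label is used with exponent
  1.\<close>
proof (rule level_I[OF bij_label_perm, where \<alpha> = "\<lambda>_. 1"])
  fix y :: fibre and z :: int
  have nl: "label_at z = id" if "z \<in> V" for z using that Lab_not_V by (intro label_at_id) blast
  show "acts 0 label_perm (\<lambda>_. 1) y z"
    unfolding acts_def
  proof (intro conjI impI allI)
    assume "blk 0 z \<in> V"
    then show "label_perm (y, z) = transl (5 ^ 0 * blk 0 z) (label_perm (y, pos 0 z))"
      by (simp add: label_perm_def nl V.zero)
  next
    fix m assume "Lab m (blk 0 z)"
    then show "label_perm (y, z) = (perm_power (label (0 + m)) 1 y, z)"
      by (simp add: label_perm_def label_at_Lab perm_power_1[OF bij_label])
  next
    assume "\<forall>m. \<not> Lab m (blk 0 z)"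
    then show "label_perm (y, z) = (y, z)" by (simp add: label_perm_def label_at_id)
  qed
next
  fix y j assume "blk 0 j = 0"
  then show "blk 0 (snd (label_perm (y, j))) = 0" by (simp add: label_perm_def)
next
  fix j :: int assume "blk 0 j = 0"
  then have "label_at j = id" using Lab_not_V V.zero by (intro label_at_id) auto
  then have "finite {y. label_perm (y, j) \<noteq> (id y, j)}" by (simp add: label_perm_def)
  then show "\<exists>u\<in>lamp_group. finite {y. label_perm (y, j) \<noteq> (u y, j)}"
    using perm_groupD(1)[OF perm_group_lamp_group] by blast
qed

lemma spread_level:
  assumes n: "n \<ge> 1" and \<sigma>: "\<sigma> permutes five_points"
  shows "spread n V \<sigma> \<in> level n"
proof (rule level_I[where \<alpha> = "\<lambda>_. 0"])
  note i = permutes_five_points_inv[OF \<sigma>]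
  show "bij (spread n V \<sigma>)" by (rule spread_inv(1)[OF keeps_five_points[OF n \<sigma>] keeps_five_points[OF n i(1)] i(2,3)])
next
  fix y :: fibre and z :: int
  show "acts n (spread n V \<sigma>) (\<lambda>_. 0) y z"
    using V.zero Lab_not_V by (auto simp: acts_def spread_apply perm_power_0 pos_blk0)
next
  fix y j assume j: "blk n j = 0"
  then show "blk n (snd (spread n V \<sigma> (y, j))) = 0"
    using keepsD[OF keeps_five_points[OF n \<sigma>] j] by (simp add: spread_apply V.zero pos_blk0)
next
  fix j assume j: "blk n j = 0"
  have "{y. spread n V \<sigma> (y, j) \<noteq> (id y, j)} \<subseteq> fst ` five_points"
  proof
    fix y assume "y \<in> {y. spread n V \<sigma> (y, j) \<noteq> (id y, j)}"
    then have "\<sigma> (y, j) \<noteq> (y, j)" using j by (simp add: spread_apply V.zero pos_blk0)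
    then have "(y, j) \<in> five_points" using \<sigma> permutes_not_in by metis
    then show "y \<in> fst ` five_points" by force
  qed
  then have "finite {y. spread n V \<sigma> (y, j) \<noteq> (id y, j)}" using finite_five_points finite_subset by blast
  then show "\<exists>u\<in>lamp_group. finite {y. spread n V \<sigma> (y, j) \<noteq> (u y, j)}"
    using perm_groupD(1)[OF perm_group_lamp_group] by blast
qed

definition gens :: "(point \<Rightarrow> point) set" where
  "gens = {transl 1, label_perm} \<union> spread 1 V ` {\<sigma>. \<sigma> permutes five_points}"

definition pattern_group :: "(point \<Rightarrow> point) set" where "pattern_group = generate (perm_monoid {f. bij f}) gens"

lemma finite_gens: "finite gens"
  by (simp add: gens_def finite_permutations finite_five_points)

lemma bij_gens: "f \<in> gens \<Longrightarrow> bij f"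
  using bij_transl bij_label_perm level_D(1)[OF spread_level[of 1]] by (auto simp: gens_def)

lemma perm_group_pattern_group: "perm_group pattern_group" and gens_pattern_group: "gens \<subseteq> pattern_group"
  unfolding pattern_group_def by (rule perm_group_generate, rule bij_gens, assumption)+

lemma pattern_group_envelope: "pattern_group \<subseteq> envelope"
  unfolding pattern_group_def
proof (rule perm_group_generate(3)[OF bij_gens perm_group_envelope])
  have "f \<in> envelope" if "f \<in> levels" for f
    using that unfolding envelope_def by (intro CollectI exI[of _ 0] exI[of _ f]) (simp add: transl_0)
  moreover have "transl 1 = transl 1 \<circ> id" by simp
  then have "transl 1 \<in> envelope" using perm_groupD(1)[OF perm_group_levels] unfolding envelope_def by blast
  moreover have "label_perm \<in> levels" "\<And>\<sigma>. \<sigma> permutes five_points \<Longrightarrow> spread 1 V \<sigma> \<in> levels"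
    using label_perm_level spread_level[of 1] unfolding levels_def by auto
  ultimately show "gens \<subseteq> envelope" unfolding gens_def by auto
qed

lemma pattern_group_closed:
  "f \<in> pattern_group \<Longrightarrow> g \<in> pattern_group \<Longrightarrow> f \<circ> g \<in> pattern_group" "f \<in> pattern_group \<Longrightarrow> inv_into UNIV f \<in> pattern_group" "f \<in> pattern_group \<Longrightarrow> bij f"
  using perm_groupD[OF perm_group_pattern_group] by blast+

lemma transl_pattern_group: "transl k \<in> pattern_group"
proof -
  have 1: "transl 1 \<in> pattern_group" using gens_pattern_group by (auto simp: gens_def)
  then have 2: "transl (-1) \<in> pattern_group" using pattern_group_closed(2)[OF 1] by (simp add: inv_transl)
  show ?thesis
  proof (induction k rule: int_induct[where k = 0])
    case base
    then show ?case using perm_groupD(1)[OF perm_group_pattern_group] by (simp only: transl_0)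
  next
    case (step1 i)
    then show ?case using pattern_group_closed(1)[OF step1(2) 1] by (simp only: transl_comp)
  next
    case (step2 i)
    then show ?case using pattern_group_closed(1)[OF step2(2) 2] by (simp only: transl_comp add_uminus_conv_diff)
  qed
qed

lemma label_perm_pattern_group: "label_perm \<in> pattern_group"
  using gens_pattern_group by (auto simp: gens_def)

lemma transl_conj_pattern_group: "g \<in> pattern_group \<Longrightarrow> transl k \<circ> g \<circ> transl l \<in> pattern_group"
  by (intro pattern_group_closed(1) transl_pattern_group)

lemma spread_conj: "transl (- (5 ^ n)) \<circ> spread n V \<sigma> \<circ> transl (5 ^ n) = spread n {q. q + 1 \<in> V} \<sigma>"
proof
  fix p
  obtain q w where p: "p = transl (5 ^ n * q) w" "blk n (snd w) = 0" by (rule point_cases)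
  have "(transl (- (5 ^ n)) \<circ> spread n V \<sigma> \<circ> transl (5 ^ n)) p = transl (- (5 ^ n)) (spread n V \<sigma> (transl (5 ^ n * (q + 1)) w))"
    by (simp add: p(1) distrib_left add.commute)
  also have "\<dots> = transl (- (5 ^ n)) (transl (5 ^ n * (q + 1)) (if q + 1 \<in> V then \<sigma> w else w))"
    by (simp only: spread_transl[OF p(2)])
  also have "\<dots> = spread n {q. q + 1 \<in> V} \<sigma> p" by (simp add: spread_transl[OF p(2)] p(1) distrib_left)
  finally show "(transl (- (5 ^ n)) \<circ> spread n V \<sigma> \<circ> transl (5 ^ n)) p = spread n {q. q + 1 \<in> V} \<sigma> p" .
qed

text \<open>Since \<open>V\<close> and \<open>V - 1\<close> meet in \<open>5 V\<close>, a commutator of two pattern elements at scale \<open>n\<close>, one of them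
  shifted, is a pattern element at scale \<open>n + 1\<close>.\<close>

lemma spread_cyc_pattern_group:
  assumes "distinct [a, b, c]" "{a, b, c} \<subseteq> five_points"
  shows "spread (Suc n) V (cyc a b c) \<in> pattern_group"
  using assms
proof (induction n arbitrary: a b c)
  case 0
  then have "cyc a b c permutes five_points" by (rule cyc_permutes)
  then show ?case using gens_pattern_group by (auto simp: gens_def)
next
  case (Suc n')
  define n where "n = Suc n'"
  have n: "n \<ge> 1" by (simp add: n_def)
  note IH = Suc.IH[folded n_def]
  \<comment> \<open>The two spare points complete \<open>a\<close>, \<open>b\<close>,
    \<open>c\<close> to the five points of \<open>cyc_commutator\<close>.\<close>
  have "card (five_points - {a, b, c}) = 2"
    using card_five_points finite_five_points Suc.prems by (simp add: card_Diff_subset)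
  then obtain d f where "five_points - {a, b, c} = {d, f}" and ne: "d \<noteq> f" unfolding card_2_iff by blast
  then have "d \<in> five_points - {a, b, c}" "f \<in> five_points - {a, b, c}" by blast+
  with ne Suc.prems have df: "d \<in> five_points" "f \<in> five_points" "distinct [a, b, c, d, f]" by auto
  have P: "cyc a b d permutes five_points" "cyc a c f permutes five_points" "cyc d b a permutes five_points" "cyc f c a permutes five_points"
    "cyc a b c permutes five_points"
    using df Suc.prems by (auto intro!: cyc_permutes)
  note K = P[THEN keeps_five_points[OF n]]
  have i: "cyc a b d \<circ> cyc d b a = id" "cyc a c f \<circ> cyc f c a = id"
    using df by (auto intro!: cyc_inv)
  have G: "spread n V (cyc a b d) \<in> pattern_group" "spread n V (cyc a c f) \<in> pattern_group" "spread n V (cyc d b a) \<in> pattern_group" "spread n V (cyc f c a) \<in> pattern_group"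
    using df Suc.prems by (auto intro!: IH)
  then have G': "spread n {q. q + 1 \<in> V} (cyc a c f) \<in> pattern_group" "spread n {q. q + 1 \<in> V} (cyc f c a) \<in> pattern_group"
    using transl_conj_pattern_group by (metis spread_conj)+
  have "spread (Suc n) V (cyc a b c) = spread n (V \<inter> {q. q + 1 \<in> V}) (cyc a b d \<circ> cyc a c f \<circ> cyc d b a \<circ> cyc f c a)"
    unfolding cyc_commutator[OF df(3)] by (rule spread_Suc[OF n P(5)])
  also have "\<dots> = spread n V (cyc a b d) \<circ> spread n {q. q + 1 \<in> V} (cyc a c f) \<circ> spread n V (cyc d b a) \<circ> spread n {q. q + 1 \<in> V} (cyc f c a)"
    by (rule spread_commutator[OF K(1,3,2,4) i, symmetric])
  also have "\<dots> \<in> pattern_group" by (intro pattern_group_closed(1) G G')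
  finally show ?case by (simp only: n_def)
qed

abbreviation pattern_closure :: "(point \<Rightarrow> point) set" where "pattern_closure \<equiv> closure_perm pattern_group"

lemmas pattern_closure = perm_groupD[OF perm_group_closure[OF perm_group_pattern_group]]

lemma pattern_group_pattern_closure: "g \<in> pattern_group \<Longrightarrow> g \<in> pattern_closure"
  using closure_perm_incl[OF perm_group_pattern_group] by blast

text \<open>Once window 0 at scale \<open>n\<close> contains the given finite set, the copies of the
  cycle in the other windows are invisible there. So the patterns converge to the single
  cycle.\<close>

lemma cyc_pattern_closure:
  assumes d: "distinct [a, b, c]" "{a, b, c} \<subseteq> five_points"
  shows "cyc a b c \<in> pattern_closure"
proof (rule closure_perm_closed)
  have P: "cyc a b c permutes five_points" by (rule cyc_permutes[OF d])
  then show "bij (cyc a b c)" by (rule permutes_bij)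
  fix F :: "point set" assume F: "finite F"
  define n where "n = Max (insert 1 ((\<lambda>w. nat \<bar>snd w\<bar>) ` F))"
  have n1: "n \<ge> 1" unfolding n_def using F by (intro Max_ge) auto
  have "spread n V (cyc a b c) w = cyc a b c w" if w: "w \<in> F" for w
  proof -
    have "nat \<bar>snd w\<bar> \<le> n" unfolding n_def using F w by (intro Max_ge) auto
    then have "blk n (snd w) = 0" using margin_ge[of n] by (auto simp: blk_iff)
    then show ?thesis using spread_transl[of n w V "cyc a b c" 0] V.zero by simp
  qed
  moreover have "spread n V (cyc a b c) \<in> pattern_closure" using pattern_group_pattern_closure[OF spread_cyc_pattern_group[OF d, of "n - 1"]] n1 by simp
  ultimately show "\<exists>\<tau>\<in>pattern_closure. \<forall>w\<in>F. \<tau> w = cyc a b c w" by blast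
qed

abbreviation adj_swap :: "int \<Rightarrow> point \<Rightarrow> point" where "adj_swap i \<equiv> Transposition.transpose (base_pt i) (base_pt (i + 1))"

lemma pattern_closure_conj: "g \<in> pattern_group \<Longrightarrow> \<sigma> \<in> pattern_closure \<Longrightarrow> g \<circ> \<sigma> \<circ> inv_into UNIV g \<in> pattern_closure"
  using pattern_closure(4) pattern_group_pattern_closure pattern_group_closed(2) by blast

lemma adj_swap_adj_swap_pattern_closure: "adj_swap i \<circ> adj_swap (i + 1) \<in> pattern_closure"
proof -
  have d: "distinct [base_pt 0, base_pt 1, base_pt 2]" "{base_pt 0, base_pt 1, base_pt 2} \<subseteq> five_points" by (auto simp: inj_base_pt five_points_def)
  have "transl i \<circ> cyc (base_pt 0) (base_pt 1) (base_pt 2) \<circ> inv_into UNIV (transl i) \<in> pattern_closure"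
    by (rule pattern_closure_conj[OF transl_pattern_group cyc_pattern_closure[OF d]])
  then have "cyc (base_pt i) (base_pt (i + 1)) (base_pt (i + 1 + 1)) \<in> pattern_closure"
    by (simp add: conj_cyc[OF bij_transl] transl_base_pt add.commute add.assoc)
  moreover have "distinct [base_pt i, base_pt (i + 1), base_pt (i + 1 + 1)]" by (simp add: inj_base_pt)
  ultimately show ?thesis by (simp only: cyc_eq_transpose)
qed

text \<open>Products of neighbouring transpositions telescope. This pushes the second transposition
  out along the line, and in the limit it disappears: a transposition becomes a limit of products of
  3-cycles.\<close>

lemma adj_swap_0_adj_swap_pattern_closure: "adj_swap 0 \<circ> adj_swap (int m + 1) \<in> pattern_closure"
proof (induction m)
  case 0
  show ?case using adj_swap_adj_swap_pattern_closure[of 0] by (simp only: of_nat_0)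
next
  case (Suc m)
  have "adj_swap 0 \<circ> adj_swap (int m + 1) \<circ> (adj_swap (int m + 1) \<circ> adj_swap (int m + 1 + 1)) = adj_swap 0 \<circ> adj_swap (int (Suc m) + 1)"
    by (simp add: fun_eq_iff add.commute)
  then show ?case using pattern_closure(4)[OF Suc adj_swap_adj_swap_pattern_closure[of "int m + 1"]] by (simp only:)
qed

lemma adj_swap_0_pattern_closure: "adj_swap 0 \<in> pattern_closure"
proof (rule closure_perm_closed)
  show "bij (adj_swap 0)" by simp
  fix F :: "point set" assume F: "finite F"
  define m where "m = Max (insert 0 ((\<lambda>w. nat \<bar>snd w\<bar>) ` F))"
  have "(adj_swap 0 \<circ> adj_swap (int m + 1)) w = adj_swap 0 w" if w: "w \<in> F" for w
  proof -
    have "nat \<bar>snd w\<bar> \<le> m" unfolding m_def using F w by (intro Max_ge) auto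
    then have "w \<noteq> base_pt (int m + 1)" "w \<noteq> base_pt (int m + 1 + 1)" by (auto simp: base_pt_def)
    then show ?thesis by simp
  qed
  then show "\<exists>\<tau>\<in>pattern_closure. \<forall>w\<in>F. \<tau> w = adj_swap 0 w" using adj_swap_0_adj_swap_pattern_closure by blast
qed

text \<open>An equivalence relation that is invariant under \<open>pattern_group\<close>; the aim is
  that all points form one class, as \<open>closure_perm_transpositions\<close> asks.\<close>

definition linked :: "point \<Rightarrow> point \<Rightarrow> bool" where
  "linked a b \<longleftrightarrow> Transposition.transpose a b \<in> pattern_closure"

lemma linked_refl: "linked a a"
  using pattern_closure(1) by (simp add: linked_def)

lemma linked_sym: "linked a b \<Longrightarrow> linked b a"
  by (simp add: linked_def transpose_commute)

lemma linked_trans: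
  assumes "linked a b" "linked b c"
  shows "linked a c"
proof (cases "a = b \<or> b = c \<or> a = c")
  case True
  then show ?thesis using assms linked_refl by blast
next
  case False
  then have "Transposition.transpose a b \<circ> Transposition.transpose b c \<circ> Transposition.transpose a b = Transposition.transpose a c"
    by (auto simp: fun_eq_iff transpose_def)
  moreover have "Transposition.transpose a b \<circ> Transposition.transpose b c \<circ> Transposition.transpose a b \<in> pattern_closure"
    using assms unfolding linked_def by (intro pattern_closure(4))
  ultimately show ?thesis by (simp only: linked_def)
qed

lemma linked_pattern_group:
  assumes "g \<in> pattern_group" "linked a b"
  shows "linked (g a) (g b)"
  using pattern_closure_conj[OF assms(1) assms(2)[unfolded linked_def]]
  by (simp add: linked_def conj_transpose pattern_group_closed(3)[OF assms(1)])

lemma linked_transl: "linked a b \<Longrightarrow> linked (transl k a) (transl k b)"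
  by (rule linked_pattern_group[OF transl_pattern_group])

lemma linked_base_pt_Suc: "linked (base_pt i) (base_pt (i + 1))"
proof -
  have "linked (transl i (base_pt 0)) (transl i (base_pt 1))" using adj_swap_0_pattern_closure by (intro linked_transl) (simp add: linked_def)
  then show ?thesis by (simp add: transl_base_pt add.commute)
qed

lemma linked_base_pt: "linked (base_pt i) (base_pt j)"
proof -
  have "linked (base_pt 0) (base_pt j)" for j
  proof (induction j rule: int_induct[where k = 0])
    case base
    show ?case by (rule linked_refl)
  next
    case (step1 i)
    show ?case by (rule linked_trans[OF step1(2) linked_base_pt_Suc])
  next
    case (step2 i)
    have "linked (base_pt i) (base_pt (i - 1))" using linked_sym[OF linked_base_pt_Suc[of "i - 1"]] by simp
    then show ?case by (rule linked_trans[OF step2(2)])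
  qed
  then show ?thesis using linked_trans[OF linked_sym] by metis
qed

text \<open>The translate of \<open>label_perm\<close> by \<open>2 * 5 ^ m\<close> acts by
  \<open>label m\<close> on the fibre at 0 and trivially on the fibre at 1. It moves
  \<open>p\<close> while keeping the partner \<open>base_pt 1\<close> in place.\<close>

lemma linked_fibre:
  assumes "linked (p, 0) (base_pt 0)" "u = label m \<or> u = inv_into UNIV (label m)"
  shows "linked (u p, 0) (base_pt 0)"
proof -
  let ?K = "2 * 5 ^ m :: int"
  let ?g = "transl (- ?K) \<circ> label_perm \<circ> transl ?K"
  have g: "?g \<in> pattern_group" by (rule transl_conj_pattern_group[OF label_perm_pattern_group])
  \<comment> \<open>The last digit is 3 if \<open>m\<close> is 0 and 1 otherwise; labelled integers
    end in 0 or 2.\<close>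
  have "\<not> Lab m' (?K + 1)" for m'
  proof (cases m)
    case 0
    then show ?thesis using Lab_digit[of 3 m' 0] by simp
  next
    case (Suc k)
    then show ?thesis using Lab_digit[of 1 m' "2 * 5 ^ k"] by simp
  qed
  then have 1: "?g (y, 1) = (y, 1)" for y by (simp add: label_perm_def label_at_id add.commute)
  have "Lab m ?K" using Lab_power[OF V.zero, of m] by simp
  then have 0: "?g (y, 0) = (label m y, 0)" for y by (simp add: label_perm_def label_at_Lab)
  have p1: "linked (p, 0) ((0, 0), 1)" using linked_trans[OF assms(1) linked_base_pt[of 0 1]] by (simp add: base_pt_def)
  have "linked (u p, 0) ((0, 0), 1)"
    using assms(2)
  proof
    assume "u = label m"
    then show ?thesis using linked_pattern_group[OF g p1] unfolding 0 1 by simp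
  next
    assume u: "u = inv_into UNIV (label m)"
    have bij: "bij ?g" by (rule pattern_group_closed(3)[OF g])
    have "inv_into UNIV ?g (p, 0) = (u p, 0)"
      using bij_label[of m] by (intro inv_f_eq bij_is_inj[OF bij]) (simp only: 0 u, simp add: bij_is_surj surj_f_inv_f)
    moreover have "inv_into UNIV ?g ((0, 0), 1) = ((0, 0), 1)"
      by (intro inv_f_eq bij_is_inj[OF bij] 1)
    ultimately show ?thesis using linked_pattern_group[OF pattern_group_closed(2)[OF g] p1] by simp
  qed
  then show ?thesis using linked_trans[of "(u p, 0)" "base_pt 1" "base_pt 0"] linked_base_pt[of 1 0] by (simp add: base_pt_def)
qed

text \<open>By transitivity of \<open>HH\<close>, the labels \<open>half (e m)\<close> reach every
  point of row 0; the shift and its inverse then reach all rows.\<close>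

lemma linked_origin: "linked (p, 0) (base_pt 0)"
proof -
  obtain x i where p: "p = (x, i)" by force
  obtain f where f: "f \<in> HH" "f 0 = x" using transitive by blast
  then obtain m where m: "f = e m" using e by auto
  have "linked ((0, 0), 0) (base_pt 0)" using linked_refl by (simp add: base_pt_def)
  then have "linked (label (Suc m) (0, 0), 0) (base_pt 0)" using linked_fibre by blast
  then have base: "linked ((x, 0), 0) (base_pt 0)" using f m by (simp add: half_def)
  have inv: "inv_into UNIV (label 0) (x, j) = (x, j - 1)" for x j
    using bij_label[of 0] by (intro inv_f_eq) (auto simp: bij_is_inj shift1_def)
  have "linked ((x, i), 0) (base_pt 0)"
  proof (induction i rule: int_induct[where k = 0])
    case base
    show ?case by (rule \<open>linked ((x, 0), 0) (base_pt 0)\<close>)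
  next
    case (step1 j)
    then show ?case using linked_fibre[OF step1(2), of "label 0" 0] by (simp add: shift1_def)
  next
    case (step2 j)
    then show ?case using linked_fibre[OF step2(2), of "inv_into UNIV (label 0)" 0] inv by simp
  qed
  then show ?thesis by (simp add: p)
qed

lemma linked_all: "linked a b"
proof -
  have "linked a (base_pt 0)" for a
  proof -
    obtain p z where a: "a = (p, z)" by (metis surj_pair)
    have "linked (transl z (p, 0)) (transl z (base_pt 0))" by (rule linked_transl[OF linked_origin])
    then have "linked a (base_pt z)" by (simp add: a transl_base_pt)
    then show ?thesis by (rule linked_trans[OF _ linked_base_pt])
  qed
  then show ?thesis using linked_trans[OF _ linked_sym] by metis
qed

lemma pattern_group_highly_transitive:
  assumes "length xs = length ys" "distinct xs" "distinct ys"
  shows "\<exists>g\<in>pattern_group. map g xs = ys"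
  using linked_all assms unfolding linked_def by (intro closure_perm_transpositions[OF perm_group_pattern_group])

lemma pattern_group_infinite_support: "g \<in> pattern_group \<Longrightarrow> g \<noteq> id \<Longrightarrow> infinite {w. g w \<noteq> w}"
  using infinite_support_envelope pattern_group_envelope by blast

section \<open>Recovering the given group inside the pattern group\<close>

definition fibre_emb :: "int set \<Rightarrow> (nat \<Rightarrow> nat) \<Rightarrow> point \<Rightarrow> point" where
  "fibre_emb S f = (\<lambda>((x, i), z). ((if z \<in> S \<and> i = 0 then f x else x, i), z))"

text \<open>A commutator of two translates of \<open>label_perm\<close>. By
  \<open>Lab_overlap\<close> both are nontrivial only on the fibres of the stated set, where they
  act as \<open>half (e m)\<close> and \<open>shift1\<close>.\<close>

lemma fibre_emb_pattern_group_start: "fibre_emb {5 ^ (m + 2) * w | w. w \<in> V} (e m) \<in> pattern_group"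
proof -
  let ?a = "2::int" and ?b = "2 * 5 ^ Suc m :: int"
  let ?X = "\<lambda>k. transl (-k) \<circ> label_perm \<circ> transl k"
  have X: "?X k = (\<lambda>(y, z). (label_at (z + k) y, z))" for k by (auto simp: label_perm_def)
  have Xi: "inv_into UNIV (?X k) = (\<lambda>(y, z). (inv_into UNIV (label_at (z + k)) y, z))" for k
    unfolding X by (rule bij_fibrewise(2)[OF bij_label_at])
  have G: "?X k \<in> pattern_group" for k by (rule transl_conj_pattern_group[OF label_perm_pattern_group])
  have shift_inv: "inv_into UNIV shift1 (x, i) = (x, i - 1)" for x i
    using bij_label[of 0] by (intro inv_f_eq) (auto simp: bij_is_inj shift1_def)
  have em: "bij (e m)" using e perm_groupD(2)[OF HH] by auto
  have half_inv: "inv_into UNIV (half (e m)) (x, i) = (if i \<ge> 0 then inv_into UNIV (e m) x else x, i)" for x i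
    using bij_label[of "Suc m"] em by (intro inv_f_eq) (auto simp: bij_is_inj half_def bij_is_surj surj_f_inv_f)
  \<comment> \<open>Conjugating by the shift moves the half fibre up by one row, so everything
    cancels except in row 0.\<close>
  have comm: "half (e m) (shift1 (inv_into UNIV (half (e m)) (inv_into UNIV shift1 (x, i)))) = (if i = 0 then e m x else x, i)" for x i
    using em by (simp only: shift_inv half_inv) (auto simp: shift1_def half_def bij_is_surj surj_f_inv_f)
  have val: "(?X ?b \<circ> ?X ?a \<circ> inv_into UNIV (?X ?b) \<circ> inv_into UNIV (?X ?a)) (y, z) =
      (label_at (z + ?b) (label_at (z + ?a) (inv_into UNIV (label_at (z + ?b)) (inv_into UNIV (label_at (z + ?a)) y))), z)" for y z
    unfolding Xi unfolding X by (simp only: comp_apply prod.case)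
  have pw: "(?X ?b \<circ> ?X ?a \<circ> inv_into UNIV (?X ?b) \<circ> inv_into UNIV (?X ?a)) ((x, i), z) =
      fibre_emb {5 ^ (m + 2) * w | w. w \<in> V} (e m) ((x, i), z)" for x i z
  proof (cases "\<exists>w\<in>V. z = 5 ^ (m + 2) * w")
    case True
    then obtain w where w: "w \<in> V" "z = 5 ^ (m + 2) * w" by blast
    have "5 ^ (m + 1) * w \<in> V" using w V_power by blast
    then have "Lab 0 (5 * (5 ^ (m + 1) * w) + 2)" by (rule Lab.zero)
    then have a: "label_at (z + ?a) = shift1" using label_at_Lab[of 0 "z + ?a"] w(2) by (simp add: algebra_simps)
    have b: "label_at (z + ?b) = half (e m)" using label_at_Lab[OF Lab_power[OF w(1), of "Suc m"]] w(2) by (simp add: algebra_simps)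
    have "z \<in> {5 ^ (m + 2) * w | w. w \<in> V}" using True by blast
    then show ?thesis unfolding val a b comm by (simp only: fibre_emb_def prod.case simp_thms)
  next
    case False
    then have "(\<forall>c. \<not> Lab c (z + ?a)) \<or> (\<forall>c. \<not> Lab c (z + ?b))" using Lab_overlap by blast
    then have "label_at (z + ?a) = id \<or> label_at (z + ?b) = id" using label_at_id by blast
    moreover have "label_at k (inv_into UNIV (label_at k) y) = y" for k y
      using bij_label_at[of k] by (simp add: bij_is_surj surj_f_inv_f)
    ultimately have "label_at (z + ?b) (label_at (z + ?a) (inv_into UNIV (label_at (z + ?b)) (inv_into UNIV (label_at (z + ?a)) y))) = y" for y
      by (metis id_apply inv_id)
    moreover have "z \<notin> {5 ^ (m + 2) * w | w. w \<in> V}" using False by blast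
    ultimately show ?thesis unfolding val by (simp only: fibre_emb_def prod.case simp_thms if_False)
  qed
  have "?X ?b \<circ> ?X ?a \<circ> inv_into UNIV (?X ?b) \<circ> inv_into UNIV (?X ?a) = fibre_emb {5 ^ (m + 2) * w | w. w \<in> V} (e m)"
  proof
    fix p :: point
    obtain x i z where "p = ((x, i), z)" by (metis surj_pair)
    then show "(?X ?b \<circ> ?X ?a \<circ> inv_into UNIV (?X ?b) \<circ> inv_into UNIV (?X ?a)) p = fibre_emb {5 ^ (m + 2) * w | w. w \<in> V} (e m) p"
      by (simp only: pw)
  qed
  moreover have "?X ?b \<circ> ?X ?a \<circ> inv_into UNIV (?X ?b) \<circ> inv_into UNIV (?X ?a) \<in> pattern_group"
    by (intro pattern_group_closed(1) pattern_group_closed(2) G)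
  ultimately show ?thesis by (simp only:)
qed

text \<open>An element of \<open>V\<close> ends in 0 or 1, so the new support is the disjoint union
  of the old one and its translate by \<open>5 ^ k\<close>.\<close>

lemma fibre_emb_pattern_group_step:
  assumes "fibre_emb {5 ^ Suc k * w | w. w \<in> V} f \<in> pattern_group"
  shows "fibre_emb {5 ^ k * w | w. w \<in> V} f \<in> pattern_group"
proof -
  let ?S = "\<lambda>k. {5 ^ k * w | w. w \<in> V} :: int set"
  have S: "z \<in> ?S k \<longleftrightarrow> z \<in> ?S (Suc k) \<or> z - 5 ^ k \<in> ?S (Suc k)" for z
  proof
    assume "z \<in> ?S k"
    then obtain w where w: "w \<in> V" "z = 5 ^ k * w" by blast
    from w(1) show "z \<in> ?S (Suc k) \<or> z - 5 ^ k \<in> ?S (Suc k)"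
    proof cases
      case zero
      then show ?thesis using w V.zero by auto
    next
      case (even v)
      then show ?thesis using w by auto
    next
      case (odd v)
      then have "z - 5 ^ k = 5 ^ Suc k * v" using w by (simp add: algebra_simps)
      then show ?thesis using odd by blast
    qed
  next
    assume "z \<in> ?S (Suc k) \<or> z - 5 ^ k \<in> ?S (Suc k)"
    then obtain v where v: "v \<in> V" "z = 5 ^ k * (5 * v) \<or> z = 5 ^ k * (5 * v + 1)" by (auto simp: algebra_simps)
    then show "z \<in> ?S k" using V.even V.odd by blast
  qed
  have disj: "\<not> (z \<in> ?S (Suc k) \<and> z - 5 ^ k \<in> ?S (Suc k))" for z
  proof
    assume "z \<in> ?S (Suc k) \<and> z - 5 ^ k \<in> ?S (Suc k)"
    then obtain v w where "z = 5 ^ Suc k * v" "z - 5 ^ k = 5 ^ Suc k * w" by blast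
    then have "(5::int) ^ k * (5 * v - 5 * w) = 5 ^ k * 1" by (simp add: algebra_simps)
    then have "5 * v - 5 * w = 1" by simp
    then show False by presburger
  qed
  have "(transl (5 ^ k) \<circ> fibre_emb (?S (Suc k)) f \<circ> transl (- (5 ^ k))) \<circ> fibre_emb (?S (Suc k)) f = fibre_emb (?S k) f"
  proof
    fix p :: point
    obtain x i z where p: "p = ((x, i), z)" by (metis surj_pair)
    consider "z \<in> ?S (Suc k)" "z - 5 ^ k \<notin> ?S (Suc k)" "z \<in> ?S k" | "z \<notin> ?S (Suc k)" "z - 5 ^ k \<in> ?S (Suc k)" "z \<in> ?S k"
      | "z \<notin> ?S (Suc k)" "z - 5 ^ k \<notin> ?S (Suc k)" "z \<notin> ?S k" using S disj by blast
    then show "((transl (5 ^ k) \<circ> fibre_emb (?S (Suc k)) f \<circ> transl (- (5 ^ k))) \<circ> fibre_emb (?S (Suc k)) f) p = fibre_emb (?S k) f p"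
      by cases (simp_all only: p fibre_emb_def comp_apply prod.case transl_simps simp_thms if_True if_False add_uminus_conv_diff diff_add_cancel)
  qed
  moreover have "(transl (5 ^ k) \<circ> fibre_emb (?S (Suc k)) f \<circ> transl (- (5 ^ k))) \<circ> fibre_emb (?S (Suc k)) f \<in> pattern_group"
    by (intro pattern_group_closed(1)[OF transl_conj_pattern_group[OF assms] assms])
  ultimately show ?thesis by simp
qed

text \<open>The support obtained from the commutator depends on the index of \<open>f\<close>.
  Descending to \<open>V\<close> itself lets all of \<open>HH\<close> act on the same fibres, which
  makes the embedding multiplicative.\<close>

lemma fibre_emb_pattern_group:
  assumes "f \<in> HH"
  shows "fibre_emb V f \<in> pattern_group"
proof -
  obtain m where m: "f = e m" using assms e by auto
  have "fibre_emb {5 ^ (m + 2 - k) * w | w. w \<in> V} f \<in> pattern_group" if "k \<le> m + 2" for k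
    using that
  proof (induction k)
    case 0
    show ?case using fibre_emb_pattern_group_start[of m] m by simp
  next
    case (Suc k)
    then have eq: "m + 2 - k = Suc (m + 2 - Suc k)" by simp
    have "fibre_emb {5 ^ (m + 2 - k) * w | w. w \<in> V} f \<in> pattern_group" using Suc by simp
    then show ?case unfolding eq by (rule fibre_emb_pattern_group_step)
  qed
  from this[of "m + 2"] show ?thesis by simp
qed

lemma fibre_emb_comp: "fibre_emb V f \<circ> fibre_emb V g = fibre_emb V (f \<circ> g)"
  by (auto simp: fibre_emb_def fun_eq_iff)

lemma fibre_emb_inj: "fibre_emb V f = fibre_emb V g \<Longrightarrow> f = g"
proof
  fix x assume "fibre_emb V f = fibre_emb V g"
  then have "fibre_emb V f ((x, 0), 0) = fibre_emb V g ((x, 0), 0)" by simp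
  then show "f x = g x" using V.zero by (simp add: fibre_emb_def)
qed

end

lemma (in pattern_in_class) pattern_group_in_class: "perm_in_class pattern_group"
  using perm_in_class_subset[OF envelope_in_class perm_group_pattern_group pattern_group_envelope] .

section \<open>Embedding theorems\<close>

lemma countable_generate:
  assumes G: "group G" and S: "S \<subseteq> carrier G" "countable S"
  shows "countable (generate G S)"
proof -
  interpret group G by fact
  define T where "T = S \<union> m_inv G ` S"
  define val where "val ws = foldr (\<otimes>\<^bsub>G\<^esub>) ws \<one>\<^bsub>G\<^esub>" for ws
  have T: "T \<subseteq> carrier G" using S by (auto simp: T_def)
  have closed: "val u \<in> carrier G" if "u \<in> lists T" for u
    using that T unfolding val_def by induction auto
  have app: "val (u @ v) = val u \<otimes>\<^bsub>G\<^esub> val v" if "u \<in> lists T" "v \<in> lists T" for u v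
    using that(1)
  proof induction
    case Nil
    then show ?case using closed[OF that(2)] by (simp add: val_def)
  next
    case (Cons a u)
    then show ?case using closed[OF that(2)] closed[of u] T m_assoc[of a "val u" "val v"] by (auto simp: val_def)
  qed
  have "generate G S \<subseteq> val ` lists T"
  proof
    fix x assume "x \<in> generate G S"
    then show "x \<in> val ` lists T"
    proof induction
      case one
      show ?case by (intro image_eqI[of _ _ "[]"]) (auto simp: val_def)
    next
      case (incl h)
      then show ?case using S by (intro image_eqI[of _ _ "[h]"]) (auto simp: val_def T_def)
    next
      case (inv h)
      then have "h \<in> carrier G" using S by auto
      with inv show ?case by (intro image_eqI[of _ _ "[inv\<^bsub>G\<^esub> h]"]) (auto simp: val_def T_def)
    next
      case (eng a b)
      then obtain u v where "u \<in> lists T" "v \<in> lists T" "a = val u" "b = val v" by auto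
      then show ?case using app by (intro image_eqI[of _ _ "u @ v"]) auto
    qed
  qed
  moreover have "countable (lists T)" using S by (intro countable_lists) (simp add: T_def)
  ultimately show ?thesis by (rule countable_subset[OF _ countable_image])
qed

context group_class
begin

text \<open>The factor makes the group infinite without leaving the class, as a regular action on
  \<open>nat\<close> requires.\<close>

lemma locally_in_class_times_integer:
  assumes H: "group H" "locally_in_class H"
  shows "group (H \<times>\<times> integer_group)" "locally_in_class (H \<times>\<times> integer_group)"
proof -
  show g: "group (H \<times>\<times> integer_group)" by (rule DirProd_group[OF H(1) group_integer_group])
  have snd: "snd \<in> hom (H \<times>\<times> integer_group) integer_group" by (auto simp: hom_def DirProd_def)
  let ?N = "kernel (H \<times>\<times> integer_group) integer_group snd"
  have carr: "carrier (H \<times>\<times> integer_group) = carrier H \<times> UNIV" by (simp add: DirProd_def)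
  have N: "?N = carrier H \<times> {0}" unfolding kernel_def carr by auto
  have "subgroup ?N (H \<times>\<times> integer_group)"
    by (intro group_hom.subgroup_kernel) (simp add: group_hom_def group_hom_axioms_def g snd)
  then have gN: "group ((H \<times>\<times> integer_group)\<lparr>carrier := ?N\<rparr>)" using g by (rule subgroup.subgroup_is_group)
  have "locally_in_class ((H \<times>\<times> integer_group)\<lparr>carrier := ?N\<rparr>)"
  proof (rule locally_in_class_embed[OF gN H(2)])
    show "fst \<in> hom ((H \<times>\<times> integer_group)\<lparr>carrier := ?N\<rparr>) H" unfolding N by (auto simp: hom_def DirProd_def)
    show "inj_on fst (carrier ((H \<times>\<times> integer_group)\<lparr>carrier := ?N\<rparr>))" unfolding N by (auto simp: inj_on_def)
  qed
  then show "locally_in_class (H \<times>\<times> integer_group)"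
    by (rule locally_in_class_extension[OF g locally_in_class_abelian[OF abelian_integer_group] snd])
qed

lemma regular_representation:
  assumes H: "group H" "locally_in_class H" "countable (carrier H)" "infinite (carrier H)"
  shows "\<exists>HH \<rho>. perm_in_class HH \<and> \<rho> \<in> iso H (perm_monoid HH) \<and>
    (\<forall>f\<in>HH. \<forall>x::nat. f x = x \<longrightarrow> f = id) \<and> (\<forall>x y. \<exists>f\<in>HH. f x = y)"
proof -
  interpret group H by fact
  let ?b = "to_nat_on (carrier H)"
  let ?c = "inv_into (carrier H) ?b"
  have bij: "bij_betw ?b (carrier H) UNIV" using H(3,4) by (rule to_nat_on_infinite)
  have cb: "?c (?b x) = x" if "x \<in> carrier H" for x using bij_betw_inv_into_left[OF bij that] .
  have bc: "?b (?c n) = n" and c: "?c n \<in> carrier H" for n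
    using bij_betw_inv_into_right[OF bij, of n] bij_betw_inv_into[OF bij] by (auto simp: bij_betw_def)
  define \<rho> where "\<rho> h n = ?b (h \<otimes>\<^bsub>H\<^esub> ?c n)" for h n
  have mult: "\<rho> (g \<otimes>\<^bsub>H\<^esub> h) = \<rho> g \<circ> \<rho> h" if "g \<in> carrier H" "h \<in> carrier H" for g h
    using that by (auto simp: \<rho>_def cb c m_assoc fun_eq_iff)
  have one: "\<rho> \<one>\<^bsub>H\<^esub> = id" by (auto simp: \<rho>_def c bc fun_eq_iff)
  have inv: "\<rho> h \<circ> \<rho> (inv\<^bsub>H\<^esub> h) = id" "\<rho> (inv\<^bsub>H\<^esub> h) \<circ> \<rho> h = id" if "h \<in> carrier H" for h
    using that by (simp_all add: one flip: mult)
  let ?HH = "\<rho> ` carrier H"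
  have PG: "perm_group ?HH"
  proof (rule perm_groupI)
    show "id \<in> ?HH" using one by (metis image_eqI one_closed)
  next
    fix f assume "f \<in> ?HH"
    then obtain h where h: "h \<in> carrier H" "f = \<rho> h" by auto
    show "bij f" unfolding h(2) by (rule o_bij[OF inv(2,1)[OF h(1)]])
    have "inv_into UNIV f = \<rho> (inv\<^bsub>H\<^esub> h)" unfolding h(2) by (rule inv_unique_comp[OF inv[OF h(1)]])
    then show "inv_into UNIV f \<in> ?HH" using h(1) by auto
  next
    fix f g assume "f \<in> ?HH" "g \<in> ?HH"
    then obtain h k where "h \<in> carrier H" "f = \<rho> h" "k \<in> carrier H" "g = \<rho> k" by blast
    then show "f \<circ> g \<in> ?HH" by (intro image_eqI[of _ _ "h \<otimes>\<^bsub>H\<^esub> k"]) (simp_all add: mult)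
  qed
  have fixed: "h = \<one>\<^bsub>H\<^esub>" if "h \<in> carrier H" "\<rho> h n = n" for h n
  proof -
    have "?c (\<rho> h n) = h \<otimes>\<^bsub>H\<^esub> ?c n" unfolding \<rho>_def using that(1) c by (intro cb) simp
    then have "h \<otimes>\<^bsub>H\<^esub> ?c n = ?c n" using that(2) by simp
    then show ?thesis using r_cancel_one'[OF c that(1)] by metis
  qed
  have inj: "inj_on \<rho> (carrier H)"
  proof (rule inj_onI)
    fix g h assume gh: "g \<in> carrier H" "h \<in> carrier H" "\<rho> g = \<rho> h"
    have e: "?c (\<rho> x 0) = x \<otimes>\<^bsub>H\<^esub> ?c 0" if "x \<in> carrier H" for x using that c by (simp add: \<rho>_def cb)
    have "g \<otimes>\<^bsub>H\<^esub> ?c 0 = h \<otimes>\<^bsub>H\<^esub> ?c 0" using e[OF gh(1)] e[OF gh(2)] gh(3) by simp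
    then show "g = h" using gh(1,2) c by simp
  qed
  have hom: "\<rho> \<in> hom H (perm_monoid ?HH)" using mult by (auto simp: hom_def)
  then have iso: "\<rho> \<in> iso H (perm_monoid ?HH)" using inj by (simp add: iso_def bij_betw_def)
  then have iso': "inv_into (carrier H) \<rho> \<in> iso (perm_monoid ?HH) H" by (rule iso_set_sym)
  have "locally_in_class (perm_monoid ?HH)"
    using iso' by (intro locally_in_class_embed[OF group_perm_monoid[OF PG] H(2), of "inv_into (carrier H) \<rho>"])
      (auto simp: iso_def bij_betw_def)
  then have "perm_in_class ?HH" using PG by (simp add: perm_in_class_def)
  moreover have "f = id" if f: "f \<in> ?HH" and x: "f x = x" for f x
  proof -
    obtain h where h: "h \<in> carrier H" "f = \<rho> h" using f by blast
    then show ?thesis using fixed[OF h(1), of x] x one by simp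
  qed
  moreover have "\<exists>f\<in>?HH. f x = y" for x y
  proof
    show "\<rho> (?c y \<otimes>\<^bsub>H\<^esub> inv\<^bsub>H\<^esub> ?c x) \<in> ?HH" using c by simp
    show "\<rho> (?c y \<otimes>\<^bsub>H\<^esub> inv\<^bsub>H\<^esub> ?c x) x = y" using c by (simp add: \<rho>_def m_assoc bc)
  qed
  ultimately show ?thesis using iso by blast
qed

theorem embeds_highly_transitive:
  fixes H :: "'a monoid"
  assumes H: "group H" "locally_in_class H" "countable (carrier H)"
  shows "\<exists>L :: nat monoid. group L \<and> finitely_generated L \<and> C L \<and> highly_transitive L \<and>
    mixed_identity_free L \<and> embeds H L"
proof -
  let ?H = "H \<times>\<times> integer_group"
  have carr: "carrier ?H = carrier H \<times> UNIV" by (simp add: DirProd_def)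
  have "\<one>\<^bsub>H\<^esub> \<in> carrier H" using H(1) by (simp add: group.is_monoid)
  then have "infinite (carrier ?H)" unfolding carr
    by (auto simp: finite_cartesian_product_iff infinite_UNIV_int)
  moreover have "countable (carrier ?H)" unfolding carr using H(3) by simp
  ultimately obtain HH \<rho> where HH: "perm_in_class HH" and \<rho>: "\<rho> \<in> iso ?H (perm_monoid HH)"
    and free: "\<forall>f\<in>HH. \<forall>x::nat. f x = x \<longrightarrow> f = id" and trans: "\<forall>x y. \<exists>f\<in>HH. f x = y"
    using regular_representation[OF locally_in_class_times_integer[OF H(1,2)]] by blast
  have "HH = \<rho> ` carrier ?H" using \<rho> by (auto simp: iso_def bij_betw_def)
  then have "countable HH" using \<open>countable (carrier ?H)\<close> by simp
  moreover have PG: "perm_group HH" using HH by (simp add: perm_in_class_def)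
  then have "HH \<noteq> {}" using perm_groupD(1) by blast
  ultimately have range: "range (from_nat_into HH) = HH" by (intro range_from_nat_into)
  interpret pattern_in_class HH "from_nat_into HH" C
    by unfold_locales (use HH PG free trans range in auto)
  have gG: "group (perm_monoid pattern_group)" by (rule group_perm_monoid[OF perm_group_pattern_group])
  have "countable pattern_group"
    unfolding pattern_group_def using bij_gens finite_gens
    by (intro countable_generate group_perm_monoid perm_group_bij) (auto simp: countable_finite)
  then have "copy_in_class (perm_monoid pattern_group)"
    using pattern_group_in_class by (intro locally_in_class_countable) (simp_all add: perm_in_class_def)
  then obtain L f where L: "group L" "C L" and f: "f \<in> iso (perm_monoid pattern_group) L" by (auto simp: copy_in_class_def)
  define \<psi> where "\<psi> = inv_into pattern_group f"
  have f_bij: "bij_betw f pattern_group (carrier L)" using f by (simp add: iso_def)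
  have \<psi>_iso: "\<psi> \<in> iso L (perm_monoid pattern_group)" using group.iso_set_sym[OF gG f] by (simp add: \<psi>_def)
  have \<psi>_GG: "\<psi> x \<in> pattern_group" if "x \<in> carrier L" for x using \<psi>_iso that by (auto simp: iso_def hom_def)
  have \<psi>_f: "\<psi> (f g) = g" if "g \<in> pattern_group" for g unfolding \<psi>_def using bij_betw_inv_into_left[OF f_bij that] .
  have f_\<psi>: "f (\<psi> x) = x" if "x \<in> carrier L" for x unfolding \<psi>_def using bij_betw_inv_into_right[OF f_bij that] .
  have fL: "f g \<in> carrier L" if "g \<in> pattern_group" for g using f_bij that by (auto simp: bij_betw_def)
  interpret L: group L by fact
  interpret fh: group_hom "perm_monoid pattern_group" L f
    using f gG L(1) by (simp add: group_hom_def group_hom_axioms_def iso_def)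
  interpret rep: highly_transitive_rep L \<psi>
  proof
    fix x assume x: "x \<in> carrier L"
    show "bij (\<psi> x)" by (rule pattern_group_closed(3)[OF \<psi>_GG[OF x]])
    show "infinite {w. \<psi> x w \<noteq> w}" if "x \<noteq> \<one>\<^bsub>L\<^esub>"
    proof (rule pattern_group_infinite_support[OF \<psi>_GG[OF x]])
      have "f id = \<one>\<^bsub>L\<^esub>" using fh.hom_one by simp
      then show "\<psi> x \<noteq> id" using that f_\<psi>[OF x] by auto
    qed
    fix y assume y: "y \<in> carrier L"
    show "\<psi> (x \<otimes>\<^bsub>L\<^esub> y) = \<psi> x \<circ> \<psi> y" using \<psi>_iso x y by (simp add: iso_def hom_def)
  next
    fix xs ys :: "point list" assume "length xs = length ys" "distinct xs" "distinct ys"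
    then obtain g where "g \<in> pattern_group" "map g xs = ys" using pattern_group_highly_transitive by blast
    then show "\<exists>x\<in>carrier L. map (\<psi> x) xs = ys" using fL \<psi>_f by (intro bexI[of _ "f g"]) simp_all
  next
    show "infinite (UNIV :: point set)" by (simp add: finite_prod infinite_UNIV_int)
  qed
  have "infinite (UNIV :: point set)" by (rule rep.infinite_space)
  then have b: "bij (to_nat_on (UNIV :: point set))" by (intro to_nat_on_infinite) auto
  have "highly_transitive L"
    unfolding highly_transitive_def
    using L(1) rep.infinite_carrier rep.highly_transitive_action[OF b] by blast
  moreover have "finitely_generated L"
  proof -
    have gens: "gens \<subseteq> carrier (perm_monoid pattern_group)" using gens_pattern_group by simp
    have "generate (perm_monoid pattern_group) gens = pattern_group"
      using group.generate_consistent[OF group_perm_monoid[OF perm_group_bij] gens_pattern_group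
          subgroup_perm_monoid[OF perm_group_bij perm_group_pattern_group]] pattern_group_closed(3)
      by (auto simp: pattern_group_def)
    then have "generate L (f ` gens) = carrier L"
      using fh.generate_img[OF gens] f_bij by (simp add: bij_betw_def)
    moreover have "f ` gens \<subseteq> carrier L" using fL gens_pattern_group by auto
    ultimately show ?thesis using L(1) finite_gens unfolding finitely_generated_def by blast
  qed
  moreover have "embeds H L"
  proof -
    let ?e = "\<lambda>h. f (fibre_emb V (\<rho> (h, 0)))"
    have \<rho>HH: "\<rho> (h, 0) \<in> HH" if "h \<in> carrier H" for h
      using \<rho> that by (auto simp: iso_def hom_def carr)
    have "?e \<in> hom H L"
    proof (rule homI)
      fix g h assume gh: "g \<in> carrier H" "h \<in> carrier H"
      then have "\<rho> (g \<otimes>\<^bsub>H\<^esub> h, 0) = \<rho> (g, 0) \<circ> \<rho> (h, 0)"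
        using \<rho> hom_mult[of \<rho> ?H "perm_monoid HH" "(g, 0)" "(h, 0)"] by (simp add: iso_def carr)
      then have "?e (g \<otimes>\<^bsub>H\<^esub> h) = f (fibre_emb V (\<rho> (g, 0)) \<otimes>\<^bsub>perm_monoid pattern_group\<^esub> fibre_emb V (\<rho> (h, 0)))"
        by (simp add: fibre_emb_comp)
      also have "\<dots> = ?e g \<otimes>\<^bsub>L\<^esub> ?e h" using fibre_emb_pattern_group[OF \<rho>HH] gh by (intro fh.hom_mult) simp_all
      finally show "?e (g \<otimes>\<^bsub>H\<^esub> h) = ?e g \<otimes>\<^bsub>L\<^esub> ?e h" .
    qed (use fL fibre_emb_pattern_group \<rho>HH in blast)
    moreover have "inj_on ?e (carrier H)"
    proof (rule inj_onI)
      fix g h assume gh: "g \<in> carrier H" "h \<in> carrier H" "?e g = ?e h"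
      then have "fibre_emb V (\<rho> (g, 0)) = fibre_emb V (\<rho> (h, 0))" using \<psi>_f[OF fibre_emb_pattern_group[OF \<rho>HH]] by metis
      then have "\<rho> (g, 0) = \<rho> (h, 0)" by (rule fibre_emb_inj)
      then have "(g, 0 :: int) = (h, 0)" using \<rho> gh by (auto simp: iso_def bij_betw_def carr dest: inj_onD)
      then show "g = h" by simp
    qed
    ultimately show ?thesis unfolding embeds_def mon_def by blast
  qed
  ultimately show ?thesis using L rep.mixed_identity_free by blast
qed

end

section \<open>The three classes of groups\<close>

interpretation amenable: group_class "amenable :: nat monoid \<Rightarrow> bool"
proof
  fix G :: "nat monoid" and \<K> assume G: "group G" "\<K> \<noteq> {}"
    "\<And>K. K \<in> \<K> \<Longrightarrow> subgroup K G" "\<And>K. K \<in> \<K> \<Longrightarrow> amenable (G\<lparr>carrier := K\<rparr>)"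
    "\<And>K L. K \<in> \<K> \<Longrightarrow> L \<in> \<K> \<Longrightarrow> \<exists>M\<in>\<K>. K \<union> L \<subseteq> M" "\<Union>\<K> = carrier G"
  show "amenable G" by (rule amenable_union[OF G])
qed (rule amenable_finite amenable_abelian amenable_extension; assumption)+

interpretation no_free: group_class "no_free_pair :: nat monoid \<Rightarrow> bool"
proof
  fix G :: "nat monoid" and \<K> assume G: "group G" "\<K> \<noteq> {}"
    "\<And>K. K \<in> \<K> \<Longrightarrow> subgroup K G" "\<And>K. K \<in> \<K> \<Longrightarrow> no_free_pair (G\<lparr>carrier := K\<rparr>)"
    "\<And>K L. K \<in> \<K> \<Longrightarrow> L \<in> \<K> \<Longrightarrow> \<exists>M\<in>\<K>. K \<union> L \<subseteq> M" "\<Union>\<K> = carrier G"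
  show "no_free_pair G" by (rule no_free_pair_union[OF G(1,3-6)])
qed (rule no_free_pair_finite no_free_pair_abelian no_free_pair_extension; assumption)+

lemma elementary_amenable_surj:
  assumes "group K" "group Q" "\<pi> \<in> hom K Q" "\<pi> ` carrier K = carrier Q"
  shows "Q \<cong> K Mod kernel K Q \<pi>" "kernel K Q \<pi> \<lhd> K"
proof -
  interpret group_hom K Q \<pi> using assms by (simp add: group_hom_def group_hom_axioms_def)
  show "kernel K Q \<pi> \<lhd> K" by (rule normal_kernel)
  show "Q \<cong> K Mod kernel K Q \<pi>"
    by (rule group.iso_sym[OF normal.factorgroup_is_group[OF normal_kernel] FactGroup_iso[OF assms(4)]])
qed

interpretation ea: group_class "elementary_amenable :: nat monoid \<Rightarrow> bool"
proof
  fix K Q :: "nat monoid" and \<pi>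
  assume K: "group K" and Q: "group Q" and \<pi>: "\<pi> \<in> hom K Q"
    and ker: "elementary_amenable (K\<lparr>carrier := kernel K Q \<pi>\<rparr>)" and eaQ: "elementary_amenable Q"
  note r = hom_restrict_subgroup[OF K Q \<pi> group.subgroup_self[OF K]]
  \<comment> \<open>The rule \<open>extension\<close> speaks of \<open>G Mod N\<close>, so
    \<open>Q\<close> is cut down to the image of \<open>\<pi>\<close>; the image is elementary
    amenable by the rule \<open>subgroup\<close>.\<close>
  let ?Q = "Q\<lparr>carrier := \<pi> ` carrier K\<rparr>"
  have gQ: "group ?Q" using r(2) Q by (rule subgroup.subgroup_is_group)
  have h: "\<pi> \<in> hom K ?Q" using r(3) by simp
  have k: "kernel K ?Q \<pi> = kernel K Q \<pi>" by (simp add: kernel_def)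
  note q = elementary_amenable_surj[OF K gQ h, unfolded k]
  show "elementary_amenable K"
    by (rule elementary_amenable.extension[OF K q(2) ker elementary_amenable.subgroup[OF eaQ r(2)] q(1)]) simp_all
next
  fix G :: "nat monoid" and \<K> assume G: "group G" "\<K> \<noteq> {}"
    "\<And>K. K \<in> \<K> \<Longrightarrow> subgroup K G" "\<And>K. K \<in> \<K> \<Longrightarrow> elementary_amenable (G\<lparr>carrier := K\<rparr>)"
    "\<And>K L. K \<in> \<K> \<Longrightarrow> L \<in> \<K> \<Longrightarrow> \<exists>M\<in>\<K>. K \<union> L \<subseteq> M" "\<Union>\<K> = carrier G"
  show "elementary_amenable G" by (rule elementary_amenable.directed_union[OF G])
qed (rule elementary_amenable.finite elementary_amenable.abelian; assumption)+

lemma Mod_hom: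
  assumes N: "N \<lhd> G" and Q: "group Q" "Q \<cong> G Mod N"
  obtains \<pi> where "\<pi> \<in> hom G Q" "\<pi> ` carrier G = carrier Q" "kernel G Q \<pi> = N"
proof -
  interpret normal N G by fact
  have gM: "group (G Mod N)" by (rule factorgroup_is_group)
  obtain h where h: "h \<in> iso (G Mod N) Q" using group.iso_sym[OF Q] by (auto simp: is_iso_def)
  interpret h: group_hom "G Mod N" Q h
    using h gM Q(1) by (simp add: group_hom_def group_hom_axioms_def iso_def)
  let ?\<pi> = "h \<circ> (\<lambda>a. N #>\<^bsub>G\<^esub> a)"
  have hom: "?\<pi> \<in> hom G Q" by (rule Group.hom_compose[OF r_coset_hom_Mod h.homh])
  have c: "carrier (G Mod N) = (\<lambda>a. N #>\<^bsub>G\<^esub> a) ` carrier G" by (auto simp: FactGroup_def RCOSETS_def)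
  have img: "?\<pi> ` carrier G = carrier Q" using h by (simp add: iso_def bij_betw_def c image_comp)
  have "?\<pi> a = \<one>\<^bsub>Q\<^esub> \<longleftrightarrow> a \<in> N" if a: "a \<in> carrier G" for a
  proof -
    have inj: "inj_on h (carrier (G Mod N))" using h by (simp add: iso_def bij_betw_def)
    have m: "N #>\<^bsub>G\<^esub> a \<in> carrier (G Mod N)" unfolding c using a by blast
    have o: "\<one>\<^bsub>G Mod N\<^esub> \<in> carrier (G Mod N)" by (rule monoid.one_closed[OF group.is_monoid[OF gM]])
    have "?\<pi> a = \<one>\<^bsub>Q\<^esub> \<longleftrightarrow> h (N #>\<^bsub>G\<^esub> a) = h \<one>\<^bsub>G Mod N\<^esub>" by (simp only: h.hom_one comp_apply)
    also have "\<dots> \<longleftrightarrow> N #>\<^bsub>G\<^esub> a = \<one>\<^bsub>G Mod N\<^esub>" by (rule inj_on_eq_iff[OF inj m o])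
    also have "\<dots> \<longleftrightarrow> a \<in> N"
      using coset_join1[OF _ a subgroup_axioms] coset_join2[OF a subgroup_axioms] by (auto simp: FactGroup_def)
    finally show ?thesis .
  qed
  then have "kernel G Q ?\<pi> = N" using subset by (auto simp: kernel_def)
  then show ?thesis using that hom img by blast
qed

text \<open>A countable subgroup of the quotient is the image of a countable subgroup of
  \<open>G\<close>, generated by countably many preimages. The rule \<open>quotient\<close> is then
  applied to copies of both on \<open>nat\<close>.\<close>

lemma ea_locally_quotient:
  assumes G: "ea.locally_in_class G" and Q: "group Q" and \<pi>: "\<pi> \<in> hom G Q" "\<pi> ` carrier G = carrier Q"
  shows "ea.locally_in_class Q"
  unfolding ea.locally_in_class_def
proof (intro conjI allI impI)
  fix B assume B: "subgroup B Q" "countable B"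
  have gG: "group G" using G by (simp add: ea.locally_in_class_def)
  interpret group_hom G Q \<pi> using gG Q \<pi> by (simp add: group_hom_def group_hom_axioms_def)
  have BQ: "B \<subseteq> \<pi> ` carrier G" using subgroup.subset[OF B(1)] \<pi>(2) by simp
  then obtain T where T: "T \<subseteq> carrier G" "countable T" "\<pi> ` T = B"
    using countable_subset_image[of B \<pi> "carrier G"] B(2) by blast
  let ?B = "generate G T"
  have sB: "subgroup ?B G" by (rule G.generate_is_subgroup[OF T(1)])
  have "\<pi> ` ?B = generate Q B" using generate_img[OF T(1)] T(3) by simp
  also have "\<dots> = B"
    using H.generate_subgroup_incl[OF subset_refl B(1)] by (auto intro: generate.incl)
  finally have img: "\<pi> ` ?B = B" .
  have "ea.copy_in_class (G\<lparr>carrier := ?B\<rparr>)"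
    using G sB countable_generate[OF gG T(1,2)] by (simp add: ea.locally_in_class_def)
  then obtain L f where L: "group L" "elementary_amenable (L :: nat monoid)" "f \<in> iso (G\<lparr>carrier := ?B\<rparr>) L"
    by (auto simp: ea.copy_in_class_def)
  have gB: "group (Q\<lparr>carrier := B\<rparr>)" by (rule subgroup.subgroup_is_group[OF B(1) Q])
  have gB': "group (G\<lparr>carrier := ?B\<rparr>)" by (rule subgroup.subgroup_is_group[OF sB gG])
  have cB: "countable (carrier (Q\<lparr>carrier := B\<rparr>))" using B(2) by simp
  obtain M :: "nat monoid" and g where M: "group M" "g \<in> iso (Q\<lparr>carrier := B\<rparr>) M"
    by (rule countable_nat_copy[OF gB cB])
  let ?f = "inv_into (carrier (G\<lparr>carrier := ?B\<rparr>)) f"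
  have f': "?f \<in> iso L (G\<lparr>carrier := ?B\<rparr>)" by (rule group.iso_set_sym[OF gB' L(3)])
  have p: "\<pi> \<in> hom (G\<lparr>carrier := ?B\<rparr>) (Q\<lparr>carrier := B\<rparr>)"
    using hom_restrict_subgroup(3)[OF gG Q \<pi>(1) sB] img by simp
  let ?p = "g \<circ> (\<pi> \<circ> ?f)"
  have hp: "?p \<in> hom L M"
    by (rule Group.hom_compose[OF Group.hom_compose[OF iso_imp_homomorphism[OF f'] p] iso_imp_homomorphism[OF M(2)]])
  have "?f ` carrier L = ?B" using f' by (simp add: iso_def bij_betw_def)
  moreover have "g ` B = carrier M" using M(2) by (simp add: iso_def bij_betw_def)
  ultimately have "?p ` carrier L = carrier M" using img by (simp only: image_comp[symmetric])
  note q = elementary_amenable_surj[OF L(1) M(1) hp this]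
  have "elementary_amenable M" by (rule elementary_amenable.quotient[OF L(2) q(2) M(1) q(1)])
  then show "ea.copy_in_class (Q\<lparr>carrier := B\<rparr>)" using gB M by (auto simp: ea.copy_in_class_def)
qed fact

text \<open>A derivation over the type \<open>'a\<close> is replayed over \<open>nat\<close>. Its
  groups can be uncountable, so the induction carries a statement about their countable
  subgroups.\<close>

lemma elementary_amenable_locally:
  "elementary_amenable G \<Longrightarrow> ea.locally_in_class G"
proof (induction rule: elementary_amenable.induct)
  case (finite G)
  then show ?case by (rule ea.locally_in_class_finite)
next
  case (abelian G)
  then show ?case by (rule ea.locally_in_class_abelian)
next
  case (subgroup G K)
  have "group (G\<lparr>carrier := K\<rparr>)"
    by (rule subgroup.subgroup_is_group[OF subgroup(2) elementary_amenable_group[OF subgroup(1)]])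
  then show ?case
    using subgroup.subset[OF subgroup(2)]
    by (intro ea.locally_in_class_embed[OF _ subgroup.IH, of _ "\<lambda>x. x"]) (auto simp: hom_def)
next
  case (quotient G N Q)
  obtain \<pi> where "\<pi> \<in> hom G Q" "\<pi> ` carrier G = carrier Q" using Mod_hom[OF quotient(2,3,4)] by metis
  then show ?case by (rule ea_locally_quotient[OF quotient.IH quotient(3)])
next
  case (extension G N Q)
  have Q: "group Q" by (rule elementary_amenable_group[OF extension(4)])
  obtain \<pi> where \<pi>: "\<pi> \<in> hom G Q" "kernel G Q \<pi> = N" using Mod_hom[OF extension(2) Q extension(5)] by metis
  show ?case
    by (rule ea.locally_in_class_extension[OF extension(1) extension.IH(2) \<pi>(1)]) (simp add: \<pi>(2) extension.IH(1))
next
  case (directed_union G \<K>)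
  then show ?case by (intro ea.locally_in_class_union[of G \<K>]) auto
qed

theorem corollary1p2:
  fixes H :: "'a monoid"
  assumes "group H" and "countable (carrier H)"
  shows
    "(amenable H \<longrightarrow>
       (\<exists>G :: nat monoid. group G \<and> finitely_generated G \<and> amenable G \<and>
          highly_transitive G \<and> mixed_identity_free G \<and> embeds H G)) \<and>
     (elementary_amenable H \<longrightarrow>
       (\<exists>G :: nat monoid. group G \<and> finitely_generated G \<and> elementary_amenable G \<and>
          highly_transitive G \<and> mixed_identity_free G \<and> embeds H G)) \<and>
     (\<not> has_nonabelian_free_subgroup H \<longrightarrow>
       (\<exists>G :: nat monoid. group G \<and> finitely_generated G \<and> \<not> has_nonabelian_free_subgroup G \<and>
          highly_transitive G \<and> mixed_identity_free G \<and> embeds H G))"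
proof -
  obtain L :: "nat monoid" and f where L: "group L" "f \<in> iso H L"
    by (rule countable_nat_copy[OF assms])
  let ?f = "inv_into (carrier H) f"
  have "?f \<in> iso L H" by (rule group.iso_set_sym[OF assms(1) L(2)])
  then have f': "?f \<in> hom L H" "inj_on ?f (carrier L)" by (simp_all add: iso_def bij_betw_def)
  interpret group_hom L H ?f using L(1) assms(1) f'(1) by (simp add: group_hom_def group_hom_axioms_def)
  have "amenable.locally_in_class H" if am: "amenable H"
  proof -
    \<comment> \<open>Amenability moves from \<open>'a\<close> to \<open>nat\<close> by the
      extension theorem, with the copy \<open>L\<close> as an extension of a trivial kernel.\<close>
    have "kernel L H ?f = {\<one>\<^bsub>L\<^esub>}" using f'(2) inj_iff_trivial_ker by auto
    then have "amenable (L\<lparr>carrier := kernel L H ?f\<rparr>)"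
      using subgroup.subgroup_is_group[OF subgroup_kernel L(1)] by (intro amenable_finite) simp_all
    then have "amenable L" by (rule amenable_extension[OF L(1) assms(1) f'(1) _ am])
    then show ?thesis using L assms(1)
      by (intro amenable.copy_in_class_locally) (auto simp: amenable.copy_in_class_def)
  qed
  moreover have "no_free.locally_in_class H" if nf: "\<not> has_nonabelian_free_subgroup H"
  proof -
    have "no_free_pair L" by (rule no_free_pair_embed[OF L(1) assms(1) f' imp_no_free_pair[OF assms(1) nf]])
    then show ?thesis using L assms(1)
      by (intro no_free.copy_in_class_locally) (auto simp: no_free.copy_in_class_def)
  qed
  ultimately show ?thesis
    using amenable.embeds_highly_transitive[OF assms(1) _ assms(2)]
      ea.embeds_highly_transitive[OF assms(1) elementary_amenable_locally assms(2)]
      no_free.embeds_highly_transitive[OF assms(1) _ assms(2)] no_free_pair_imp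
    by (intro conjI impI) blast+
qed

end
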